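(* For every $N\ge2$ and every forest $F\in\mathcal For'_N$, $$c_F=\sum_{t\in hTub(F)}\frac{(-1)^{|t|-1}}{|t|}\prod_{s\in t}\frac{1}{|\partial s|!}\,\operatorname{sh}_{j(s)_0,\dots,j(s)_{lg(s')}}\prod_{1\le a\le lg(s')}\operatorname{sh}_{f^s_{T_a}(v_1),\dots,f^s_{T_a}(v_{k(T_a)})},$$ where for the minimal tube $s$ of $t$ the factor $\operatorname{sh}_{j(s)_0,\dots,j(s)_{lg(s')}}\prod_{a}\operatorname{sh}_{f^s_{T_a}(v_1),\dots}$ is set equal to $1$.
   Context: $\mathbb K$ is a field of characteristic zero. Let $L$ be the free post-Lie algebra on one generator $x$ (a post-Lie algebra is a Lie algebra with bilinear $\triangleright$ such that $x\triangleright[y,z]=[x\triangleright y,z]+[y,x\triangleright z]$ and $[x,y]\triangleright z=a(x,y,z)-a(y,x,z)$, $a(x,y,z)=x\triangleright(y\triangleright z)-(x\triangleright y)\triangleright z$). In $\mathcal U(L)$ (enveloping algebra of the underlying Lie algebra; concatenation product, counit $\varepsilon$, shuffle coproduct $\Delta X=X_{(1)}\otimes X_{(2)}$ with $L$ primitive), $\triangleright$ extends uniquely to $\mathcal U(L)^{\otimes2}\to\mathcal U(L)$ with $1\triangleright X=X$, $X\triangleright1=\varepsilon(X)1$, $X\triangleright(YZ)=(X_{(1)}\triangleright Y)(X_{(2)}\triangleright Z)$, $(aX)\triangleright b=a\triangleright(X\triangleright b)-(a\triangleright X)\triangleright b$ ($a,b\in L$); the Grossman–Larson product is $X\ast Y=X_{(1)}(X_{(2)}\triangleright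 Y)$. A planar rooted tree has linearly ordered children at each vertex (left to right); a forest is a finite word of planar rooted trees. $\iota$ maps the one-vertex tree to $x$, a tree whose root has children subtrees $T_1,\dots,T_k$ (left to right) to $(\iota(T_1)\cdots\iota(T_k))\triangleright x$, and a forest $T_1\cdots T_k$ to $\iota(T_1)\cdots\iota(T_k)$; these form a basis of $\mathcal U(L)$, graded by number of vertices. In the degree completion, $\chi(x)=\log_\ast(\exp(x))$ with $\exp(x)=\sum_{j\ge0}x^j/j!$ (concatenation product) and $\log_\ast$ the logarithm for $\ast$; the coefficients $c_F$ are defined by $\chi(x)=\sum_F c_F\,\iota(F)$. $\mathcal For_N$ is the set of forests with $N$ vertices, $\bullet^{\times N}$ the forest of $N$ one-vertex trees, $\mathcal For'_N=\mathcal For_N\setminus\{\bullet^{\times N}\}$. Orders: in a tree, $v\prec u$ if $u\neq v$ lies on the path from $v$ to the root; the canonical linear order $<$ is the preorder (root first, children left to right); $\mathfrak b_v$ is the set of descendants of $v$ with order $<$; roots of a forest are ordered left to right ($<_h$). A higher set of a poset is a subset containing every element greater than any of its elements. A tube of a tree $T$ is a connected higher set $t$ of $(V(T),\prec)$ such that for each $v\in t$, $t\cap\mathfrak b_v$ is a higher set of $(\mathfrak b_v,<)$. A tube of a forest $F$ is a subset of $V(F)$ whose intersection with the roots is a higher set for $<_h$ and whose intersection with each tree is empty or a tube of that tree. A nested tubing of $F$ is a set of at least two non-empty, pairwise nested tubes containing $V(F)$; $|t|$ is its number of tubes. For a tube $s$ of $t$, $\partial s=s\setminus\bigcup\{s'\in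 t:s'\subsetneq s\}$. A horizontal nested tubing is one in which, for each tube $s$, no edge of $F$ joins two vertices of $\partial s$; $hTub(F)$ is the set of horizontal nested tubings. For a non-minimal tube $s$, let $s'$ be the largest tube of $t$ strictly contained in $s$ (so $\partial s=s\setminus s'$), and let $T_1,\dots,T_{lg(s')}$ be the trees (from left to right) of the subforest induced on $s'$. Then: $j(s)_0$ is the number of vertices of $\partial s$ that are roots of $F$; for $1\le a\le lg(s')$, $j(s)_a$ is the number of vertices of $\partial s$ whose parent lies in $T_a$; for a vertex $v$ of $T_a$, $f^s_{T_a}(v)$ is the number of vertices of $\partial s$ whose parent is $v$; $v_1,\dots,v_{k(T_a)}$ are the vertices $v$ of $T_a$ with $f^s_{T_a}(v)\ne0$. For nonnegative integers, $\operatorname{sh}_{q_1,\dots,q_k}=\frac{(q_1+\dots+q_k)!}{q_1!\cdots q_k!}$.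
   Formalization: The set 𝔟_v is taken to be the direct descendants (children) of v rather than all descendants; with all descendants the three-vertex ladder has no horizontal nested tubing, although its coefficient is 1/3. *)

theory Defs
  imports Complex_Main "HOL-Library.Sublist"
begin

section \<open>Post-Lie algebras\<close>

locale post_lie = vector_space scale
  for scale :: "'k::field_char_0 \<Rightarrow> 'a::ab_group_add \<Rightarrow> 'a" +
  fixes br :: "'a \<Rightarrow> 'a \<Rightarrow> 'a"
    and tri :: "'a \<Rightarrow> 'a \<Rightarrow> 'a"
  assumes br_linear_left: "Vector_Spaces.linear scale scale (\<lambda>a. br a b)"
    and br_linear_right: "Vector_Spaces.linear scale scale (br a)"
    and br_alternating: "br a a = 0"
    and jacobi: "br a (br b c) + br b (br c a) + br c (br a b) = 0"
    and tri_linear_left: "Vector_Spaces.linear scale scale (\<lambda>a. tri a b)"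
    and tri_linear_right: "Vector_Spaces.linear scale scale (tri a)"
    and tri_derivation: "tri a (br b c) = br (tri a b) c + br b (tri a c)"
    and tri_associator:
      "tri (br a b) c = (tri a (tri b c) - tri (tri a b) c) - (tri b (tri a c) - tri (tri b a) c)"

section \<open>The free post-Lie algebra on one generator\<close>

text \<open>Terms in one generator modulo the congruence generated by the axioms of a post-Lie
  algebra over the field; \<open>free_plie_universal\<close> below is the universal property.\<close>

datatype 'k plterm =
    PGen
  | PZero
  | PAdd "'k plterm" "'k plterm"
  | PScale 'k "'k plterm"
  | PBr "'k plterm" "'k plterm"
  | PTri "'k plterm" "'k plterm"

abbreviation PMinus :: "'k::field_char_0 plterm \<Rightarrow> 'k plterm \<Rightarrow> 'k plterm" where
  "PMinus a b \<equiv> PAdd a (PScale (- 1) b)"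

inductive pl_eq :: "'k::field_char_0 plterm \<Rightarrow> 'k plterm \<Rightarrow> bool" where
  pl_refl: "pl_eq a a"
| pl_sym: "pl_eq a b \<Longrightarrow> pl_eq b a"
| pl_trans: "pl_eq a b \<Longrightarrow> pl_eq b c \<Longrightarrow> pl_eq a c"
| cong_add: "pl_eq a a' \<Longrightarrow> pl_eq b b' \<Longrightarrow> pl_eq (PAdd a b) (PAdd a' b')"
| cong_scale: "pl_eq a a' \<Longrightarrow> pl_eq (PScale k a) (PScale k a')"
| cong_br: "pl_eq a a' \<Longrightarrow> pl_eq b b' \<Longrightarrow> pl_eq (PBr a b) (PBr a' b')"
| cong_tri: "pl_eq a a' \<Longrightarrow> pl_eq b b' \<Longrightarrow> pl_eq (PTri a b) (PTri a' b')"
| add_assoc: "pl_eq (PAdd (PAdd a b) c) (PAdd a (PAdd b c))"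
| add_comm: "pl_eq (PAdd a b) (PAdd b a)"
| add_zero: "pl_eq (PAdd PZero a) a"
| scale_zero: "pl_eq (PScale 0 a) PZero"
| scale_one: "pl_eq (PScale 1 a) a"
| scale_scale: "pl_eq (PScale k (PScale l a)) (PScale (k * l) a)"
| scale_add_left: "pl_eq (PScale (k + l) a) (PAdd (PScale k a) (PScale l a))"
| scale_add_right: "pl_eq (PScale k (PAdd a b)) (PAdd (PScale k a) (PScale k b))"
| br_add_left: "pl_eq (PBr (PAdd a b) c) (PAdd (PBr a c) (PBr b c))"
| br_add_right: "pl_eq (PBr a (PAdd b c)) (PAdd (PBr a b) (PBr a c))"
| br_scale_left: "pl_eq (PBr (PScale k a) b) (PScale k (PBr a b))"
| br_scale_right: "pl_eq (PBr a (PScale k b)) (PScale k (PBr a b))"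
| br_alt: "pl_eq (PBr a a) PZero"
| br_jacobi: "pl_eq (PAdd (PAdd (PBr a (PBr b c)) (PBr b (PBr c a))) (PBr c (PBr a b))) PZero"
| tri_add_left: "pl_eq (PTri (PAdd a b) c) (PAdd (PTri a c) (PTri b c))"
| tri_add_right: "pl_eq (PTri a (PAdd b c)) (PAdd (PTri a b) (PTri a c))"
| tri_scale_left: "pl_eq (PTri (PScale k a) b) (PScale k (PTri a b))"
| tri_scale_right: "pl_eq (PTri a (PScale k b)) (PScale k (PTri a b))"
| tri_br: "pl_eq (PTri a (PBr b c)) (PAdd (PBr (PTri a b) c) (PBr b (PTri a c)))"
| br_tri: "pl_eq (PTri (PBr a b) c)
    (PMinus (PMinus (PTri a (PTri b c)) (PTri (PTri a b) c))
            (PMinus (PTri b (PTri a c)) (PTri (PTri b a) c)))"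

quotient_type (overloaded) 'k free_plie = "'k::field_char_0 plterm" / pl_eq
  by (rule equivpI) (auto intro: reflpI sympI transpI pl_refl pl_sym pl_trans)

lift_definition pgen :: "'k::field_char_0 free_plie" is PGen .

lift_definition pscale :: "'k::field_char_0 \<Rightarrow> 'k free_plie \<Rightarrow> 'k free_plie" is PScale
  by (rule cong_scale)

lift_definition pbr :: "'k::field_char_0 free_plie \<Rightarrow> 'k free_plie \<Rightarrow> 'k free_plie" is PBr
  by (rule cong_br)

lift_definition ptri :: "'k::field_char_0 free_plie \<Rightarrow> 'k free_plie \<Rightarrow> 'k free_plie" is PTri
  by (rule cong_tri)

instantiation free_plie :: (field_char_0) ab_group_add
begin

lift_definition zero_free_plie :: "'a free_plie" is PZero .
lift_definition plus_free_plie :: "'a free_plie \<Rightarrow> 'a free_plie \<Rightarrow> 'a free_plie" is PAdd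
  by (rule cong_add)
lift_definition uminus_free_plie :: "'a free_plie \<Rightarrow> 'a free_plie" is "PScale (- 1)"
  by (rule cong_scale)
lift_definition minus_free_plie :: "'a free_plie \<Rightarrow> 'a free_plie \<Rightarrow> 'a free_plie" is PMinus
  by (intro cong_add cong_scale)

instance
proof
  fix a b c :: "'a free_plie"
  show "a + b + c = a + (b + c)" by transfer (rule add_assoc)
  show "a + b = b + a" by transfer (rule add_comm)
  show "0 + a = a" by transfer (rule add_zero)
  show "- a + a = 0"
  proof transfer
    fix a :: "'a plterm"
    have "pl_eq (PAdd (PScale (- 1) a) a) (PAdd (PScale (- 1) a) (PScale 1 a))"
      by (intro cong_add pl_refl pl_sym[OF scale_one])
    moreover have "pl_eq (PAdd (PScale (- 1) a) (PScale 1 a)) (PScale (- 1 + 1) a)"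
      by (rule pl_sym[OF scale_add_left])
    moreover have "pl_eq (PScale (- 1 + 1) a) PZero"
      using scale_zero[of a] by simp
    ultimately show "pl_eq (PAdd (PScale (- 1) a) a) PZero" by (meson pl_trans)
  qed
  show "a - b = a + - b" by transfer (rule pl_refl)
qed

end

interpretation plie_vs: vector_space "pscale :: 'k::field_char_0 \<Rightarrow> _"
proof
  fix k l :: 'k and a b :: "'k free_plie"
  show "pscale k (a + b) = pscale k a + pscale k b" by transfer (rule scale_add_right)
  show "pscale (k + l) a = pscale k a + pscale l a" by transfer (rule scale_add_left)
  show "pscale k (pscale l a) = pscale (k * l) a" by transfer (rule scale_scale)
  show "pscale 1 a = a" by transfer (rule scale_one)
qed

interpretation plie: post_lie "pscale :: 'k::field_char_0 \<Rightarrow> _" pbr ptri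
proof unfold_locales
  fix k :: 'k and a b c d :: "'k free_plie"
  show "pbr (a + d) b = pbr a b + pbr d b" by transfer (rule br_add_left)
  show "pbr (pscale k a) b = pscale k (pbr a b)" by transfer (rule br_scale_left)
  show "pbr a (b + d) = pbr a b + pbr a d" by transfer (rule br_add_right)
  show "pbr a (pscale k b) = pscale k (pbr a b)" by transfer (rule br_scale_right)
  show "pbr a a = 0" by transfer (rule br_alt)
  show "pbr a (pbr b c) + pbr b (pbr c a) + pbr c (pbr a b) = 0" by transfer (rule br_jacobi)
  show "ptri (a + d) b = ptri a b + ptri d b" by transfer (rule tri_add_left)
  show "ptri (pscale k a) b = pscale k (ptri a b)" by transfer (rule tri_scale_left)
  show "ptri a (b + d) = ptri a b + ptri a d" by transfer (rule tri_add_right)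
  show "ptri a (pscale k b) = pscale k (ptri a b)" by transfer (rule tri_scale_right)
  show "ptri a (pbr b c) = pbr (ptri a b) c + pbr b (ptri a c)" by transfer (rule tri_br)
  show "ptri (pbr a b) c
      = (ptri a (ptri b c) - ptri (ptri a b) c) - (ptri b (ptri a c) - ptri (ptri b a) c)"
    by transfer (rule br_tri)
qed

context post_lie
begin

primrec pl_eval :: "'a \<Rightarrow> 'k plterm \<Rightarrow> 'a" where
  "pl_eval g PGen = g"
| "pl_eval g PZero = 0"
| "pl_eval g (PAdd s t) = pl_eval g s + pl_eval g t"
| "pl_eval g (PScale k s) = scale k (pl_eval g s)"
| "pl_eval g (PBr s t) = br (pl_eval g s) (pl_eval g t)"
| "pl_eval g (PTri s t) = tri (pl_eval g s) (pl_eval g t)"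

lemma pl_linear_simps:
  "br (a + b) c = br a c + br b c" "br a (b + c) = br a b + br a c"
  "br (scale k a) b = scale k (br a b)" "br a (scale k b) = scale k (br a b)"
  "tri (a + b) c = tri a c + tri b c" "tri a (b + c) = tri a b + tri a c"
  "tri (scale k a) b = scale k (tri a b)" "tri a (scale k b) = scale k (tri a b)"
  using br_linear_left br_linear_right tri_linear_left tri_linear_right
  by (simp_all add: Vector_Spaces.linear_iff)

lemma pl_eval_cong: "pl_eq s t \<Longrightarrow> pl_eval g s = pl_eval g t"
proof (induction rule: pl_eq.induct)
  case (br_tri a b c)
  then show ?case by (simp add: tri_associator)
qed (simp_all add: pl_linear_simps scale_left_distrib scale_right_distrib br_alternating jacobi
  tri_derivation)

theorem free_plie_universal:
  "\<exists>!f :: 'k free_plie \<Rightarrow> 'a. Vector_Spaces.linear pscale scale f \<and> f pgen = g \<and>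
    (\<forall>a b. f (pbr a b) = br (f a) (f b)) \<and> (\<forall>a b. f (ptri a b) = tri (f a) (f b))"
    (is "\<exists>!f. ?P f")
proof (rule ex1I)
  define f where "f = (\<lambda>a. pl_eval g (rep_free_plie a))"
  have f_abs: "f (abs_free_plie t) = pl_eval g t" for t
    unfolding f_def
    by (rule pl_eval_cong) (metis Quotient3_free_plie Quotient3_rep_abs pl_refl)
  have "f (a + b) = f a + f b" for a b
    by (induction a; induction b) (simp add: plus_free_plie.abs_eq f_abs)
  moreover have "f (pscale k a) = scale k (f a)" for k a
    by (induction a) (simp add: pscale.abs_eq f_abs)
  moreover have "f (pbr a b) = br (f a) (f b)" for a b
    by (induction a; induction b) (simp add: pbr.abs_eq f_abs)
  moreover have "f (ptri a b) = tri (f a) (f b)" for a b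
    by (induction a; induction b) (simp add: ptri.abs_eq f_abs)
  moreover have "f pgen = g"
    by (simp add: pgen_def f_abs)
  ultimately show "?P f"
    by (simp add: Vector_Spaces.linear_iff vector_space_axioms plie_vs.vector_space_axioms)
next
  fix h assume h: "?P h"
  then have lin: "h (a + b) = h a + h b" "h (pscale k a) = scale k (h a)" for a b k
    by (simp_all add: Vector_Spaces.linear_iff)
  have "h 0 = 0"
    using lin(1)[of 0 0] by simp
  have "h (abs_free_plie t) = pl_eval g t" for t
    by (induction t)
       (use h lin \<open>h 0 = 0\<close> in \<open>simp_all flip: pgen_def zero_free_plie_def plus_free_plie.abs_eq
         pscale.abs_eq pbr.abs_eq ptri.abs_eq\<close>)
  then show "h = (\<lambda>a. pl_eval g (rep_free_plie a))"
    by (metis Quotient3_free_plie Quotient3_abs_rep)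
qed

end


section \<open>The enveloping algebra\<close>

text \<open>The unital associative algebra generated by the vector space \<open>L\<close>, subject to
  \<open>[a,b] = ab - ba\<close>.\<close>

context notes [[typedef_overloaded]]
begin

datatype (dead 'k::field_char_0) uterm =
    UInc "'k free_plie"
  | UOne
  | UZero
  | UAdd "'k uterm" "'k uterm"
  | UScale 'k "'k uterm"
  | UMul "'k uterm" "'k uterm"

end

inductive u_eq :: "'k::field_char_0 uterm \<Rightarrow> 'k uterm \<Rightarrow> bool" where
  u_refl: "u_eq X X"
| u_sym: "u_eq X Y \<Longrightarrow> u_eq Y X"
| u_trans: "u_eq X Y \<Longrightarrow> u_eq Y Z \<Longrightarrow> u_eq X Z"
| ucong_add: "u_eq X X' \<Longrightarrow> u_eq Y Y' \<Longrightarrow> u_eq (UAdd X Y) (UAdd X' Y')"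
| ucong_scale: "u_eq X X' \<Longrightarrow> u_eq (UScale k X) (UScale k X')"
| ucong_mul: "u_eq X X' \<Longrightarrow> u_eq Y Y' \<Longrightarrow> u_eq (UMul X Y) (UMul X' Y')"
| uadd_assoc: "u_eq (UAdd (UAdd X Y) Z) (UAdd X (UAdd Y Z))"
| uadd_comm: "u_eq (UAdd X Y) (UAdd Y X)"
| uadd_zero: "u_eq (UAdd UZero X) X"
| uscale_zero: "u_eq (UScale 0 X) UZero"
| uscale_one: "u_eq (UScale 1 X) X"
| uscale_scale: "u_eq (UScale k (UScale l X)) (UScale (k * l) X)"
| uscale_add_left: "u_eq (UScale (k + l) X) (UAdd (UScale k X) (UScale l X))"
| uscale_add_right: "u_eq (UScale k (UAdd X Y)) (UAdd (UScale k X) (UScale k Y))"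
| umul_assoc: "u_eq (UMul (UMul X Y) Z) (UMul X (UMul Y Z))"
| umul_one_left: "u_eq (UMul UOne X) X"
| umul_one_right: "u_eq (UMul X UOne) X"
| umul_add_left: "u_eq (UMul (UAdd X Y) Z) (UAdd (UMul X Z) (UMul Y Z))"
| umul_add_right: "u_eq (UMul X (UAdd Y Z)) (UAdd (UMul X Y) (UMul X Z))"
| umul_scale_left: "u_eq (UMul (UScale k X) Y) (UScale k (UMul X Y))"
| umul_scale_right: "u_eq (UMul X (UScale k Y)) (UScale k (UMul X Y))"
| uinc_add: "u_eq (UInc (a + b)) (UAdd (UInc a) (UInc b))"
| uinc_scale: "u_eq (UInc (pscale k a)) (UScale k (UInc a))"
| uinc_br: "u_eq (UInc (pbr a b))
    (UAdd (UMul (UInc a) (UInc b)) (UScale (- 1) (UMul (UInc b) (UInc a))))"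

quotient_type (overloaded) 'k env = "'k::field_char_0 uterm" / u_eq
  by (rule equivpI) (auto intro: reflpI sympI transpI u_refl u_sym u_trans)

lift_definition inc :: "'k::field_char_0 free_plie \<Rightarrow> 'k env" is UInc .

lift_definition uscale :: "'k::field_char_0 \<Rightarrow> 'k env \<Rightarrow> 'k env" is UScale
  by (rule ucong_scale)

primrec counit_term :: "'k::field_char_0 uterm \<Rightarrow> 'k" where
  "counit_term (UInc a) = 0"
| "counit_term UOne = 1"
| "counit_term UZero = 0"
| "counit_term (UAdd X Y) = counit_term X + counit_term Y"
| "counit_term (UScale k X) = k * counit_term X"
| "counit_term (UMul X Y) = counit_term X * counit_term Y"

lift_definition counit :: "'k::field_char_0 env \<Rightarrow> 'k" is counit_term
proof -
  fix X Y :: "'k uterm" assume "u_eq X Y"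
  then show "counit_term X = counit_term Y"
    by (induction rule: u_eq.induct) (simp_all add: algebra_simps)
qed

instantiation env :: (field_char_0) ring_1
begin

lift_definition zero_env :: "'a env" is UZero .
lift_definition one_env :: "'a env" is UOne .
lift_definition plus_env :: "'a env \<Rightarrow> 'a env \<Rightarrow> 'a env" is UAdd
  by (rule ucong_add)
lift_definition uminus_env :: "'a env \<Rightarrow> 'a env" is "UScale (- 1)"
  by (rule ucong_scale)
lift_definition minus_env :: "'a env \<Rightarrow> 'a env \<Rightarrow> 'a env" is "\<lambda>X Y. UAdd X (UScale (- 1) Y)"
  by (intro ucong_add ucong_scale)
lift_definition times_env :: "'a env \<Rightarrow> 'a env \<Rightarrow> 'a env" is UMul
  by (rule ucong_mul)

instance
proof
  fix X Y Z :: "'a env"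
  show "X + Y + Z = X + (Y + Z)" by transfer (rule uadd_assoc)
  show "X + Y = Y + X" by transfer (rule uadd_comm)
  show "0 + X = X" by transfer (rule uadd_zero)
  show "- X + X = 0"
  proof transfer
    fix X :: "'a uterm"
    have "u_eq (UAdd (UScale (- 1) X) X) (UAdd (UScale (- 1) X) (UScale 1 X))"
      by (intro ucong_add u_refl u_sym[OF uscale_one])
    moreover have "u_eq (UAdd (UScale (- 1) X) (UScale 1 X)) (UScale (- 1 + 1) X)"
      by (rule u_sym[OF uscale_add_left])
    moreover have "u_eq (UScale (- 1 + 1) X) UZero"
      using uscale_zero[of X] by simp
    ultimately show "u_eq (UAdd (UScale (- 1) X) X) UZero" by (meson u_trans)
  qed
  show "X - Y = X + - Y" by transfer (rule u_refl)
  show "X * Y * Z = X * (Y * Z)" by transfer (rule umul_assoc)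
  show "1 * X = X" by transfer (rule umul_one_left)
  show "X * 1 = X" by transfer (rule umul_one_right)
  show "(X + Y) * Z = X * Z + Y * Z" by transfer (rule umul_add_left)
  show "X * (Y + Z) = X * Y + X * Z" by transfer (rule umul_add_right)
  have "counit (0 :: 'a env) \<noteq> counit 1" by transfer simp
  then show "(0 :: 'a env) \<noteq> 1" by metis
qed

end

interpretation env_vs: vector_space "uscale :: 'k::field_char_0 \<Rightarrow> _"
proof
  fix k l :: 'k and X Y :: "'k env"
  show "uscale k (X + Y) = uscale k X + uscale k Y" by transfer (rule uscale_add_right)
  show "uscale (k + l) X = uscale k X + uscale l X" by transfer (rule uscale_add_left)
  show "uscale k (uscale l X) = uscale (k * l) X" by transfer (rule uscale_scale)
  show "uscale 1 X = X" by transfer (rule uscale_one)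
qed

lemma inc_add: "inc (a + b) = inc a + inc b"
  by transfer (rule uinc_add)

lemma inc_scale: "inc (pscale k a) = uscale k (inc a)"
  by transfer (rule uinc_scale)

lemma inc_br: "inc (pbr a b) = inc a * inc b - inc b * inc a"
  by transfer (rule uinc_br)

lemma uscale_mult_left: "uscale k X * Y = uscale k (X * Y)"
  by transfer (rule umul_scale_left)

lemma uscale_mult_right: "X * uscale k Y = uscale k (X * Y)"
  by transfer (rule umul_scale_right)

lemma counit_simps:
  "counit (inc a) = 0" "counit 1 = 1" "counit 0 = 0" "counit (X + Y) = counit X + counit Y"
  "counit (uscale k X) = k * counit X" "counit (X * Y) = counit X * counit Y"
  by (transfer, simp)+

section \<open>The tensor square of the enveloping algebra and the coproduct\<close>

text \<open>A list of pairs stands for the sum of the pure tensors of its entries.\<close>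

inductive t_eq :: "('k::field_char_0 env \<times> 'k env) list \<Rightarrow> ('k env \<times> 'k env) list \<Rightarrow> bool" where
  t_refl: "t_eq p p"
| t_sym: "t_eq p q \<Longrightarrow> t_eq q p"
| t_trans: "t_eq p q \<Longrightarrow> t_eq q r \<Longrightarrow> t_eq p r"
| tcong_append: "t_eq p p' \<Longrightarrow> t_eq q q' \<Longrightarrow> t_eq (p @ q) (p' @ q')"
| tcomm: "t_eq (p @ q) (q @ p)"
| tzero: "t_eq [(0, Y)] []"
| tadd_left: "t_eq [(X + X', Y)] [(X, Y), (X', Y)]"
| tadd_right: "t_eq [(X, Y + Y')] [(X, Y), (X, Y')]"
| tscale_swap: "t_eq [(uscale k X, Y)] [(X, uscale k Y)]"

quotient_type (overloaded) 'k tens = "('k::field_char_0 env \<times> 'k env) list" / t_eq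
  by (rule equivpI) (auto intro: reflpI sympI transpI t_refl t_sym t_trans)

lift_definition pure :: "'k::field_char_0 env \<Rightarrow> 'k env \<Rightarrow> 'k tens" 
  is "\<lambda>(X :: 'k env) (Y :: 'k env). [(X, Y)]" .

lift_definition tscale :: "'k::field_char_0 \<Rightarrow> 'k tens \<Rightarrow> 'k tens"
  is "\<lambda>k. map (\<lambda>(X, Y :: 'k env). (uscale k X, Y))"
proof -
  fix k :: 'k and p q :: "('k env \<times> 'k env) list"
  assume "t_eq p q"
  then show "t_eq (map (\<lambda>(X, Y). (uscale k X, Y)) p) (map (\<lambda>(X, Y). (uscale k X, Y)) q)"
  proof (induction rule: t_eq.induct)
    case (tscale_swap l X Y)
    from t_eq.tscale_swap[of l "uscale k X" Y] show ?case
      by (simp add: mult.commute)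
  qed ((simp add: env_vs.scale_right_distrib)?,
    (rule t_refl tcomm tzero tadd_left tadd_right | erule t_sym | erule (1) t_trans tcong_append))+
qed

definition tmul :: "('k::field_char_0 env \<times> 'k env) list \<Rightarrow> ('k env \<times> 'k env) list \<Rightarrow>
    ('k env \<times> 'k env) list" where
  "tmul p q = concat (map (\<lambda>(X, Y). map (\<lambda>(X', Y'). (X * X', Y * Y')) q) p)"

lemma tmul_Nil [simp]: "tmul [] q = []" "tmul p [] = []"
  by (induction p) (auto simp: tmul_def)

lemma tmul_append: "tmul (p @ p') q = tmul p q @ tmul p' q"
  by (simp add: tmul_def)

lemma tmul_Cons: "tmul (x # p) q = tmul [x] q @ tmul p q"
  by (simp add: tmul_def)

lemma t_eq_interchange: "t_eq ((p @ q) @ (p' @ q')) ((p @ p') @ (q @ q'))"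
proof -
  have "t_eq (p @ (q @ p') @ q') (p @ (p' @ q) @ q')"
    by (intro tcong_append t_refl tcomm)
  then show ?thesis by simp
qed

lemma tmul_append_right: "t_eq (tmul p (q @ q')) (tmul p q @ tmul p q')"
proof (induction p)
  case (Cons x p)
  have "tmul [x] (q @ q') = tmul [x] q @ tmul [x] q'"
    by (cases x) (simp add: tmul_def)
  then have "tmul (x # p) (q @ q') = (tmul [x] q @ tmul [x] q') @ tmul p (q @ q')"
    by (subst tmul_Cons) (rule arg_cong2[where f = append], simp_all)
  moreover have "t_eq \<dots> ((tmul [x] q @ tmul [x] q') @ (tmul p q @ tmul p q'))"
    using Cons by (rule tcong_append[OF t_refl])
  moreover have "t_eq \<dots> ((tmul [x] q @ tmul p q) @ (tmul [x] q' @ tmul p q'))"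
    by (rule t_eq_interchange)
  moreover have "tmul [x] r @ tmul p r = tmul (x # p) r" for r
    by (rule tmul_Cons[symmetric])
  ultimately show ?case
    by (simp only:) (rule t_trans)
qed (simp add: t_refl)

lemma tmul_cong_right:
  assumes "t_eq q q'" shows "t_eq (tmul p q) (tmul p q')"
proof (induction p)
  case (Cons x p)
  have "t_eq (tmul [x] q) (tmul [x] q')"
    using assms
  proof (induction rule: t_eq.induct)
    case (tscale_swap k X Y)
    then show ?case
      by (cases x) (simp add: tmul_def uscale_mult_right t_eq.tscale_swap)
  qed ((simp add: tmul_def ring_distribs split_def)?,
    (rule t_refl tcomm tzero tadd_left tadd_right | erule t_sym | erule (1) t_trans tcong_append))+
  from tcong_append[OF this Cons] show ?case
    by (simp only: tmul_Cons[of x p])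
qed (simp add: t_refl)

lemma tmul_singleton_cong:
  assumes "\<And>X Y. t_eq (tmul p [(X, Y)]) (tmul p' [(X, Y)])"
  shows "t_eq (tmul p q) (tmul p' q)"
proof (induction q)
  case (Cons x q)
  have *: "t_eq (tmul r (x # q)) (tmul r [x] @ tmul r q)" for r
    using tmul_append_right[of r "[x]" q] by simp
  have "t_eq (tmul p [x]) (tmul p' [x])"
    using assms[of "fst x" "snd x"] by simp
  from tcong_append[OF this Cons] show ?case
    by (rule t_trans[OF t_trans[OF *] t_sym[OF *]])
qed (simp add: t_refl)

lemma tmul_cong_left:
  assumes "t_eq p p'" shows "t_eq (tmul p q) (tmul p' q)"
  using assms
proof (induction rule: t_eq.induct)
  case (tscale_swap k X Y)
  show ?case
    by (rule tmul_singleton_cong) (simp add: tmul_def uscale_mult_left t_eq.tscale_swap)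
next
  case (tadd_left X X' Y)
  show ?case
    by (rule tmul_singleton_cong) (simp add: tmul_def ring_distribs t_eq.tadd_left)
next
  case (tadd_right X Y Y')
  show ?case
    by (rule tmul_singleton_cong) (simp add: tmul_def ring_distribs t_eq.tadd_right)
next
  case (tzero Y)
  show ?case
    by (rule tmul_singleton_cong) (simp add: tmul_def t_eq.tzero)
qed ((simp add: tmul_append)?,
    (rule t_refl tcomm tzero tadd_left tadd_right | erule t_sym | erule (1) t_trans tcong_append))+

lemma tmul_assoc: "tmul (tmul p q) r = tmul p (tmul q r)"
proof (induction p)
  case (Cons x p)
  obtain X Y where x: "x = (X, Y)" by (cases x)
  have "tmul (tmul [x] q) r = tmul [x] (tmul q r)"
    by (induction q) (auto simp: x tmul_def mult.assoc map_concat o_def split_def)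
  then show ?case
    by (simp only: tmul_Cons[of x p] tmul_append Cons.IH)
qed simp

lemma t_eq_neg: "t_eq (map (\<lambda>(X, Y). (uscale (- 1) X, Y)) p @ p) []"
proof (induction p)
  case (Cons x p)
  obtain X Y where x: "x = (X, Y)" by (cases x)
  let ?n = "map (\<lambda>(X, Y). (uscale (- 1) X, Y))"
  have "t_eq [(0, Y)] ([(uscale (- 1) X, Y)] @ [(X, Y)])"
    using tadd_left[of "uscale (- 1) X" X Y] by simp
  then have "t_eq ([(uscale (- 1) X, Y)] @ [(X, Y)]) [(0, Y)]"
    by (rule t_sym)
  then have "t_eq ([(uscale (- 1) X, Y)] @ [(X, Y)]) []"
    by (rule t_trans[OF _ tzero])
  then have "t_eq (([(uscale (- 1) X, Y)] @ [(X, Y)]) @ (?n p @ p)) ([] @ [])"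
    using Cons by (intro tcong_append)
  from t_trans[OF t_eq_interchange this]
  show ?case
    by (simp add: x)
qed (simp add: t_refl)

primrec counit2 :: "('k::field_char_0 env \<times> 'k env) list \<Rightarrow> 'k" where
  "counit2 [] = 0"
| "counit2 (x # p) = counit (fst x) * counit (snd x) + counit2 p"

lemma counit2_append: "counit2 (p @ q) = counit2 p + counit2 q"
  by (induction p) auto

lemma counit2_cong: "t_eq p q \<Longrightarrow> counit2 p = counit2 q"
  by (induction rule: t_eq.induct)
    (simp_all add: counit2_append counit_simps algebra_simps)

instantiation tens :: (field_char_0) ring_1
begin

lift_definition zero_tens :: "'a tens" is "[] :: ('a env \<times> 'a env) list" .
lift_definition one_tens :: "'a tens" is "[(1 :: 'a env, 1 :: 'a env)]" .
lift_definition plus_tens :: "'a tens \<Rightarrow> 'a tens \<Rightarrow> 'a tens"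
  is "(@) :: ('a env \<times> 'a env) list \<Rightarrow> ('a env \<times> 'a env) list \<Rightarrow> ('a env \<times> 'a env) list"
  by (rule tcong_append)
definition uminus_tens :: "'a tens \<Rightarrow> 'a tens" where
  "uminus_tens = tscale (- 1)"
definition minus_tens :: "'a tens \<Rightarrow> 'a tens \<Rightarrow> 'a tens" where
  "minus_tens p q = p + tscale (- 1) q"
lift_definition times_tens :: "'a tens \<Rightarrow> 'a tens \<Rightarrow> 'a tens" is tmul
  by (meson tmul_cong_left tmul_cong_right t_trans)

instance
proof
  fix p q r :: "'a tens"
  show "p + q + r = p + (q + r)" by transfer (simp add: t_refl)
  show "p + q = q + p" by transfer (rule tcomm)
  show "0 + p = p" by transfer (simp add: t_refl)
  show "- p + p = 0" unfolding uminus_tens_def by transfer (rule t_eq_neg)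
  show "p - q = p + - q" by (simp add: minus_tens_def uminus_tens_def)
  show "p * q * r = p * (q * r)" by transfer (simp add: tmul_assoc t_refl)
  show "1 * p = p" by transfer (simp add: tmul_def t_refl)
  show "p * 1 = p" by transfer (simp add: tmul_def t_refl split_def)
  show "(p + q) * r = p * r + q * r" by transfer (simp add: tmul_append t_refl)
  show "p * (q + r) = p * q + p * r" by transfer (rule tmul_append_right)
  have "\<not> t_eq [] [(1 :: 'a env, 1 :: 'a env)]"
    using counit2_cong by (force simp: counit_simps)
  then show "(0 :: 'a tens) \<noteq> 1" by transfer
qed

end

interpretation tens_vs: vector_space "tscale :: 'k::field_char_0 \<Rightarrow> _"
proof
  fix k l :: 'k and p q :: "'k tens"
  show "tscale k (p + q) = tscale k p + tscale k q"
    by transfer (simp add: t_refl)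
  show "tscale (k + l) p = tscale k p + tscale l p"
  proof transfer
    fix k l :: 'k and p :: "('k env \<times> 'k env) list"
    let ?m = "\<lambda>k. map (\<lambda>(X, Y). (uscale k X, Y))"
    show "t_eq (?m (k + l) p) (?m k p @ ?m l p)"
    proof (induction p)
      case (Cons x p)
      obtain X Y where x: "x = (X, Y)" by (cases x)
      have "t_eq ([(uscale (k + l) X, Y)] @ ?m (k + l) p)
          (([(uscale k X, Y)] @ [(uscale l X, Y)]) @ (?m k p @ ?m l p))"
        by (rule tcong_append) (use Cons in \<open>simp_all add: env_vs.scale_left_distrib tadd_left\<close>)
      then show ?case
        using x t_trans[OF _ t_eq_interchange] by fastforce
    qed (simp add: t_refl)
  qed
  show "tscale k (tscale l p) = tscale (k * l) p"
    by transfer (simp add: t_refl split_def comp_def)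
  show "tscale 1 p = p"
    by transfer (simp add: t_refl split_def)
qed

lemma pure_add_left: "pure (X + X') Y = pure X Y + pure X' Y"
  by (simp add: pure.abs_eq plus_tens.abs_eq tens.abs_eq_iff tadd_left)

lemma pure_add_right: "pure X (Y + Y') = pure X Y + pure X Y'"
  by (simp add: pure.abs_eq plus_tens.abs_eq tens.abs_eq_iff tadd_right)

lemma pure_scale_left: "pure (uscale k X) Y = tscale k (pure X Y)"
  by (simp add: pure.abs_eq tscale.abs_eq)

lemma pure_scale_right: "pure X (uscale k Y) = tscale k (pure X Y)"
  by (simp add: pure.abs_eq tscale.abs_eq tens.abs_eq_iff t_sym[OF tscale_swap])

lemma pure_mult: "pure X Y * pure X' Y' = pure (X * X') (Y * Y')"
  by (simp add: pure.abs_eq times_tens.abs_eq tmul_def)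

lemma pure_one: "pure 1 1 = 1"
  by (simp add: pure.abs_eq one_tens_def)

lemmas pure_simps = pure_add_left pure_add_right pure_scale_left pure_scale_right pure_mult pure_one

lemma tscale_mult_left: "tscale k p * q = tscale k (p * q)"
  by transfer (simp add: tmul_def map_concat o_def split_def uscale_mult_left t_refl)

lemma tscale_mult_right: "p * tscale k q = tscale k (p * q)"
  by transfer (simp add: tmul_def map_concat o_def split_def uscale_mult_right t_refl)

primrec coprod_term :: "'k::field_char_0 uterm \<Rightarrow> 'k tens" where
  "coprod_term (UInc a) = pure (inc a) 1 + pure 1 (inc a)"
| "coprod_term UOne = 1"
| "coprod_term UZero = 0"
| "coprod_term (UAdd X Y) = coprod_term X + coprod_term Y"
| "coprod_term (UScale k X) = tscale k (coprod_term X)"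
| "coprod_term (UMul X Y) = coprod_term X * coprod_term Y"

lift_definition coprod :: "'k::field_char_0 env \<Rightarrow> 'k tens" is coprod_term
proof -
  fix X Y :: "'k uterm" assume "u_eq X Y"
  then show "coprod_term X = coprod_term Y"
  proof (induction rule: u_eq.induct)
    case (uinc_br a b)
    have neg: "tscale (- 1) p = - p" for p :: "'k tens" by simp
    have sub: "pure (X - X') Y = pure X Y - pure X' Y" "pure Y (X - X') = pure Y X - pure Y X'"
      for X X' Y :: "'k env"
      using pure_add_left[of "X - X'" X' Y] pure_add_right[of Y "X - X'" X'] by simp_all
    show ?case
      by (simp add: neg sub inc_br pure_mult ring_distribs)
  qed (simp_all add: tens_vs.scale_right_distrib tens_vs.scale_left_distrib ring_distribs mult.assoc
      tscale_mult_left tscale_mult_right inc_add inc_scale pure_simps add_ac)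
qed

text \<open>A choice of factors in \<open>\<Delta> X = X\<^sub>(\<^sub>1\<^sub>) \<otimes> X\<^sub>(\<^sub>2\<^sub>)\<close>; it is only used inside expressions
  that are bilinear in the two factors, where the choice is immaterial.\<close>

definition sweedler :: "'k::field_char_0 env \<Rightarrow> ('k env \<times> 'k env) list" where
  "sweedler X = (SOME p. coprod X = (\<Sum>(U, V)\<leftarrow>p. pure U V))"

section \<open>Extension of the post-Lie product and the Grossman--Larson product\<close>

definition is_tri_extension :: "('k::field_char_0 env \<Rightarrow> 'k env \<Rightarrow> 'k env) \<Rightarrow> bool" where
  "is_tri_extension T \<longleftrightarrow>
    (\<forall>X. Vector_Spaces.linear uscale uscale (T X)) \<and>
    (\<forall>Y. Vector_Spaces.linear uscale uscale (\<lambda>X. T X Y)) \<and>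
    (\<forall>a b. T (inc a) (inc b) = inc (ptri a b)) \<and>
    (\<forall>X. T 1 X = X) \<and>
    (\<forall>X. T X 1 = uscale (counit X) 1) \<and>
    (\<forall>X Y Z. T X (Y * Z) = (\<Sum>(U, V)\<leftarrow>sweedler X. T U Y * T V Z)) \<and>
    (\<forall>a X b. T (inc a * X) (inc b) = T (inc a) (T X (inc b)) - T (T (inc a) X) (inc b))"

definition utri :: "'k::field_char_0 env \<Rightarrow> 'k env \<Rightarrow> 'k env" where
  "utri = (THE T. is_tri_extension T)"

definition gl :: "'k::field_char_0 env \<Rightarrow> 'k env \<Rightarrow> 'k env" where
  "gl X Y = (\<Sum>(U, V)\<leftarrow>sweedler X. U * utri V Y)"

section \<open>Planar forests\<close>

datatype ptree = Node (subtrees: "ptree list")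

type_synonym forest = "ptree list"

primrec tree_size :: "ptree \<Rightarrow> nat" where
  "tree_size (Node ts) = Suc (sum_list (map tree_size ts))"

definition forest_size :: "forest \<Rightarrow> nat" where
  "forest_size F = sum_list (map tree_size F)"

definition For :: "nat \<Rightarrow> forest set" where
  "For N = {F. forest_size F = N}"

definition For' :: "nat \<Rightarrow> forest set" where
  "For' N = For N - {replicate N (Node [])}"

text \<open>The one-vertex tree is sent to \<open>1 \<triangleright> x = x\<close>.\<close>

primrec iota_tree :: "ptree \<Rightarrow> 'k::field_char_0 env" where
  "iota_tree (Node ts) = utri (prod_list (map iota_tree ts)) (inc pgen)"

definition iota :: "forest \<Rightarrow> 'k::field_char_0 env" where
  "iota F = prod_list (map iota_tree F)"

section \<open>Degree completion and the coefficients of the post-Lie Magnus expansion\<close>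

text \<open>An element of the completion is the sequence of its homogeneous components, the one of
  degree \<open>n\<close> lying in the span of \<open>iota ` For n\<close>. Both products are homogeneous,
  hence given by the Cauchy formula.\<close>

definition cauchy ::
  "('k::field_char_0 env \<Rightarrow> 'k env \<Rightarrow> 'k env) \<Rightarrow> (nat \<Rightarrow> 'k env) \<Rightarrow> (nat \<Rightarrow> 'k env) \<Rightarrow> nat \<Rightarrow> 'k env" where
  "cauchy m X Y n = (\<Sum>i\<le>n. m (X i) (Y (n - i)))"

definition cone :: "nat \<Rightarrow> 'k::field_char_0 env" where
  "cone n = (if n = 0 then 1 else 0)"

primrec gl_power :: "(nat \<Rightarrow> 'k::field_char_0 env) \<Rightarrow> nat \<Rightarrow> nat \<Rightarrow> 'k env" where
  "gl_power X 0 = cone"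
| "gl_power X (Suc k) = cauchy gl X (gl_power X k)"

text \<open>For \<open>Y\<close> with constant term 1, the \<open>k\<close>-th Grossman--Larson power of \<open>Y - 1\<close> starts in
  degree \<open>k\<close>, so the component of degree \<open>n\<close> of the logarithmic series stops at \<open>k = n\<close>.\<close>

definition gl_log :: "(nat \<Rightarrow> 'k::field_char_0 env) \<Rightarrow> nat \<Rightarrow> 'k env" where
  "gl_log Y n =
    (\<Sum>k = 1..n. uscale ((- 1) ^ (k - 1) / of_nat k) (gl_power (\<lambda>i. Y i - cone i) k n))"

definition exp_gen :: "nat \<Rightarrow> 'k::field_char_0 env" where
  "exp_gen j = uscale (1 / fact j) (inc pgen ^ j)"

definition chi :: "nat \<Rightarrow> 'k::field_char_0 env" where
  "chi = gl_log exp_gen"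

definition chi_coeff :: "forest \<Rightarrow> 'k::field_char_0" where
  "chi_coeff = (THE c. \<forall>n. chi n = (\<Sum>F\<in>For n. uscale (c F) (iota F)))"

section \<open>Vertices and tubes\<close>

text \<open>Vertices are addressed by the sequence of child positions, counted from 0 from left to
  right, leading to them: from the root in a tree, where the root is \<open>[]\<close>, and preceded by
  the position of the tree in a forest, where the roots are the \<open>[i]\<close>. Thus \<open>v\<close> lies
  above \<open>u\<close> in \<open>\<prec>\<close> iff \<open>v\<close> is a proper prefix of \<open>u\<close>, and preorder is the lexicographic
  order.\<close>

primrec is_vertex :: "nat list \<Rightarrow> ptree \<Rightarrow> bool" where
  "is_vertex [] T = True"
| "is_vertex (i # p) T = (i < length (subtrees T) \<and> is_vertex p (subtrees T ! i))"

definition tree_verts :: "ptree \<Rightarrow> nat list set" where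
  "tree_verts T = {p. is_vertex p T}"

definition forest_verts :: "forest \<Rightarrow> nat list set" where
  "forest_verts F = {i # p | i p. i < length F \<and> p \<in> tree_verts (F ! i)}"

definition roots :: "forest \<Rightarrow> nat list set" where
  "roots F = {[i] | i. i < length F}"

definition child_of :: "nat list \<Rightarrow> nat list \<Rightarrow> bool" where
  "child_of v u \<longleftrightarrow> (\<exists>i. v = u @ [i])"

definition tree_less :: "nat list \<Rightarrow> nat list \<Rightarrow> bool" where
  "tree_less v u \<longleftrightarrow> strict_prefix u v"

definition preorder_less :: "nat list \<Rightarrow> nat list \<Rightarrow> bool" where
  "preorder_less v u \<longleftrightarrow> (v, u) \<in> lexord {(i, j). i < j}"

definition higher_set :: "'v set \<Rightarrow> ('v \<Rightarrow> 'v \<Rightarrow> bool) \<Rightarrow> 'v set \<Rightarrow> bool" where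
  "higher_set P lt t \<longleftrightarrow> t \<subseteq> P \<and> (\<forall>v\<in>t. \<forall>u\<in>P. lt v u \<longrightarrow> u \<in> t)"

text \<open>The poset \<open>\<bb>\<^sub>v\<close> consists of the direct descendants of \<open>v\<close>. With all descendants, a tube
  containing a vertex \<open>v\<close> and a child of \<open>v\<close> would contain everything below that child; the
  ladder with three vertices would then have no horizontal nested tubing, although its
  coefficient is \<open>1/3\<close>.\<close>

definition branches :: "ptree \<Rightarrow> nat list \<Rightarrow> nat list set" where
  "branches T v = {u \<in> tree_verts T. child_of u v}"

definition connected_verts :: "nat list set \<Rightarrow> bool" where
  "connected_verts t \<longleftrightarrow>
    (\<forall>u\<in>t. \<forall>v\<in>t. (u, v) \<in> {(a, b). a \<in> t \<and> b \<in> t \<and> (child_of a b \<or> child_of b a)}\<^sup>*)"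

definition tree_tube :: "ptree \<Rightarrow> nat list set \<Rightarrow> bool" where
  "tree_tube T t \<longleftrightarrow> connected_verts t \<and> higher_set (tree_verts T) tree_less t \<and>
    (\<forall>v\<in>t. higher_set (branches T v) preorder_less (t \<inter> branches T v))"

definition forest_tube :: "forest \<Rightarrow> nat list set \<Rightarrow> bool" where
  "forest_tube F t \<longleftrightarrow> t \<subseteq> forest_verts F \<and>
    higher_set (roots F) preorder_less (t \<inter> roots F) \<and>
    (\<forall>i<length F. {p. i # p \<in> t} = {} \<or> tree_tube (F ! i) {p. i # p \<in> t})"

definition nested_tubing :: "forest \<Rightarrow> nat list set set \<Rightarrow> bool" where
  "nested_tubing F t \<longleftrightarrow> card t \<ge> 2 \<and> (\<forall>s\<in>t. s \<noteq> {} \<and> forest_tube F s) \<and>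
    (\<forall>s\<in>t. \<forall>s'\<in>t. s \<subseteq> s' \<or> s' \<subseteq> s) \<and> forest_verts F \<in> t"

definition bdry :: "nat list set set \<Rightarrow> nat list set \<Rightarrow> nat list set" where
  "bdry t s = s - \<Union>{s' \<in> t. s' \<subset> s}"

definition hTub :: "forest \<Rightarrow> nat list set set set" where
  "hTub F = {t. nested_tubing F t \<and> (\<forall>s\<in>t. \<forall>u\<in>bdry t s. \<forall>v\<in>bdry t s. \<not> child_of u v)}"

section \<open>The shuffle factors\<close>

definition sh :: "('i \<Rightarrow> nat) \<Rightarrow> 'i set \<Rightarrow> 'k::field_char_0" where
  "sh q I = fact (\<Sum>i\<in>I. q i) / (\<Prod>i\<in>I. fact (q i))"

definition inner_tube :: "nat list set set \<Rightarrow> nat list set \<Rightarrow> nat list set" where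
  "inner_tube t s = (GREATEST s'. s' \<in> t \<and> s' \<subset> s)"

text \<open>The trees of the subforest induced on a tube \<open>r\<close> of \<open>F\<close> are the non-empty intersections
  of \<open>r\<close> with the trees of \<open>F\<close>, because each of these is connected.\<close>

definition tree_positions :: "nat list set \<Rightarrow> nat list" where
  "tree_positions r = sorted_list_of_set {i. \<exists>p. i # p \<in> r}"

definition lg :: "nat list set \<Rightarrow> nat" where
  "lg r = length (tree_positions r)"

definition tube_tree :: "nat list set \<Rightarrow> nat \<Rightarrow> nat list set" where
  "tube_tree r a = {v \<in> r. hd v = tree_positions r ! (a - 1)}"

definition j_count :: "forest \<Rightarrow> nat list set set \<Rightarrow> nat list set \<Rightarrow> nat \<Rightarrow> nat" where
  "j_count F t s a =
    (if a = 0 then card (bdry t s \<inter> roots F)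
     else card {u \<in> bdry t s. \<exists>v\<in>tube_tree (inner_tube t s) a. child_of u v})"

definition f_count :: "nat list set set \<Rightarrow> nat list set \<Rightarrow> nat list \<Rightarrow> nat" where
  "f_count t s v = card {u \<in> bdry t s. child_of u v}"

definition shuffle_factor :: "forest \<Rightarrow> nat list set set \<Rightarrow> nat list set \<Rightarrow> 'k::field_char_0" where
  "shuffle_factor F t s =
    (if \<exists>s'\<in>t. s' \<subset> s
     then sh (j_count F t s) {0..lg (inner_tube t s)} *
       (\<Prod>a = 1..lg (inner_tube t s).
          sh (f_count t s) {v \<in> tube_tree (inner_tube t s) a. f_count t s v \<noteq> 0})
     else 1)"

end

(* Idea. Let A(K) be the K-th Grossman--Larson power of exp(x). Since exp(x) is grouplike, it acts
   by algebra automorphisms of the completion, and with w |> x =: B(w) this gives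
   A(K + 1) = A(K) exp(B(A(K))). Reading off coefficients, the coefficient of a forest F in A(K) is
   a weighted count of labelings of the vertices of F by 0, ..., K - 1 that decrease strictly from
   parents to children and increase weakly from left to right among siblings. Grouping labelings by
   their image, the coefficient of F in the k-th power of exp(x) - 1 is the weighted count of
   surjective labelings. The sets { v. j <= f v } of a surjective labeling f form a horizontal nested
   tubing, every horizontal nested tubing arises from exactly one f in this way, and the weights
   agree.

   That the coefficients c_F are well defined rests on two facts. The extended product exists: it is
   defined on words in L by (aX) |> Y = a |> (X |> Y) - (a |> X) |> Y, and this respects the relations
   of the enveloping algebra. The elements iota F are linearly independent: the free associative
   algebra on planar rooted trees is a post-Lie algebra for the commutator and the derivations
   D_a B(w) = B(a w + D_a w), defined for all a, and the induced homomorphism from the enveloping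
   algebra sends iota F to F. *)

theory Submission
  imports
    Defs
    "HOL-Computational_Algebra.Formal_Power_Series"
    "HOL-Library.Poly_Mapping"
    "HOL-Library.FuncSet"
    "HOL-Library.Infinite_Set"
begin

section \<open>Linear maps on the enveloping algebra\<close>

text \<open>Unfolding the recursion gives A(K) = exp(B(A(0))) ... exp(B(A(K - 1))). The label of a
  vertex is the index of the exponential that produces it: a root from factor m carries branches
  from A(m), whence the strict decrease along edges; the order of the factors gives the weak
  increase among siblings; j siblings with equal labels come from one exponential, whence 1/j!.
  Labels may be skipped, and choosing the set of labels that occur is the binomial relation between
  the powers of exp(x) and those of exp(x) - 1. The obstacle for the extended product: its recursion
  calls the product at all words of a |> X, not at subwords, and the commutator relation has to be
  respected at every position of a word. Hence the inductions on word length. The formula for D_a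
  B(w) is the axiom (aX) |> b = a |> (X |> b) - (a |> X) |> b with b = x, solved for a |> (X |>
  x).\<close>

lemma abs_env_simps:
  "abs_env (UInc a) = inc a" "abs_env UOne = 1" "abs_env UZero = 0"
  "abs_env (UAdd S T) = abs_env S + abs_env T" "abs_env (UScale k S) = uscale k (abs_env S)"
  "abs_env (UMul S T) = abs_env S * abs_env T"
  by (simp_all add: inc.abs_eq one_env_def zero_env_def plus_env.abs_eq uscale.abs_eq times_env.abs_eq)

lemma u_eq_abs: "u_eq S T \<Longrightarrow> abs_env S = abs_env T"
  by (simp add: env.abs_eq_iff)

inductive_set word_span :: "'k::field_char_0 env set" where
  word_span_word: "prod_list (map inc w) \<in> word_span"
| word_span_add: "X \<in> word_span \<Longrightarrow> Y \<in> word_span \<Longrightarrow> X + Y \<in> word_span"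
| word_span_scale: "X \<in> word_span \<Longrightarrow> uscale k X \<in> word_span"

lemma word_span_mult:
  assumes "X \<in> word_span" "Y \<in> word_span" shows "X * Y \<in> word_span"
  using assms(1)
proof induction
  case (word_span_word w)
  show ?case
    using assms(2)
  proof induction
    case (word_span_word v)
    show ?case using word_span.word_span_word[of "w @ v"] by simp
  qed (simp_all add: ring_distribs uscale_mult_right word_span.intros)
qed (simp_all add: ring_distribs uscale_mult_left word_span.intros)

lemma abs_env_word_span: "abs_env S \<in> word_span"
proof (induction S)
  case (UInc a)
  show ?case using word_span_word[of "[a]"] by (simp add: abs_env_simps)
next
  case UOne
  show ?case using word_span_word[of "[]"] by (simp add: abs_env_simps)
next
  case UZero
  show ?case using word_span_scale[OF word_span_word[of "[]"], of 0] by (simp add: abs_env_simps)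
qed (simp_all add: abs_env_simps word_span.intros word_span_mult)

text \<open>For statements linear in \<open>X\<close> it is enough to treat words; an induction on
  the word then peels off one letter at a time.\<close>

lemma env_word_induct [case_names word add scale]:
  assumes "\<And>w. P (prod_list (map inc w))"
    and "\<And>X Y. P X \<Longrightarrow> P Y \<Longrightarrow> P (X + Y)" and "\<And>k X. P X \<Longrightarrow> P (uscale k X)"
  shows "P X"
proof -
  have "X \<in> word_span"
    by (induction X) (rule abs_env_word_span)
  then show ?thesis by induction (use assms in auto)
qed

subsection \<open>Elements of the Lie algebra act by derivations\<close>

text \<open>The derivation of the enveloping algebra extending \<open>ptri a\<close>. The recursion
  runs over terms while its values already lie in \<open>env\<close>, so the Leibniz rule takes the
  class \<open>abs_env\<close> of the factor left alone.\<close>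

primrec der_term :: "'k::field_char_0 free_plie \<Rightarrow> 'k uterm \<Rightarrow> 'k env" where
  "der_term a (UInc b) = inc (ptri a b)"
| "der_term a UOne = 0"
| "der_term a UZero = 0"
| "der_term a (UAdd S T) = der_term a S + der_term a T"
| "der_term a (UScale k S) = uscale k (der_term a S)"
| "der_term a (UMul S T) = der_term a S * abs_env T + abs_env S * der_term a T"

lift_definition der :: "'k::field_char_0 free_plie \<Rightarrow> 'k env \<Rightarrow> 'k env" is der_term
proof -
  fix a :: "'k free_plie" and S T :: "'k uterm"
  assume "u_eq S T"
  then show "der_term a S = der_term a T"
  proof (induction rule: u_eq.induct)
    \<comment> \<open>The commutator relation survives because \<open>ptri a\<close> is a derivation
      of the bracket.\<close>
    case (uinc_br b c)
    then show ?case
      by (simp add: plie.tri_derivation inc_add inc_br abs_env_simps algebra_simps)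
  qed (simp_all add: u_eq_abs abs_env_simps algebra_simps env_vs.scale_left_distrib
      env_vs.scale_right_distrib uscale_mult_left uscale_mult_right inc_add inc_scale
      plie.pl_linear_simps)
qed

lemma der_simps [simp]:
  "der a (inc b) = inc (ptri a b)" "der a 1 = 0" "der a 0 = 0"
  "der a (X + Y) = der a X + der a Y" "der a (uscale k X) = uscale k (der a X)"
  "der a (X * Y) = der a X * Y + X * der a Y"
proof -
  show "der a (inc b) = inc (ptri a b)"
    by (metis abs_env_simps(1) der.abs_eq der_term.simps(1))
  show "der a 1 = 0" by (metis abs_env_simps(2) der.abs_eq der_term.simps(2))
  show "der a 0 = 0" by (metis abs_env_simps(3) der.abs_eq der_term.simps(3))
  show "der a (X + Y) = der a X + der a Y"
    by (induction X; induction Y) (simp add: der.abs_eq flip: abs_env_simps)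
  show "der a (uscale k X) = uscale k (der a X)"
    by (induction X) (simp add: der.abs_eq flip: abs_env_simps)
  show "der a (X * Y) = der a X * Y + X * der a Y"
    by (induction X; induction Y) (simp add: der.abs_eq flip: abs_env_simps)
qed

lemma der_diff [simp]: "der a (X - Y) = der a X - der a Y"
  using der_simps(4)[of a "X - Y" Y] by simp

lemma env_induct [case_names inc one zero add scale mult]:
  assumes "\<And>a. P (inc a)" "P 1" "P 0" "\<And>X Y. P X \<Longrightarrow> P Y \<Longrightarrow> P (X + Y)"
    "\<And>k X. P X \<Longrightarrow> P (uscale k X)" "\<And>X Y. P X \<Longrightarrow> P Y \<Longrightarrow> P (X * Y)"
  shows "P X"
proof -
  have "P (abs_env S)" for S
    by (induction S) (use assms in \<open>simp_all add: abs_env_simps\<close>)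
  then show ?thesis by (induction X) auto
qed

lemma der_add_left: "der (a + b) X = der a X + der b X"
  by (induction X rule: env_induct)
    (simp_all add: plie.pl_linear_simps inc_add algebra_simps env_vs.scale_right_distrib)

lemma der_scale_left: "der (pscale k a) X = uscale k (der a X)"
  by (induction X rule: env_induct)
    (simp_all add: plie.pl_linear_simps inc_scale algebra_simps env_vs.scale_right_distrib
      uscale_mult_left uscale_mult_right)

lemma inc_diff: "inc (a - b) = inc a - inc b"
  using inc_add[of "a - b" b] by simp

text \<open>A commutator of derivations is a derivation, so both sides are derivations in
  \<open>X\<close> and agree once they agree on \<open>L\<close>, where the identity is the
  associator axiom.\<close>

lemma der_br:
  "der (pbr a b) X = der a (der b X) - der b (der a X) - der (ptri a b) X + der (ptri b a) X"
proof (induction X rule: env_induct)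
  case (add X Y)
  show ?case by (simp only: der_simps add) (simp add: algebra_simps)
next
  case (scale k X)
  show ?case
    by (simp only: der_simps scale)
      (simp add: env_vs.scale_right_distrib env_vs.scale_right_diff_distrib)
next
  case (mult X Y)
  show ?case by (simp only: der_simps mult) (simp add: algebra_simps)
qed (simp_all add: plie.tri_associator inc_diff inc_add)

subsection \<open>Linear maps given on words\<close>

text \<open>A linear functional given by its values \<open>f\<close> on words in \<open>L\<close> is evaluated at a term in
  continuation-passing style, so that products become nested applications.\<close>

primrec wlift :: "'k::field_char_0 uterm \<Rightarrow> ('k free_plie list \<Rightarrow> 'k env) \<Rightarrow> 'k env" where
  "wlift (UInc a) f = f [a]"
| "wlift UOne f = f []"
| "wlift UZero f = 0"
| "wlift (UAdd S T) f = wlift S f + wlift T f"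
| "wlift (UScale k S) f = uscale k (wlift S f)"
| "wlift (UMul S T) f = wlift S (\<lambda>u. wlift T (\<lambda>v. f (u @ v)))"

text \<open>The condition for values on words over \<open>L\<close> to descend to a linear map on
  the enveloping algebra.\<close>

definition word_rel :: "('k::field_char_0 free_plie list \<Rightarrow> 'k env) \<Rightarrow> bool" where
  "word_rel f \<longleftrightarrow> (\<forall>u a b v. f (u @ (a + b) # v) = f (u @ a # v) + f (u @ b # v)) \<and>
    (\<forall>u k a v. f (u @ pscale k a # v) = uscale k (f (u @ a # v))) \<and>
    (\<forall>u a b v. f (u @ pbr a b # v) = f (u @ a # b # v) - f (u @ b # a # v))"

lemma wlift_linear:
  "wlift S (\<lambda>w. f w + g w) = wlift S f + wlift S g"
  "wlift S (\<lambda>w. uscale k (f w)) = uscale k (wlift S f)"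
  by (induction S arbitrary: f g)
    (simp_all add: algebra_simps env_vs.scale_right_distrib)

lemma wlift_diff: "wlift S (\<lambda>w. f w - g w) = wlift S f - wlift S g"
  using wlift_linear(1)[of S "\<lambda>w. f w - g w" g] by simp

lemma word_rel_left: "word_rel f \<Longrightarrow> word_rel (\<lambda>v. f (u @ v))"
  unfolding word_rel_def append_assoc[symmetric] by metis

lemma word_rel_wlift: "word_rel f \<Longrightarrow> word_rel (\<lambda>u. wlift S (\<lambda>v. f (u @ v)))"
  unfolding word_rel_def by (simp add: wlift_linear wlift_diff)

text \<open>\<open>f\<close> has to be general: evaluating a product evaluates its factors at
  functionals built from \<open>f\<close>, and these inherit the relations by
  \<open>word_rel_wlift\<close> (left factor) and \<open>word_rel_left\<close> (right
  factor).\<close>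

lemma wlift_cong:
  "u_eq S T \<Longrightarrow> word_rel f \<Longrightarrow> wlift S f = wlift T f"
proof (induction arbitrary: f rule: u_eq.induct)
  case (ucong_mul X X' Y Y')
  then show ?case
    by (simp add: word_rel_wlift word_rel_left)
next
  case (uinc_add a b)
  then have "f ([] @ (a + b) # []) = f ([] @ a # []) + f ([] @ b # [])"
    unfolding word_rel_def by blast
  then show ?case by simp
next
  case (uinc_scale k a)
  then have "f ([] @ pscale k a # []) = uscale k (f ([] @ a # []))"
    unfolding word_rel_def by blast
  then show ?case by simp
next
  case (uinc_br a b)
  then have "f ([] @ pbr a b # []) = f ([] @ a # b # []) - f ([] @ b # a # [])"
    unfolding word_rel_def by blast
  then show ?case by simp
qed (simp_all add: wlift_linear algebra_simps env_vs.scale_right_distrib env_vs.scale_left_distrib)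

definition elift :: "('k::field_char_0 free_plie list \<Rightarrow> 'k env) \<Rightarrow> 'k env \<Rightarrow> 'k env" where
  "elift f X = wlift (rep_env X) f"

lemma elift_abs: "word_rel f \<Longrightarrow> elift f (abs_env S) = wlift S f"
  unfolding elift_def
  by (rule wlift_cong) (use Quotient3_env Quotient3_rep_abs u_refl in metis)+

lemma elift_add: "word_rel f \<Longrightarrow> elift f (X + Y) = elift f X + elift f Y"
  by (induction X; induction Y) (simp add: elift_abs flip: abs_env_simps)

lemma elift_scale: "word_rel f \<Longrightarrow> elift f (uscale k X) = uscale k (elift f X)"
  by (induction X) (simp add: elift_abs flip: abs_env_simps)

lemma elift_inc_mult:
  assumes "word_rel f" shows "elift f (inc a * X) = elift (\<lambda>v. f (a # v)) X"
proof -
  have "word_rel (\<lambda>v. f (a # v))"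
    using word_rel_left[of f "[a]"] assms by simp
  then show ?thesis
    by (induction X) (simp add: assms elift_abs flip: abs_env_simps)
qed

lemma elift_word: "word_rel f \<Longrightarrow> elift f (prod_list (map inc w)) = f w"
proof (induction w arbitrary: f)
  case Nil
  then show ?case by (simp add: elift_abs flip: abs_env_simps(2))
next
  case (Cons a w)
  then show ?case
    using word_rel_left[of f "[a]"] by (simp add: elift_inc_mult)
qed

section \<open>Existence and uniqueness of the extended product\<close>

text \<open>With \<open>f\<close> extended linearly to combinations of words this is f(a |> w), the
  action on letters summed over all positions. Passing \<open>f\<close> along avoids formal sums of
  words.\<close>

primrec word_der ::
  "('k::field_char_0 free_plie list \<Rightarrow> 'k env) \<Rightarrow> 'k free_plie \<Rightarrow> 'k free_plie list \<Rightarrow> 'k env" where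
  "word_der f a [] = 0"
| "word_der f a (b # w) = f (ptri a b # w) + word_der (\<lambda>v. f (b # v)) a w"

lemma word_der_append:
  "word_der f a (u @ v) = word_der (\<lambda>u'. f (u' @ v)) a u + word_der (\<lambda>v'. f (u @ v')) a v"
  by (induction u arbitrary: f) simp_all

text \<open>The action keeps the length of a word, so only the values of \<open>f\<close> on words
  of that length enter. The inductions on length below rest on this.\<close>

lemma word_der_cong:
  "(\<And>v. length v = length w \<Longrightarrow> f v = g v) \<Longrightarrow> word_der f a w = word_der g a w"
proof (induction w arbitrary: f g)
  case (Cons b w)
  have "word_der (\<lambda>v. f (b # v)) a w = word_der (\<lambda>v. g (b # v)) a w"
    by (rule Cons.IH) (simp add: Cons.prems)
  then show ?case by (simp add: Cons.prems)
qed simp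

lemma word_der_linear:
  "word_der (\<lambda>v. f v + g v) a w = word_der f a w + word_der g a w"
  "word_der (\<lambda>v. uscale k (f v)) a w = uscale k (word_der f a w)"
  "word_der (\<lambda>v. f v - g v) a w = word_der f a w - word_der g a w"
  "word_der (\<lambda>v. der b (f v)) a w = der b (word_der f a w)"
  by (induction w arbitrary: f g)
    (simp_all add: algebra_simps env_vs.scale_right_distrib)

text \<open>The recursion calls the function, inside \<open>word_der\<close>, at every word
  occurring in a |> v, and these are not subwords of \<open>w\<close>. A fuel argument takes the
  place of the length; started at \<open>length w\<close>, it reaches 0 only together with the empty
  word, where \<open>Y\<close> is the right value.\<close>

primrec tri_word_upto :: "nat \<Rightarrow> 'k::field_char_0 env \<Rightarrow> 'k free_plie list \<Rightarrow> 'k env" where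
  "tri_word_upto 0 Y w = Y"
| "tri_word_upto (Suc n) Y w =
    (case w of [] \<Rightarrow> Y
     | a # v \<Rightarrow> der a (tri_word_upto n Y v) - word_der (tri_word_upto n Y) a v)"

definition tri_word :: "'k::field_char_0 env \<Rightarrow> 'k free_plie list \<Rightarrow> 'k env" where
  "tri_word Y w = tri_word_upto (length w) Y w"

lemma tri_word_Nil [simp]: "tri_word Y [] = Y"
  by (simp add: tri_word_def)

lemma tri_word_Cons:
  "tri_word Y (a # w) = der a (tri_word Y w) - word_der (tri_word Y) a w"
  unfolding tri_word_def
  by (simp, rule word_der_cong) simp

section \<open>Compatibility with the relations of the enveloping algebra\<close>

definition lin_word :: "nat \<Rightarrow> ('k::field_char_0 free_plie list \<Rightarrow> 'k env) \<Rightarrow> bool" where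
  "lin_word n f \<longleftrightarrow> (\<forall>u a k b v. length u + length v = n \<longrightarrow>
     f (u @ (a + pscale k b) # v) = f (u @ a # v) + uscale k (f (u @ b # v)))"

lemma lin_wordD:
  "lin_word n f \<Longrightarrow> length u + length v = n \<Longrightarrow>
    f (u @ (a + pscale k b) # v) = f (u @ a # v) + uscale k (f (u @ b # v))"
  by (auto simp: lin_word_def)

lemma lin_word_Cons: "lin_word (Suc n) f \<Longrightarrow> lin_word n (\<lambda>v. f (c # v))"
  unfolding lin_word_def by (metis append_Cons length_Cons add_Suc)

lemma word_der_linear_left:
  assumes "\<And>n. length w = Suc n \<Longrightarrow> lin_word n f"
  shows "word_der f (a + pscale k b) w = word_der f a w + uscale k (word_der f b w)"
  using assms
proof (induction w arbitrary: f)
  case (Cons c w)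
  have lin: "lin_word (length w) f" using Cons.prems by simp
  have 1: "f (ptri (a + pscale k b) c # w) = f (ptri a c # w) + uscale k (f (ptri b c # w))"
    using lin_wordD[OF lin, of "[]" w] by (simp add: plie.pl_linear_simps)
  have 2: "word_der (\<lambda>v. f (c # v)) (a + pscale k b) w
      = word_der (\<lambda>v. f (c # v)) a w + uscale k (word_der (\<lambda>v. f (c # v)) b w)"
    by (rule Cons.IH) (use lin in \<open>auto intro: lin_word_Cons\<close>)
  show ?case by (simp add: 1 2 env_vs.scale_right_distrib)
qed simp

text \<open>Induction on the number \<open>n\<close> of letters beside the varied one. A varied
  first letter acts on the rest, and \<open>word_der\<close> is linear in it because shorter words
  are settled. A varied later letter is met by the action before it, at it or after it, and each
  part again concerns shorter words.\<close>

lemma lin_word_tri_word: "lin_word n (tri_word Y)"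
proof (induction n)
  case 0
  show ?case
    by (auto simp: lin_word_def tri_word_Cons der_add_left der_scale_left)
next
  case (Suc n)
  show ?case
    unfolding lin_word_def
  proof (intro allI impI)
    fix u v :: "'a free_plie list" and a b k
    assume len: "length u + length v = Suc n"
    show "tri_word Y (u @ (a + pscale k b) # v)
      = tri_word Y (u @ a # v) + uscale k (tri_word Y (u @ b # v))"
    proof (cases u)
      case Nil
      have "word_der (tri_word Y) (a + pscale k b) v
          = word_der (tri_word Y) a v + uscale k (word_der (tri_word Y) b v)"
        by (rule word_der_linear_left) (use Suc Nil len in auto)
      then show ?thesis
        by (simp add: Nil tri_word_Cons der_add_left der_scale_left
            env_vs.scale_right_diff_distrib)
    next
      case (Cons c u')
      have len': "length u' + length v = n" using len Cons by simp
      note lin = lin_wordD[OF Suc.IH]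
      have "word_der (\<lambda>u''. tri_word Y (u'' @ (a + pscale k b) # v)) c u'
          = word_der (\<lambda>u''. tri_word Y (u'' @ a # v) + uscale k (tri_word Y (u'' @ b # v))) c u'"
        by (rule word_der_cong) (simp add: lin len')
      moreover have "word_der (\<lambda>v'. tri_word Y (u' @ (a + pscale k b) # v')) c v
          = word_der (\<lambda>v'. tri_word Y (u' @ a # v') + uscale k (tri_word Y (u' @ b # v'))) c v"
        by (rule word_der_cong) (simp add: lin len')
      ultimately show ?thesis
        by (simp add: Cons tri_word_Cons word_der_append lin len' plie.pl_linear_simps
            word_der_linear env_vs.scale_right_distrib env_vs.scale_right_diff_distrib
            algebra_simps)
    qed
  qed
qed

lemma lin_word_plus:
  assumes "\<And>n. lin_word n f"
  shows "f (u @ (a + b) # v) = f (u @ a # v) + f (u @ b # v)"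
  using lin_wordD[OF assms refl, of u a 1 b v] by simp

lemma lin_word_scale:
  assumes "\<And>n. lin_word n f"
  shows "f (u @ pscale k a # v) = uscale k (f (u @ a # v))"
proof -
  have "f (u @ 0 # v) = 0"
    using lin_word_plus[OF assms, of u 0 0 v] by simp
  then show ?thesis
    using lin_wordD[OF assms refl, of u 0 k a v] by simp
qed

lemma lin_word_minus:
  assumes "\<And>n. lin_word n f"
  shows "f (u @ (a - b) # v) = f (u @ a # v) - f (u @ b # v)"
  using lin_word_plus[OF assms, of u "a - b" b v] by simp

text \<open>\<open>word_der (word_der f a) b\<close> is \<open>f\<close> after the action of
  \<open>b\<close> followed by that of \<open>a\<close>, so this is \<open>der_br\<close> on words.
  Terms with \<open>a\<close> and \<open>b\<close> acting on different letters cancel.\<close>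

lemma word_der_br:
  assumes "\<And>n. lin_word n f"
  shows "word_der f (pbr a b) w = word_der (word_der f a) b w - word_der (word_der f b) a w
    - word_der f (ptri a b) w + word_der f (ptri b a) w"
  using assms
proof (induction w arbitrary: f)
  case (Cons c w)
  have lin: "lin_word n (\<lambda>v. f (c # v))" for n
    using Cons.prems by (rule lin_word_Cons)
  note lm = lin_word_minus[OF Cons.prems, of "[]", simplified]
  show ?case
    by (simp only: word_der.simps plie.tri_associator word_der_linear Cons.IH[OF lin] lm)
      (simp add: algebra_simps)
qed simp

text \<open>Given linearity, only the commutator relation is left. At the front of a word it follows
  by expanding two letters with \<open>der_br\<close> and \<open>word_der_br\<close>. Behind a
  letter \<open>c\<close>, the induction hypothesis applies to each shorter word, and at the bracket
  itself \<open>ptri c\<close> is a derivation.\<close>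

lemma word_rel_tri_word: "word_rel (tri_word Y)"
proof -
  have br: "tri_word Y (u @ pbr a b # v) = tri_word Y (u @ a # b # v) - tri_word Y (u @ b # a # v)"
    if "length u + length v = n" for n u a b v
    using that
  proof (induction n arbitrary: u a b v rule: less_induct)
    case (less n)
    show ?case
    proof (cases u)
      case Nil
      then show ?thesis
        by (simp add: tri_word_Cons[abs_def] word_der_linear der_br word_der_br[OF lin_word_tri_word] algebra_simps)
    next
      case (Cons c u')
      have len: "length u' + length v < n" using less.prems Cons by simp
      note IH = less.IH[OF len refl]
      note lp = lin_word_plus[OF lin_word_tri_word]
      have "word_der (\<lambda>u''. tri_word Y (u'' @ pbr a b # v)) c u'
          = word_der (\<lambda>u''. tri_word Y (u'' @ a # b # v) - tri_word Y (u'' @ b # a # v)) c u'"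
        by (rule word_der_cong) (rule less.IH[OF len], simp)
      moreover have "word_der (\<lambda>v'. tri_word Y (u' @ pbr a b # v')) c v
          = word_der (\<lambda>v'. tri_word Y (u' @ a # b # v') - tri_word Y (u' @ b # a # v')) c v"
        by (rule word_der_cong) (rule less.IH[OF len], simp)
      ultimately show ?thesis
        by (simp add: Cons tri_word_Cons word_der_append IH plie.tri_derivation lp
            word_der_linear algebra_simps)
    qed
  qed
  show ?thesis
    unfolding word_rel_def
    using br[OF refl] lin_word_plus[OF lin_word_tri_word] lin_word_scale[OF lin_word_tri_word]
    by blast
qed

text \<open>Induction along the recursion for the product: the words in a |> w are as long as
  \<open>w\<close>, so when \<open>a\<close> is put in front of \<open>X\<close>, the claim is
  available for \<open>der a X\<close> as well.\<close>

lemma env_rec_induct [case_names one add scale mult]: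
  assumes one: "P 1" and add: "\<And>X Y. P X \<Longrightarrow> P Y \<Longrightarrow> P (X + Y)"
    and scale: "\<And>k X. P X \<Longrightarrow> P (uscale k X)"
    and mult: "\<And>a X. P X \<Longrightarrow> P (der a X) \<Longrightarrow> P (inc a * X)"
  shows "P X"
proof -
  \<comment> \<open>An arbitrary \<open>Q\<close> lets the letter that is passed over be absorbed
    into the predicate.\<close>
  have der: "Q (der a (prod_list (map inc w)))"
    if "\<And>X Y. Q X \<Longrightarrow> Q Y \<Longrightarrow> Q (X + Y)" "Q 0"
      "\<And>v. length v = length w \<Longrightarrow> Q (prod_list (map inc v))" for Q a and w :: "'a free_plie list"
    using that
  proof (induction w arbitrary: Q)
    case (Cons b w)
    have "Q (prod_list (map inc (ptri a b # w)))"
      by (rule Cons.prems(3)) simp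
    moreover have "Q (inc b * der a (prod_list (map inc w)))"
    proof (rule Cons.IH[of "\<lambda>X. Q (inc b * X)"])
      fix v :: "'a free_plie list" assume "length v = length w"
      then show "Q (inc b * prod_list (map inc v))"
        using Cons.prems(3)[of "b # v"] by simp
    qed (simp_all add: ring_distribs Cons.prems)
    ultimately show ?case by (simp add: Cons.prems)
  qed simp
  have "P (prod_list (map inc w))" for w
  proof (induction "length w" arbitrary: w)
    case 0
    then show ?case by (simp add: one)
  next
    case (Suc n)
    then obtain a v where w: "w = a # v" by (metis length_Suc_conv)
    then have n: "n = length v" using Suc by simp
    have "P (der a (prod_list (map inc v)))"
      by (rule der) (use add scale[OF one, of 0] Suc n in auto)
    with Suc n show ?case by (simp add: w mult)
  qed
  then show ?thesis
    by (induction X rule: env_word_induct) (use add scale in auto)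
qed

lemma tri_word_add: "tri_word (Y + Z) w = tri_word Y w + tri_word Z w"
proof (induction w rule: length_induct)
  case (1 w)
  show ?case
  proof (cases w)
    case (Cons a v)
    have "word_der (tri_word (Y + Z)) a v = word_der (\<lambda>v. tri_word Y v + tri_word Z v) a v"
      by (rule word_der_cong) (simp add: 1 Cons)
    with 1 show ?thesis by (simp add: Cons tri_word_Cons word_der_linear)
  qed simp
qed

lemma tri_word_scale: "tri_word (uscale k Y) w = uscale k (tri_word Y w)"
proof (induction w rule: length_induct)
  case (1 w)
  show ?case
  proof (cases w)
    case (Cons a v)
    have "word_der (tri_word (uscale k Y)) a v = word_der (\<lambda>v. uscale k (tri_word Y v)) a v"
      by (rule word_der_cong) (simp add: 1 Cons)
    with 1 show ?thesis
      by (simp add: Cons tri_word_Cons word_der_linear env_vs.scale_right_diff_distrib)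
  qed simp
qed

definition ext_tri :: "'k::field_char_0 env \<Rightarrow> 'k env \<Rightarrow> 'k env" where
  "ext_tri X Y = elift (tri_word Y) X"

lemma ext_tri_word: "ext_tri (prod_list (map inc w)) Y = tri_word Y w"
  by (simp add: ext_tri_def elift_word word_rel_tri_word)

lemma ext_tri_linear [simp]:
  "ext_tri (X + X') Y = ext_tri X Y + ext_tri X' Y"
  "ext_tri (uscale k X) Y = uscale k (ext_tri X Y)"
  "ext_tri X (Y + Y') = ext_tri X Y + ext_tri X Y'"
  "ext_tri X (uscale k Y) = uscale k (ext_tri X Y)"
proof -
  show 1: "ext_tri (X + X') Y = ext_tri X Y + ext_tri X' Y"
    "ext_tri (uscale k X) Y = uscale k (ext_tri X Y)" for X X' Y k
    by (simp_all add: ext_tri_def elift_add elift_scale word_rel_tri_word)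
  show "ext_tri X (Y + Y') = ext_tri X Y + ext_tri X Y'"
    by (induction X rule: env_word_induct)
      (simp_all add: ext_tri_word tri_word_add tri_word_scale 1 env_vs.scale_right_distrib)
  show "ext_tri X (uscale k Y) = uscale k (ext_tri X Y)"
    by (induction X rule: env_word_induct)
      (simp_all add: ext_tri_word tri_word_add tri_word_scale 1 env_vs.scale_right_distrib mult.commute)
qed

lemma ext_tri_one_left [simp]: "ext_tri 1 Y = Y"
  using ext_tri_word[of "[]" Y] by simp

lemma ext_tri_zero [simp]: "ext_tri 0 Y = 0" "ext_tri X 0 = 0"
  using ext_tri_linear(2)[of 0 0 Y] ext_tri_linear(4)[of X 0 0] by simp_all

lemma elift_der_word:
  "word_rel f \<Longrightarrow> elift f (der a (prod_list (map inc w))) = word_der f a w"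
proof (induction w arbitrary: f)
  case Nil
  then show ?case
    by (simp add: elift_abs flip: abs_env_simps(3))
next
  case (Cons b w)
  have "word_rel (\<lambda>v. f (c # v))" for c
    using word_rel_left[of f "[c]"] Cons.prems by simp
  then show ?case
    by (simp add: elift_add elift_inc_mult Cons elift_word)
qed

text \<open>Holds for every \<open>Y\<close>, whereas the axiom of the extension asks for it at
  elements of \<open>L\<close>. Combined with \<open>env_rec_induct\<close> it drives the proofs
  about the counit, the coproduct and the Grossman--Larson product.\<close>

lemma ext_tri_inc_mult:
  "ext_tri (inc a * X) Y = der a (ext_tri X Y) - ext_tri (der a X) Y"
proof (induction X rule: env_word_induct)
  case (word w)
  have "ext_tri (inc a * prod_list (map inc w)) Y = tri_word Y (a # w)"
    using ext_tri_word[of "a # w" Y] by simp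
  then show ?case
    by (simp add: ext_tri_word tri_word_Cons)
      (simp add: ext_tri_def elift_der_word word_rel_tri_word)
qed (simp_all add: ring_distribs uscale_mult_right env_vs.scale_right_diff_distrib)

lemma ext_tri_inc: "ext_tri (inc a) Y = der a Y"
  using ext_tri_inc_mult[of a 1 Y] by simp

lemma counit_der: "counit (der a X) = 0"
  by (induction X rule: env_induct) (simp_all add: counit_simps)

lemma ext_tri_one_right: "ext_tri X 1 = uscale (counit X) 1"
  by (induction X rule: env_rec_induct)
    (simp_all add: counit_simps env_vs.scale_left_distrib ext_tri_inc_mult counit_der)

subsection \<open>Bilinear maps on the tensor square\<close>

definition bilin :: "('k::field_char_0 env \<Rightarrow> 'k env \<Rightarrow> 'k env) \<Rightarrow> bool" where
  "bilin f \<longleftrightarrow> (\<forall>U U' V. f (U + U') V = f U V + f U' V) \<and>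
    (\<forall>U V V'. f U (V + V') = f U V + f U V') \<and>
    (\<forall>k U V. f (uscale k U) V = uscale k (f U V)) \<and>
    (\<forall>k U V. f U (uscale k V) = uscale k (f U V))"

lemma bilin_simps:
  assumes "bilin f"
  shows "f (U + U') V = f U V + f U' V" "f U (V + V') = f U V + f U V'"
    "f (uscale k U) V = uscale k (f U V)" "f U (uscale k V) = uscale k (f U V)"
    "f 0 V = 0"
proof -
  show *: "f (uscale k U) V = uscale k (f U V)" for k U V
    using assms by (simp add: bilin_def)
  show "f 0 V = 0" using *[of 0 0 V] by simp
qed (use assms in \<open>simp_all add: bilin_def\<close>)

definition tlift :: "('k::field_char_0 env \<Rightarrow> 'k env \<Rightarrow> 'k env) \<Rightarrow> 'k tens \<Rightarrow> 'k env" where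
  "tlift f t = (\<Sum>(U, V)\<leftarrow>rep_tens t. f U V)"

lemma tlift_cong:
  "t_eq p q \<Longrightarrow> bilin f \<Longrightarrow> (\<Sum>(U, V)\<leftarrow>p. f U V) = (\<Sum>(U, V)\<leftarrow>q. f U V)"
  by (induction rule: t_eq.induct) (simp_all add: bilin_simps)

lemma tlift_abs: "bilin f \<Longrightarrow> tlift f (abs_tens p) = (\<Sum>(U, V)\<leftarrow>p. f U V)"
  unfolding tlift_def
  by (rule tlift_cong) (use Quotient3_tens Quotient3_rep_abs t_refl in metis)+

lemma tlift_simps:
  assumes "bilin f"
  shows "tlift f (s + t) = tlift f s + tlift f t" "tlift f (pure U V) = f U V"
    "tlift f (tscale k t) = uscale k (tlift f t)" "tlift f 0 = 0"
proof -
  show "tlift f (s + t) = tlift f s + tlift f t"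
    by (induction s; induction t) (simp add: plus_tens.abs_eq tlift_abs assms)
  show "tlift f (pure U V) = f U V"
    by (simp add: pure.abs_eq tlift_abs assms)
  have "(\<Sum>(U, V)\<leftarrow>map (\<lambda>(X, Y). (uscale k X, Y)) p. f U V) = uscale k (\<Sum>(U, V)\<leftarrow>p. f U V)" for p
    by (induction p) (auto simp: bilin_simps assms env_vs.scale_right_distrib)
  then show "tlift f (tscale k t) = uscale k (tlift f t)"
    by (induction t) (simp add: tscale.abs_eq tlift_abs assms)
  show "tlift f 0 = 0"
    by (simp add: zero_tens_def tlift_abs assms)
qed

lemma tens_induct [case_names pure add zero]:
  assumes "\<And>U V. P (pure U V)" "\<And>s t. P s \<Longrightarrow> P t \<Longrightarrow> P (s + t)" "P 0"
  shows "P t"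
proof (induction t)
  fix p :: "('a env \<times> 'a env) list"
  show "P (abs_tens p)"
  proof (induction p)
    case Nil
    show ?case using assms(3) by (simp add: zero_tens_def)
  next
    case (Cons x p)
    have "abs_tens (x # p) = pure (fst x) (snd x) + abs_tens p"
      by (simp add: pure.abs_eq plus_tens.abs_eq)
    with Cons show ?case by (simp add: assms)
  qed
qed

lemma tlift_mult:
  assumes "bilin f"
  shows "tlift f (pure A B * t) = tlift (\<lambda>U V. f (A * U) (B * V)) t"
proof -
  have "bilin (\<lambda>U V. f (A * U) (B * V))"
    using assms by (simp add: bilin_def ring_distribs uscale_mult_right)
  then show ?thesis
    by (induction t rule: tens_induct) (simp_all add: assms tlift_simps pure_mult ring_distribs)
qed

lemma tlift_add: "tlift (\<lambda>U V. f U V + g U V) t = tlift f t + tlift g t"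
  by (simp add: tlift_def split_def sum_list_addf)

lemma tlift_diff: "tlift (\<lambda>U V. f U V - g U V) t = tlift f t - tlift g t"
  by (simp add: tlift_def split_def sum_list_subtractf)

lemma additive_sum_list:
  assumes "\<And>X Y. h (X + Y) = h X + h Y" "h 0 = 0"
  shows "h (sum_list xs) = sum_list (map h xs)"
  by (induction xs) (simp_all add: assms)

lemma additive_tlift:
  assumes "\<And>X Y. h (X + Y) = h X + h Y" "h 0 = 0"
  shows "h (tlift f t) = tlift (\<lambda>U V. h (f U V)) t"
  by (simp add: tlift_def additive_sum_list[of h, OF assms] split_def o_def)

lemma coprod_simps:
  "coprod (inc a) = pure (inc a) 1 + pure 1 (inc a)" "coprod 1 = 1"
  "coprod (X + Y) = coprod X + coprod Y" "coprod (uscale k X) = tscale k (coprod X)"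
  "coprod (X * Y) = coprod X * coprod Y"
proof -
  show "coprod (inc a) = pure (inc a) 1 + pure 1 (inc a)" by transfer simp
  show "coprod 1 = 1" by (metis abs_env_simps(2) coprod.abs_eq coprod_term.simps(2))
  show "coprod (X + Y) = coprod X + coprod Y"
    by (induction X; induction Y) (simp add: coprod.abs_eq flip: abs_env_simps)
  show "coprod (uscale k X) = tscale k (coprod X)"
    by (induction X) (simp add: coprod.abs_eq flip: abs_env_simps)
  show "coprod (X * Y) = coprod X * coprod Y"
    by (induction X; induction Y) (simp add: coprod.abs_eq flip: abs_env_simps)
qed

text \<open>The chosen list represents \<open>coprod X\<close>, and a bilinear sum is the same for
  all lists representing one tensor. From here on the choice in \<open>sweedler\<close> is never
  inspected.\<close>

lemma sum_sweedler:
  assumes "bilin f"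
  shows "(\<Sum>(U, V)\<leftarrow>sweedler X. f U V) = tlift f (coprod X)"
proof -
  have abs: "abs_tens p = (\<Sum>(U, V)\<leftarrow>p. pure U V)" for p :: "('a env \<times> 'a env) list"
  proof (induction p)
    case (Cons x p)
    have "abs_tens (x # p) = pure (fst x) (snd x) + abs_tens p"
      by (simp add: pure.abs_eq plus_tens.abs_eq)
    with Cons show ?case by (simp add: split_def)
  qed (simp add: zero_tens_def)
  have "\<exists>p. coprod X = (\<Sum>(U, V)\<leftarrow>p. pure U V)"
    by (metis abs Quotient3_tens Quotient3_abs_rep)
  then have "coprod X = (\<Sum>(U, V)\<leftarrow>sweedler X. pure U V)"
    unfolding sweedler_def by (rule someI_ex)
  also have "\<dots> = abs_tens (sweedler X)" by (simp add: abs)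
  finally show ?thesis by (simp add: tlift_abs assms)
qed

lemma tlift_coprod_inc_mult:
  assumes "bilin f"
  shows "tlift f (coprod (inc a * X)) =
    tlift (\<lambda>U V. f (inc a * U) V) (coprod X) + tlift (\<lambda>U V. f U (inc a * V)) (coprod X)"
  by (simp add: coprod_simps ring_distribs tlift_simps tlift_mult assms)

text \<open>The derivation \<open>der a\<close> is also a coderivation: it maps primitive elements
  to primitive elements, which settles words letter by letter. Testing against all bilinear
  \<open>f\<close> replaces a map on the tensor square.\<close>

lemma tlift_coprod_der:
  assumes "bilin f"
  shows "tlift f (coprod (der a X)) =
    tlift (\<lambda>U V. f (der a U) V) (coprod X) + tlift (\<lambda>U V. f U (der a V)) (coprod X)"
proof -
  have bl: "bilin (\<lambda>U V. f (der a U) V)" "bilin (\<lambda>U V. f U (der a V))" if "bilin f" for f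
    using that by (simp_all add: bilin_def)
  have bm: "bilin (\<lambda>U V. f (inc b * U) V)" "bilin (\<lambda>U V. f U (inc b * V))" if "bilin f" for f b
    using that by (simp_all add: bilin_def ring_distribs uscale_mult_right)
  have z: "coprod (0 :: 'a env) = 0"
    using coprod_simps(4)[of 0 "0 :: 'a env"] by simp
  have z': "f U 0 = 0" if "bilin f" for f :: "'a env \<Rightarrow> 'a env \<Rightarrow> 'a env" and U
    using bilin_simps(4)[OF that, of U 0 0] by simp
  show ?thesis
    using assms
  proof (induction X arbitrary: f rule: env_word_induct)
    case (word w)
    then show ?case
    proof (induction w arbitrary: f)
      case Nil
      then show ?case
        by (simp add: z coprod_simps pure_one[symmetric] tlift_simps bl bilin_simps z')
    next
      case (Cons b w)
      then show ?case
        by (simp add: coprod_simps(3) tlift_simps tlift_coprod_inc_mult bl bm bilin_simps tlift_add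
            add_ac)
    qed
  qed (simp_all add: coprod_simps tlift_simps bl env_vs.scale_right_distrib add_ac)
qed

text \<open>For \<open>inc a * X\<close>, the Leibniz rule of \<open>der a\<close> gives the terms
  with \<open>a\<close> acting on the left or the right factor, the coderivation property gives the
  corrections, and together they match the coproduct of \<open>inc a * X\<close>.\<close>

lemma ext_tri_mult:
  "ext_tri X (Y * Z) = tlift (\<lambda>U V. ext_tri U Y * ext_tri V Z) (coprod X)"
proof -
  have b: "bilin (\<lambda>U V. ext_tri U Y * ext_tri V Z)"
    by (simp add: bilin_def ring_distribs uscale_mult_left uscale_mult_right)
  show ?thesis
  proof (induction X rule: env_rec_induct)
    case one
    then show ?case
      by (simp add: coprod_simps pure_one[symmetric] tlift_simps b)
  next
    case (mult a X)
    have "der a (tlift (\<lambda>U V. ext_tri U Y * ext_tri V Z) (coprod X))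
        = tlift (\<lambda>U V. der a (ext_tri U Y * ext_tri V Z)) (coprod X)"
      by (rule additive_tlift) simp_all
    then show ?case
      by (simp add: ext_tri_inc_mult mult tlift_coprod_der[OF b] tlift_coprod_inc_mult[OF b]
          tlift_add tlift_diff ring_distribs)
  qed (simp_all add: coprod_simps tlift_simps b)
qed

lemma is_tri_extension_ext_tri: "is_tri_extension ext_tri"
proof -
  have "bilin (\<lambda>U V. ext_tri U Y * ext_tri V Z)" for Y Z :: "'a env"
    by (simp add: bilin_def ring_distribs uscale_mult_left uscale_mult_right)
  then show ?thesis
    unfolding is_tri_extension_def
    by (simp add: Vector_Spaces.linear_iff env_vs.vector_space_axioms ext_tri_inc
        ext_tri_one_right ext_tri_mult sum_sweedler ext_tri_inc_mult)
qed

text \<open>Three steps determine \<open>T\<close>: a primitive left argument acts by a derivation,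
  so \<open>T (inc a)\<close> is \<open>der a\<close>; the last axiom then fixes \<open>T X\<close>
  on \<open>L\<close> along \<open>env_rec_induct\<close>; the product rule and the value at 1 fix
  it everywhere.\<close>

lemma is_tri_extension_unique:
  assumes "is_tri_extension T" shows "T = ext_tri"
proof -
  note T = assms[unfolded is_tri_extension_def]
  have lin: "T (X + X') Y = T X Y + T X' Y" "T (uscale k X) Y = uscale k (T X Y)"
    "T X (Y + Y') = T X Y + T X Y'" "T X (uscale k Y) = uscale k (T X Y)" for X X' Y Y' k
    using T by (simp_all add: Vector_Spaces.linear_iff)
  have z: "T X 0 = 0" for X
    using lin(4)[of X 0 0] by simp
  have b: "bilin (\<lambda>U V. T U Y * T V Z)" for Y Z
    by (simp add: bilin_def ring_distribs uscale_mult_left uscale_mult_right lin)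
  have mult: "T X (Y * Z) = (\<Sum>(U, V)\<leftarrow>sweedler X. T U Y * T V Z)" for X Y Z
    using T by blast
  have inc: "T (inc a) Y = der a Y" for a Y
    by (induction Y rule: env_induct)
      (use T in \<open>simp_all add: z lin mult sum_sweedler[OF b] coprod_simps tlift_simps[OF b] counit_simps\<close>)
  have base: "T X (inc c) = ext_tri X (inc c)" for X c
    by (induction X rule: env_rec_induct) (use T in \<open>simp_all add: lin inc ext_tri_inc_mult\<close>)
  have mult': "ext_tri X (Y * Z) = (\<Sum>(U, V)\<leftarrow>sweedler X. ext_tri U Y * ext_tri V Z)" for X Y Z
    using is_tri_extension_ext_tri unfolding is_tri_extension_def by blast
  have one: "T X 1 = uscale (counit X) 1" for X
    using T by blast
  have "T X Y = ext_tri X Y" for X Y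
    by (induction Y arbitrary: X rule: env_induct)
      (simp_all add: z lin mult mult' base one ext_tri_one_right)
  then show ?thesis by blast
qed

lemma utri_eq: "utri = ext_tri"
  unfolding utri_def
  by (rule the_equality) (rule is_tri_extension_ext_tri, erule is_tri_extension_unique)

subsection \<open>The Grossman--Larson product\<close>

lemma gl_eq: "gl X Y = tlift (\<lambda>U V. U * ext_tri V Y) (coprod X)"
  unfolding gl_def utri_eq
  by (rule sum_sweedler) (simp add: bilin_def ring_distribs uscale_mult_left uscale_mult_right)

lemma bilin_gl: "bilin (\<lambda>U V. U * ext_tri V Y)"
  by (simp add: bilin_def ring_distribs uscale_mult_left uscale_mult_right)

lemma gl_linear_left:
  "gl (X + X') Y = gl X Y + gl X' Y" "gl (uscale k X) Y = uscale k (gl X Y)" "gl 1 Y = Y"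
  by (simp_all add: gl_eq coprod_simps tlift_simps bilin_gl pure_one[symmetric])

lemma gl_linear_right:
  "gl X (Y + Y') = gl X Y + gl X Y'" "gl X (uscale k Y) = uscale k (gl X Y)"
proof -
  show "gl X (Y + Y') = gl X Y + gl X Y'"
    by (simp add: gl_eq ring_distribs tlift_add)
  have "tlift (\<lambda>U V. uscale k (U * ext_tri V Y)) t = uscale k (tlift (\<lambda>U V. U * ext_tri V Y) t)" for t
    by (rule additive_tlift[symmetric]) (simp_all add: env_vs.scale_right_distrib)
  then show "gl X (uscale k Y) = uscale k (gl X Y)"
    by (simp add: gl_eq uscale_mult_right)
qed

text \<open>Once associativity with a primitive factor is available, both sides expand by
  \<open>ext_tri_inc_mult\<close> to the same terms. This is what later moves exp(x) under a
  graft.\<close>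

lemma ext_tri_gl: "ext_tri (gl X Y) Z = ext_tri X (ext_tri Y Z)"
proof (induction X rule: env_rec_induct)
  case (mult a X)
  have "der a (gl X Y) = tlift (\<lambda>U V. der a (U * ext_tri V Y)) (coprod X)"
    unfolding gl_eq by (rule additive_tlift) simp_all
  moreover have "inc a * gl X Y = tlift (\<lambda>U V. inc a * (U * ext_tri V Y)) (coprod X)"
    unfolding gl_eq by (rule additive_tlift) (simp_all add: ring_distribs)
  \<comment> \<open>Associativity for a primitive left factor, because the \<open>gl\<close> product
    of \<open>inc a\<close> with \<open>Z\<close> is \<open>inc a * Z + der a Z\<close>.\<close>
  ultimately have "gl (inc a * X) Y = inc a * gl X Y + der a (gl X Y) - gl (der a X) Y"
    unfolding gl_eq
    by (simp add: tlift_coprod_der[OF bilin_gl] tlift_coprod_inc_mult[OF bilin_gl]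
        tlift_add tlift_diff ring_distribs ext_tri_inc_mult mult.assoc)
  then have "gl (inc a * X) Y + gl (der a X) Y = inc a * gl X Y + der a (gl X Y)"
    by simp
  then have "ext_tri (gl (inc a * X) Y) Z + ext_tri (gl (der a X) Y) Z
      = ext_tri (inc a * gl X Y) Z + ext_tri (der a (gl X Y)) Z"
    by (metis ext_tri_linear(1))
  then show ?case
    by (simp add: mult ext_tri_inc_mult algebra_simps)
qed (simp_all add: gl_linear_left)

section \<open>Grossman--Larson powers of the exponential\<close>

unbundle fps_syntax

lemma exp_gen_0 [simp]: "exp_gen 0 = 1"
  by (simp add: exp_gen_def)

lemma gen_mult_exp_gen: "inc pgen * exp_gen m = uscale (of_nat (Suc m)) (exp_gen (Suc m))"
  by (simp add: exp_gen_def uscale_mult_right field_simps del: of_nat_Suc)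

lemma ext_tri_sum:
  "ext_tri (sum f A) Y = (\<Sum>i\<in>A. ext_tri (f i) Y)"
  "ext_tri X (sum f A) = (\<Sum>i\<in>A. ext_tri X (f i))"
  by (induction A rule: infinite_finite_induct) simp_all

text \<open>Divided powers of a primitive element. Multiplying by \<open>Suc m\<close> turns the
  step into a product with the coproduct of the generator; its two summands raise the left or the
  right index, with weights \<open>i\<close> and \<open>Suc m - i\<close> adding up to
  \<open>Suc m\<close>.\<close>

lemma coprod_exp_gen: "coprod (exp_gen m) = (\<Sum>i\<le>m. pure (exp_gen i) (exp_gen (m - i)))"
proof (induction m)
  case 0
  show ?case by (simp add: coprod_simps pure_one)
next
  case (Suc m)
  let ?p = "\<lambda>i. pure (exp_gen i) (exp_gen (Suc m - i)) :: 'a tens"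
  let ?c = "of_nat (Suc m) :: 'a"
  have "tscale ?c (coprod (exp_gen (Suc m))) = coprod (inc pgen) * coprod (exp_gen m)"
    by (simp only: gen_mult_exp_gen coprod_simps(4)[symmetric] coprod_simps(5)[symmetric])
  also have "\<dots> = (\<Sum>i\<le>m. tscale (of_nat (Suc i)) (?p (Suc i))) +
      (\<Sum>i\<le>m. tscale (of_nat (Suc m - i)) (?p i))"
    by (simp add: Suc coprod_simps ring_distribs sum_distrib_left pure_mult gen_mult_exp_gen
        pure_scale_left pure_scale_right Suc_diff_le sum.distrib del: of_nat_Suc)
  also have "(\<Sum>i\<le>m. tscale (of_nat (Suc i)) (?p (Suc i))) = (\<Sum>i\<le>Suc m. tscale (of_nat i) (?p i))"
    by (subst sum.atMost_Suc_shift) simp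
  also have "(\<Sum>i\<le>m. tscale (of_nat (Suc m - i)) (?p i)) =
      (\<Sum>i\<le>Suc m. tscale (of_nat (Suc m - i)) (?p i))"
    by simp
  also have "(\<Sum>i\<le>Suc m. tscale (of_nat i) (?p i)) + \<dots> = (\<Sum>i\<le>Suc m. tscale ?c (?p i))"
    by (subst sum.distrib[symmetric], rule sum.cong)
      (simp_all add: tens_vs.scale_left_distrib[symmetric] of_nat_add[symmetric] del: of_nat_Suc of_nat_add)
  finally have "tscale ?c (coprod (exp_gen (Suc m))) = tscale ?c (\<Sum>i\<le>Suc m. ?p i)"
    by (simp only: tens_vs.scale_sum_right)
  moreover have "?c \<noteq> 0" by (simp del: of_nat_Suc)
  ultimately show ?case
    by (metis tens_vs.scale_cancel_left)
qed

lemma tlift_sum: "bilin f \<Longrightarrow> tlift f (sum g A) = (\<Sum>i\<in>A. tlift f (g i))"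
  by (induction A rule: infinite_finite_induct) (simp_all add: tlift_simps)

lemma gl_exp_gen: "gl (exp_gen m) Y = (\<Sum>i\<le>m. exp_gen i * ext_tri (exp_gen (m - i)) Y)"
  by (simp add: gl_eq coprod_exp_gen tlift_sum tlift_simps bilin_gl)

lemma ext_tri_exp_gen_mult:
  "ext_tri (exp_gen m) (Y * Z) = (\<Sum>i\<le>m. ext_tri (exp_gen i) Y * ext_tri (exp_gen (m - i)) Z)"
proof -
  have "bilin (\<lambda>U V. ext_tri U Y * ext_tri V Z)"
    by (simp add: bilin_def ring_distribs uscale_mult_left uscale_mult_right)
  then show ?thesis
    by (simp add: ext_tri_mult coprod_exp_gen tlift_sum tlift_simps)
qed

lemma counit_exp_gen: "counit (exp_gen m :: 'a::field_char_0 env) = (if m = 0 then 1 else 0)"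
proof -
  have "counit (inc pgen ^ n :: 'a env) = (if n = 0 then 1 else 0)" for n
    by (cases n) (simp_all add: counit_simps)
  then show ?thesis by (simp add: exp_gen_def counit_simps)
qed

text \<open>The action of exp(x). Power series over \<open>env\<close> stand for the completion: the
  coefficient at \<open>n\<close> is the component of degree \<open>n\<close>, and multiplication is
  concatenation.\<close>

definition exp_tri :: "'k::field_char_0 env fps \<Rightarrow> 'k env fps" where
  "exp_tri Y = Abs_fps (\<lambda>n. \<Sum>i\<le>n. ext_tri (exp_gen i) (Y $ (n - i)))"

definition exp_gl :: "'k::field_char_0 env fps \<Rightarrow> 'k env fps" where
  "exp_gl Y = Abs_fps (cauchy gl exp_gen (fps_nth Y))"

lemma exp_gl_eq: "exp_gl Y = Abs_fps exp_gen * exp_tri Y"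
proof (rule fps_ext)
  fix n
  have "exp_gl Y $ n =
      (\<Sum>i=0..n. \<Sum>j=0..i. exp_gen j * ext_tri (exp_gen (i - j)) (Y $ (n - i)))"
    by (simp add: exp_gl_def cauchy_def gl_exp_gen atLeast0AtMost)
  also have "\<dots> = (\<Sum>j=0..n. \<Sum>i=0..n - j. exp_gen j * ext_tri (exp_gen i) (Y $ (n - j - i)))"
    by (rule fps_mult_assoc_lemma)
  finally show "exp_gl Y $ n = (Abs_fps exp_gen * exp_tri Y) $ n"
    by (simp add: exp_tri_def fps_mult_nth sum_distrib_left atLeast0AtMost)
qed

lemma exp_tri_mult: "exp_tri (Y * Z) = exp_tri Y * exp_tri Z"
proof (rule fps_ext)
  fix n
  let ?f = "\<lambda>k j l p. ext_tri (exp_gen k) (Y $ j) * ext_tri (exp_gen l) (Z $ p)"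
  have "exp_tri (Y * Z) $ n = (\<Sum>i\<le>n. \<Sum>j\<le>n - i. \<Sum>k\<le>i. ?f k j (i - k) (n - i - j))"
    by (simp add: exp_tri_def fps_mult_nth ext_tri_sum ext_tri_exp_gen_mult atLeast0AtMost)
  also have "\<dots> = (\<Sum>(i, j, k)\<in>(SIGMA i:{..n}. {..n - i} \<times> {..i}). ?f k j (i - k) (n - i - j))"
    by (simp add: sum.Sigma sum.cartesian_product split_def)
  \<comment> \<open>Regroup by the degree \<open>m\<close> of the left factor, of which
    \<open>k\<close> comes from the exponential; \<open>l\<close> is the share of the exponential in
    the right factor.\<close>
  also have "\<dots> = (\<Sum>(m, k, l)\<in>(SIGMA m:{..n}. {..m} \<times> {..n - m}). ?f k (m - k) l (n - m - l))"
    by (rule sum.reindex_bij_witness[where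
          i = "\<lambda>(m, k, l). (k + l, m - k, k)" and j = "\<lambda>(i, j, k). (k + j, k, i - k)"])
      (auto simp: add.commute)
  also have "\<dots> = (\<Sum>m\<le>n. \<Sum>k\<le>m. \<Sum>l\<le>n - m. ?f k (m - k) l (n - m - l))"
    by (simp add: sum.Sigma sum.cartesian_product split_def)
  finally show "exp_tri (Y * Z) $ n = (exp_tri Y * exp_tri Z) $ n"
    by (simp add: exp_tri_def fps_mult_nth sum_product atLeast0AtMost)
qed

lemma exp_tri_one: "exp_tri 1 = 1"
proof (rule fps_ext)
  fix n
  have "exp_tri 1 $ n = (\<Sum>i\<le>n. ext_tri (exp_gen i) (if n - i = 0 then 1 else 0) :: 'a env)"
    by (simp add: exp_tri_def)
  also have "\<dots> = (\<Sum>i\<le>n. if i = n then ext_tri (exp_gen i) 1 else 0)"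
    by (rule sum.cong) auto
  finally show "exp_tri 1 $ n = (1 :: 'a env fps) $ n"
    by (simp add: ext_tri_one_right counit_exp_gen)
qed

lemma exp_tri_power: "exp_tri (Z ^ j) = exp_tri Z ^ j"
  by (induction j) (simp_all add: exp_tri_one exp_tri_mult)

text \<open>The operator B; the shift by one accounts for the added root.\<close>

definition graft :: "'k::field_char_0 env fps \<Rightarrow> 'k env fps" where
  "graft Y = Abs_fps (\<lambda>n. case n of 0 \<Rightarrow> 0 | Suc m \<Rightarrow> ext_tri (Y $ m) (inc pgen))"

lemma graft_nth [simp]: "graft Y $ 0 = 0" "graft Y $ Suc m = ext_tri (Y $ m) (inc pgen)"
  by (simp_all add: graft_def)

text \<open>The composition law \<open>ext_tri_gl\<close>, applied in each degree.\<close>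

lemma exp_tri_graft: "exp_tri (graft Y) = graft (exp_gl Y)"
proof (rule fps_ext)
  fix n show "exp_tri (graft Y) $ n = graft (exp_gl Y) $ n"
  proof (cases n)
    case (Suc m)
    have "exp_tri (graft Y) $ n = (\<Sum>i\<le>m. ext_tri (exp_gen i) (graft Y $ (Suc m - i)))"
      by (simp add: Suc exp_tri_def)
    also have "\<dots> = (\<Sum>i\<le>m. ext_tri (gl (exp_gen i) (Y $ (m - i))) (inc pgen))"
      by (rule sum.cong) (simp_all add: Suc_diff_le ext_tri_gl)
    finally show ?thesis
      by (simp add: Suc exp_gl_def cauchy_def ext_tri_sum)
  qed (simp add: exp_tri_def)
qed

text \<open>The exponential for concatenation. For a series without constant term the powers beyond
  \<open>n\<close> vanish in degree \<open>n\<close>, so cutting the sum there loses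
  nothing.\<close>

definition series_exp :: "'k::field_char_0 env fps \<Rightarrow> 'k env fps" where
  "series_exp Z = Abs_fps (\<lambda>n. \<Sum>j\<le>n. uscale (1 / fact j) ((Z ^ j) $ n))"

lemma fps_power_nth_below:
  fixes Z :: "'a::ring_1 fps"
  assumes "Z $ 0 = 0" "n < j" shows "(Z ^ j) $ n = 0"
  using assms(2)
proof (induction j arbitrary: n)
  case (Suc j)
  have "Z $ i * (Z ^ j) $ (n - i) = 0" if "i \<le> n" for i
    using assms(1) Suc that by (cases i) auto
  then show ?case by (simp add: fps_mult_nth)
qed simp

lemma exp_tri_series_exp:
  assumes "Z $ 0 = 0" shows "exp_tri (series_exp Z) = series_exp (exp_tri Z)"
proof (rule fps_ext)
  fix n
  \<comment> \<open>A common cutoff \<open>n\<close> for all degrees makes the two sums independent,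
    so that they can be exchanged.\<close>
  have *: "(\<Sum>j\<le>n - i. uscale (1 / fact j) ((Z ^ j) $ (n - i)))
      = (\<Sum>j\<le>n. uscale (1 / fact j) ((Z ^ j) $ (n - i)))" for i
    by (rule sum.mono_neutral_left) (use assms in \<open>auto simp: fps_power_nth_below\<close>)
  have "exp_tri (series_exp Z) $ n =
      (\<Sum>i\<le>n. ext_tri (exp_gen i) (\<Sum>j\<le>n. uscale (1 / fact j) ((Z ^ j) $ (n - i))))"
    by (simp only: exp_tri_def series_exp_def fps_nth_Abs_fps *)
  also have "\<dots> = (\<Sum>i\<le>n. \<Sum>j\<le>n. uscale (1 / fact j) (ext_tri (exp_gen i) ((Z ^ j) $ (n - i))))"
    by (simp add: ext_tri_sum)
  also have "\<dots> = (\<Sum>j\<le>n. uscale (1 / fact j) (exp_tri (Z ^ j) $ n))"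
    by (subst sum.swap) (simp add: exp_tri_def env_vs.scale_sum_right)
  finally show "exp_tri (series_exp Z) $ n = series_exp (exp_tri Z) $ n"
    by (simp add: series_exp_def exp_tri_power)
qed

lemma series_exp_graft_one: "series_exp (graft 1) = (Abs_fps exp_gen :: 'a::field_char_0 env fps)"
proof (rule fps_ext)
  fix n
  have g: "graft 1 = fps_const (inc pgen :: 'a env) * fps_X"
    by (rule fps_ext) (auto simp: graft_def split: nat.split)
  have "(fps_const (inc pgen :: 'a env) * fps_X) ^ j = fps_const (inc pgen ^ j) * fps_X ^ j" for j
  proof (induction j)
    case (Suc j)
    have "fps_X * fps_const c = fps_const c * fps_X" for c :: "'a env"
      by (rule fps_ext) simp
    then show ?case
      by (simp add: Suc mult.assoc) (simp add: mult.assoc[symmetric])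
  qed simp
  then have "series_exp (graft 1) $ n
      = (\<Sum>j\<le>n. uscale (1 / fact j) (if j = n then inc pgen ^ j else 0 :: 'a env))"
    unfolding series_exp_def g by simp (rule sum.cong, auto)
  also have "\<dots> = (\<Sum>j\<le>n. if j = n then uscale (1 / fact j) (inc pgen ^ j) else 0)"
    by (rule sum.cong) auto
  finally show "series_exp (graft 1) $ n = (Abs_fps exp_gen :: 'a env fps) $ n"
    by (simp add: exp_gen_def)
qed

text \<open>The \<open>K\<close>-th Grossman--Larson power of \<open>exp(x)\<close>, as a product of exponentials for the
  concatenation product.\<close>

primrec flow :: "nat \<Rightarrow> 'k::field_char_0 env fps" where
  "flow 0 = 1"
| "flow (Suc K) = flow K * series_exp (graft (flow K))"

text \<open>Grossman--Larson powers grow by a factor exp(x) on the left, \<open>flow\<close> by a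
  concatenation factor on the right. The action of exp(x) passes through the product, the
  exponential and the graft, and thereby shifts the index of \<open>flow\<close> by one.\<close>

lemma exp_gl_flow: "exp_gl (flow K) = (flow (Suc K) :: 'a::field_char_0 env fps)"
proof (induction K)
  case 0
  show ?case by (simp add: exp_gl_eq exp_tri_one series_exp_graft_one)
next
  case (Suc K)
  have "exp_gl (flow (Suc K) :: 'a env fps) = exp_gl (flow K) * series_exp (graft (exp_gl (flow K)))"
    by (simp add: exp_gl_eq[of "_ * _"] exp_tri_mult exp_tri_series_exp exp_tri_graft)
      (simp add: exp_gl_eq mult.assoc)
  then show ?case by (simp only: Suc flow.simps(2)[of "Suc K"])
qed

section \<open>Powers of exp(x) - 1\<close>

definition exp_sub_power :: "nat \<Rightarrow> 'k::field_char_0 env fps" where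
  "exp_sub_power k = Abs_fps (gl_power (\<lambda>i. exp_gen i - cone i) k)"

lemma exp_sub_power_0: "exp_sub_power 0 = 1"
  by (rule fps_ext) (simp add: exp_sub_power_def cone_def)

lemma exp_sub_power_Suc:
  "exp_sub_power (Suc k) = exp_gl (exp_sub_power k) - (exp_sub_power k :: 'a::field_char_0 env fps)"
proof (rule fps_ext)
  fix n
  have "gl (exp_gen i - cone i) Y = gl (exp_gen i) Y - (if i = 0 then Y else 0)" for i and Y :: "'a env"
  proof -
    have "gl (cone i) Y = (if i = 0 then Y else 0)"
      using gl_linear_left(2)[of 0 0 Y] by (simp add: cone_def gl_linear_left)
    then show ?thesis
      using gl_linear_left(1)[of "exp_gen i - cone i" "cone i" Y] by (simp add: algebra_simps)
  qed
  then show "exp_sub_power (Suc k) $ n = (exp_gl (exp_sub_power k) - (exp_sub_power k :: 'a env fps)) $ n"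
    by (simp add: exp_sub_power_def exp_gl_def cauchy_def sum_subtractf)
qed

lemma exp_gl_add: "exp_gl (Y + Z) = exp_gl Y + exp_gl Z"
  by (rule fps_ext) (simp add: exp_gl_def cauchy_def gl_linear_right sum.distrib)

lemma exp_gl_zero: "exp_gl 0 = 0"
  using exp_gl_add[of 0 0] by simp

lemma exp_gl_of_nat: "exp_gl (of_nat c * Y) = of_nat c * exp_gl Y"
  by (induction c) (simp_all add: exp_gl_zero exp_gl_add ring_distribs)

lemma exp_gl_sum: "exp_gl (sum f A) = (\<Sum>i\<in>A. exp_gl (f i))"
  by (induction A rule: infinite_finite_induct) (simp_all add: exp_gl_zero exp_gl_add)

text \<open>Binomial theorem for the operator \<open>exp_gl\<close>, the sum of the identity and
  multiplication by exp(x) - 1; the step is Pascal's rule.\<close>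

lemma flow_eq_exp_sub_power:
  "(flow K :: 'a::field_char_0 env fps) = (\<Sum>i\<le>K. of_nat (K choose i) * exp_sub_power i)"
proof (induction K)
  case 0
  show ?case by (simp add: exp_sub_power_0)
next
  case (Suc K)
  have "(flow (Suc K) :: 'a env fps) = exp_gl (flow K)" by (simp add: exp_gl_flow)
  also have "\<dots> = (\<Sum>i\<le>K. of_nat (K choose i) * exp_sub_power (Suc i)) +
      (\<Sum>i\<le>K. of_nat (K choose i) * exp_sub_power i)"
    by (simp only: Suc exp_gl_sum exp_gl_of_nat exp_sub_power_Suc sum.distrib[symmetric])
      (simp add: ring_distribs)
  also have "(\<Sum>i\<le>K. of_nat (K choose i) * exp_sub_power i :: 'a env fps)
      = (\<Sum>i\<le>Suc K. of_nat (K choose i) * exp_sub_power i)"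
    by (simp add: binomial_eq_0)
  also have "\<dots> = exp_sub_power 0 + (\<Sum>i\<le>K. of_nat (K choose Suc i) * exp_sub_power (Suc i))"
    by (subst sum.atMost_Suc_shift) simp
  also have "(\<Sum>i\<le>K. of_nat (K choose i) * exp_sub_power (Suc i)) + \<dots> =
      exp_sub_power 0 + (\<Sum>i\<le>K. of_nat (Suc K choose Suc i) * exp_sub_power (Suc i) :: 'a env fps)"
    by (simp add: sum.distrib[symmetric] ring_distribs add_ac)
  also have "\<dots> = (\<Sum>i\<le>Suc K. of_nat (Suc K choose i) * exp_sub_power i)"
    by (subst sum.atMost_Suc_shift) simp
  finally show ?case .
qed

section \<open>A post-Lie algebra of forests\<close>

text \<open>The wrapper carries concatenation as a \<open>monoid_add\<close> structure, for which
  the convolution product on \<open>'k falg\<close> is that of the free associative algebra on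
  planar trees.\<close>

datatype fword = FWord (unFWord: forest)

instantiation fword :: monoid_add
begin

definition zero_fword :: fword where "zero_fword = FWord []"
definition plus_fword :: "fword \<Rightarrow> fword \<Rightarrow> fword" where
  "plus_fword u v = FWord (unFWord u @ unFWord v)"

instance
  by standard (simp_all add: zero_fword_def plus_fword_def)

end

type_synonym 'k falg = "fword \<Rightarrow>\<^sub>0 'k"

definition fscale :: "'k::field_char_0 \<Rightarrow> 'k falg \<Rightarrow> 'k falg" where
  "fscale k p = Poly_Mapping.single 0 k * p"

definition fmon :: "forest \<Rightarrow> 'k::field_char_0 falg" where
  "fmon F = Poly_Mapping.single (FWord F) 1"

lemma fmon_Nil: "fmon [] = 1"
  by (simp add: fmon_def zero_fword_def[symmetric])

lemma fmon_mult: "fmon F * fmon G = fmon (F @ G)"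
  by (simp add: fmon_def mult_single plus_fword_def)

lemma fscale_fmon: "fscale k (fmon F) = Poly_Mapping.single (FWord F) k"
  by (simp add: fscale_def fmon_def mult_single)

lemma falg_induct [case_names zero add mon]:
  assumes "P 0" "\<And>p q. P p \<Longrightarrow> P q \<Longrightarrow> P (p + q)" "\<And>k F. P (fscale k (fmon F))"
  shows "P p"
proof (induction p rule: update_induct)
  case const
  show ?case by (rule assms(1))
next
  case (update p w k)
  have "Poly_Mapping.update w k p = p + fscale k (fmon (unFWord w))"
    using update(1)
    by (intro poly_mapping_eqI)
      (auto simp: fscale_fmon lookup_update lookup_add lookup_single when_def in_keys_iff)
  then show ?case using assms update by simp
qed

interpretation falg_vs: vector_space "fscale :: 'k::field_char_0 \<Rightarrow> _"
  by unfold_locales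
    (simp_all add: fscale_def ring_distribs single_add mult.assoc[symmetric] mult_single)

lemma fscale_mult_left: "fscale k p * q = fscale k (p * q)"
  by (simp add: fscale_def mult.assoc)

lemma fscale_mult_right: "p * fscale k q = fscale k (p * q)"
proof -
  have "p * Poly_Mapping.single 0 k = Poly_Mapping.single 0 k * p"
    by (induction p rule: falg_induct)
      (simp_all add: fscale_fmon mult_single ring_distribs mult.commute)
  then show ?thesis by (simp add: fscale_def mult.assoc[symmetric])
qed

lemma lookup_fscale: "Poly_Mapping.lookup (fscale k p) w = k * Poly_Mapping.lookup p w"
  by (induction p rule: falg_induct)
    (auto simp: fscale_fmon lookup_add ring_distribs falg_vs.scale_right_distrib lookup_single
      when_def fscale_def[of k "Poly_Mapping.single _ _"] mult_single)

definition fext :: "(forest \<Rightarrow> 'k::field_char_0 falg) \<Rightarrow> 'k falg \<Rightarrow> 'k falg" where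
  "fext f p = (\<Sum>w\<in>Poly_Mapping.keys p. fscale (Poly_Mapping.lookup p w) (f (unFWord w)))"

lemma fext_superset:
  assumes "finite S" "Poly_Mapping.keys p \<subseteq> S"
  shows "fext f p = (\<Sum>w\<in>S. fscale (Poly_Mapping.lookup p w) (f (unFWord w)))"
  unfolding fext_def
  by (rule sum.mono_neutral_left) (use assms in \<open>auto simp: in_keys_iff\<close>)

lemma fext_zero [simp]: "fext f 0 = 0"
  by (simp add: fext_def)

lemma fext_add [simp]: "fext f (p + q) = fext f p + fext f q"
proof -
  let ?S = "Poly_Mapping.keys p \<union> Poly_Mapping.keys q"
  have "Poly_Mapping.keys (p + q) \<subseteq> ?S" by (rule Poly_Mapping.keys_add)
  then show ?thesis
    by (simp add: fext_superset[of ?S] lookup_add falg_vs.scale_left_distrib sum.distrib)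
qed

lemma fext_diff [simp]: "fext f (p - q) = fext f p - fext f q"
  using fext_add[of f "p - q" q] by simp

lemma fext_scale [simp]: "fext f (fscale k p) = fscale k (fext f p)"
proof -
  have "Poly_Mapping.keys (fscale k p) \<subseteq> Poly_Mapping.keys p"
    by (auto simp: in_keys_iff lookup_fscale)
  then show ?thesis
    by (simp add: fext_superset[of "Poly_Mapping.keys p"] lookup_fscale falg_vs.scale_sum_right)
qed

lemma fext_fmon [simp]: "fext f (fmon F) = f F"
  by (simp add: fext_def fmon_def)

definition fgraft :: "'k::field_char_0 falg \<Rightarrow> 'k falg" where
  "fgraft = fext (\<lambda>H. fmon [Node H])"

lemma fgraft_simps [simp]:
  "fgraft (p + q) = fgraft p + fgraft q" "fgraft (p - q) = fgraft p - fgraft q"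
  "fgraft (fscale k p) = fscale k (fgraft p)" "fgraft (fmon H) = fmon [Node H]" "fgraft 0 = 0"
  by (simp_all add: fgraft_def)

fun fder_mon :: "'k::field_char_0 falg \<Rightarrow> forest \<Rightarrow> 'k falg" where
  "fder_mon a [] = 0"
| "fder_mon a (Node H # F) =
    fgraft (a * fmon H + fder_mon a H) * fmon F + fmon [Node H] * fder_mon a F"

lemma forest_induct [case_names Nil Cons]:
  assumes "P []" "\<And>H F. P H \<Longrightarrow> P F \<Longrightarrow> P (Node H # F)"
  shows "P F"
proof (induction "size_list size F" arbitrary: F rule: less_induct)
  case less
  show ?case
  proof (cases F)
    case (Cons T G)
    then show ?thesis using less assms(2) by (cases T) auto
  qed (use assms in simp)
qed

definition fder :: "'k::field_char_0 falg \<Rightarrow> 'k falg \<Rightarrow> 'k falg" where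
  "fder a = fext (fder_mon a)"

lemma fder_mon_append:
  "fder_mon a (F @ G) = fder_mon a F * fmon G + fmon F * fder_mon a G"
proof (induction F rule: forest_induct)
  case (Cons H F)
  have "fmon (Node H # F) * p = fmon [Node H] * (fmon F * p)" for p :: "'a falg"
    by (simp add: fmon_mult mult.assoc[symmetric])
  then show ?case
    by (simp add: Cons fmon_mult[symmetric, of F G] ring_distribs mult.assoc)
qed (simp add: fmon_Nil)

lemma fder_linear [simp]:
  "fder a (p + q) = fder a p + fder a q" "fder a (p - q) = fder a p - fder a q"
  "fder a (fscale k p) = fscale k (fder a p)" "fder a 0 = 0"
  by (simp_all add: fder_def)

lemma fder_mult [simp]: "fder a (p * q) = fder a p * q + p * fder a q"
proof (induction p rule: falg_induct)
  case (mon k F)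
  show ?case
    by (induction q rule: falg_induct)
      (simp_all add: ring_distribs fscale_mult_left fscale_mult_right fmon_mult fder_def
        fder_mon_append falg_vs.scale_right_distrib mult.commute)
qed (simp_all add: ring_distribs)

lemma fder_fgraft [simp]: "fder a (fgraft p) = fgraft (a * p + fder a p)"
  by (induction p rule: falg_induct)
    (simp_all add: ring_distribs fder_def fmon_Nil fscale_mult_right falg_vs.scale_right_distrib)

lemma fder_one [simp]: "fder a 1 = 0"
  by (simp add: fder_def fmon_Nil[symmetric])

text \<open>A forest is 1 or the graft of the branches of its first tree times the rest, so a linear
  claim only has to survive the passage from \<open>p\<close> and \<open>q\<close> to
  \<open>fgraft p * q\<close>.\<close>

lemma falg_struct_induct [case_names zero add scale one mult]:
  assumes "P 0" "\<And>p q. P p \<Longrightarrow> P q \<Longrightarrow> P (p + q)" "\<And>k p. P p \<Longrightarrow> P (fscale k p)"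
    "P 1" "\<And>p q. P p \<Longrightarrow> P q \<Longrightarrow> P (fgraft p * q)"
  shows "P p"
proof -
  have "P (fmon F)" for F
  proof (induction F rule: forest_induct)
    case (Cons H F)
    have "P (fgraft (fmon H) * fmon F)" by (rule assms(5)) (fact Cons)+
    then show ?case by (simp add: fmon_mult)
  qed (simp add: fmon_Nil assms)
  then show ?thesis
    by (induction p rule: falg_induct) (simp_all add: assms)
qed

lemma fder_linear_left:
  "fder (a + b) p = fder a p + fder b p" "fder (fscale k a) p = fscale k (fder a p)"
  by (induction p rule: falg_struct_induct)
    (simp_all add: ring_distribs fscale_mult_left fscale_mult_right falg_vs.scale_right_distrib
      falg_vs.scale_left_commute)

text \<open>On \<open>fgraft p\<close>, applying both derivations puts a D_b p + b D_a p under the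
  graft. This is symmetric in \<open>a\<close> and \<open>b\<close> and cancels; what remains is (ab
  - ba) p together with the identity for \<open>p\<close>.\<close>

lemma fder_associator:
  "fder (a * b - b * a) p =
    (fder a (fder b p) - fder (fder a b) p) - (fder b (fder a p) - fder (fder b a) p)"
proof (induction p rule: falg_struct_induct)
  case (add p q)
  show ?case by (simp only: fder_linear add) (simp add: algebra_simps)
next
  case (scale k p)
  show ?case
    by (simp only: fder_linear scale) (simp add: falg_vs.scale_right_diff_distrib)
next
  case (mult p q)
  show ?case
    by (simp only: fder_mult fder_fgraft fder_linear fgraft_simps mult) (simp add: algebra_simps)
qed simp_all

interpretation falg: post_lie "fscale :: 'k::field_char_0 \<Rightarrow> _" "\<lambda>a b. a * b - b * a" fder
  by unfold_locales
    (simp_all add: algebra_simps fscale_mult_left fscale_mult_right fder_linear_left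
      falg_vs.scale_right_diff_distrib fder_associator[simplified])


section \<open>The homomorphism to the forest algebra and linear independence\<close>

definition to_falg :: "'k::field_char_0 free_plie \<Rightarrow> 'k falg" where
  "to_falg = (SOME f. Vector_Spaces.linear pscale fscale f \<and> f pgen = fmon [Node []] \<and>
    (\<forall>a b. f (pbr a b) = f a * f b - f b * f a) \<and> (\<forall>a b. f (ptri a b) = fder (f a) (f b)))"

lemma to_falg_simps:
  fixes a b :: "'a::field_char_0 free_plie"
  shows "to_falg (a + b) = to_falg a + to_falg b" "to_falg (pscale k a) = fscale k (to_falg a)"
  "to_falg (pgen :: 'a free_plie) = fmon [Node []]" "to_falg (pbr a b) = to_falg a * to_falg b - to_falg b * to_falg a"
  "to_falg (ptri a b) = fder (to_falg a) (to_falg b)"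
proof -
  note * = someI_ex[OF ex1_implies_ex[OF falg.free_plie_universal], of "fmon [Node []] :: 'a falg",
      folded to_falg_def]
  show "to_falg (a + b) = to_falg a + to_falg b" "to_falg (pscale k a) = fscale k (to_falg a)"
    "to_falg (pgen :: 'a free_plie) = fmon [Node []]" "to_falg (pbr a b) = to_falg a * to_falg b - to_falg b * to_falg a"
    "to_falg (ptri a b) = fder (to_falg a) (to_falg b)"
    using * by (simp_all add: Vector_Spaces.linear_iff)
qed

primrec env_to_falg_term :: "'k::field_char_0 uterm \<Rightarrow> 'k falg" where
  "env_to_falg_term (UInc a) = to_falg a"
| "env_to_falg_term UOne = 1"
| "env_to_falg_term UZero = 0"
| "env_to_falg_term (UAdd S T) = env_to_falg_term S + env_to_falg_term T"
| "env_to_falg_term (UScale k S) = fscale k (env_to_falg_term S)"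
| "env_to_falg_term (UMul S T) = env_to_falg_term S * env_to_falg_term T"

lift_definition env_to_falg :: "'k::field_char_0 env \<Rightarrow> 'k falg" is env_to_falg_term
proof -
  fix S T :: "'k uterm" assume "u_eq S T"
  then show "env_to_falg_term S = env_to_falg_term T"
    by (induction rule: u_eq.induct)
      (simp_all add: ring_distribs mult.assoc fscale_mult_left fscale_mult_right to_falg_simps
        falg_vs.scale_left_distrib falg_vs.scale_right_distrib)
qed

lemma env_to_falg_simps [simp]:
  "env_to_falg (inc a) = to_falg (a :: 'a::field_char_0 free_plie)" "env_to_falg (1 :: 'a env) = 1"
  "env_to_falg (0 :: 'a env) = 0"
  "env_to_falg (X + Y) = env_to_falg X + env_to_falg Y"
  "env_to_falg (uscale k X) = fscale k (env_to_falg X)"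
  "env_to_falg (X * Y) = env_to_falg X * env_to_falg Y"
proof -
  show "env_to_falg (inc a) = to_falg a" by (metis abs_env_simps(1) env_to_falg.abs_eq env_to_falg_term.simps(1))
  show "env_to_falg (1 :: 'a env) = 1" by (metis abs_env_simps(2) env_to_falg.abs_eq env_to_falg_term.simps(2))
  show "env_to_falg (0 :: 'a env) = 0" by (metis abs_env_simps(3) env_to_falg.abs_eq env_to_falg_term.simps(3))
  show "env_to_falg (X + Y) = env_to_falg X + env_to_falg Y"
    by (induction X; induction Y) (simp add: env_to_falg.abs_eq flip: abs_env_simps)
  show "env_to_falg (uscale k X) = fscale k (env_to_falg X)"
    by (induction X) (simp add: env_to_falg.abs_eq flip: abs_env_simps)
  show "env_to_falg (X * Y) = env_to_falg X * env_to_falg Y"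
    by (induction X; induction Y) (simp add: env_to_falg.abs_eq flip: abs_env_simps)
qed

lemma env_to_falg_diff: "env_to_falg (X - Y) = env_to_falg X - env_to_falg Y"
  using env_to_falg_simps(4)[of "X - Y" Y] by simp

lemma env_to_falg_der: "env_to_falg (der a X) = fder (to_falg a) (env_to_falg X)"
  by (induction X rule: env_induct) (simp_all add: to_falg_simps)

text \<open>Under the homomorphism the recursion for \<open>inc a * X\<close> becomes D_a B(p) -
  B(D_a p), which is B(a p) by \<open>fder_fgraft\<close>.\<close>

lemma env_to_falg_ext_tri_gen: "env_to_falg (ext_tri X (inc pgen)) = fgraft (env_to_falg X)"
proof (induction X rule: env_rec_induct)
  case one
  show ?case by (simp add: to_falg_simps) (simp add: fmon_Nil[symmetric])
qed (simp_all add: ext_tri_inc_mult env_to_falg_diff env_to_falg_der)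

lemma env_to_falg_iota: "env_to_falg (iota F :: 'k::field_char_0 env) = fmon F"
proof (induction F rule: forest_induct)
  case Nil
  show ?case by (simp add: iota_def fmon_Nil)
next
  case (Cons H F)
  have "iota (Node H # F) = ext_tri (iota H) (inc pgen) * (iota F :: 'k env)"
    by (simp add: iota_def utri_eq)
  with Cons show ?case
    by (simp add: env_to_falg_ext_tri_gen fmon_mult)
qed

lemma iota_independent:
  assumes "finite S" "(\<Sum>F\<in>S. uscale (c F) (iota F)) = (\<Sum>F\<in>S. uscale (d F) (iota F :: 'k::field_char_0 env))"
    and "G \<in> S"
  shows "c G = d G"
proof -
  have "Poly_Mapping.lookup (env_to_falg (\<Sum>F\<in>S. uscale (c F) (iota F :: 'k env))) (FWord G) = c G"
    if "finite S" "G \<in> S" for c :: "forest \<Rightarrow> 'k" and S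
  proof -
    have "env_to_falg (\<Sum>F\<in>S. uscale (c F) (iota F :: 'k env)) = (\<Sum>F\<in>S. fscale (c F) (fmon F))"
      using that(1) by induction (simp_all add: env_to_falg_iota)
    also have "Poly_Mapping.lookup \<dots> (FWord G) = (\<Sum>F\<in>S. if F = G then c F else 0)"
      by (simp add: lookup_sum fscale_fmon lookup_single when_def)
    finally show ?thesis using that by simp
  qed
  from this[of S c] this[of S d] show ?thesis using assms by simp
qed

section \<open>Series indexed by forests\<close>

lemma forest_size_simps [simp]:
  "forest_size [] = 0" "forest_size (Node H # F) = Suc (forest_size H + forest_size F)"
  "forest_size (F @ G) = forest_size F + forest_size G"
  by (simp_all add: forest_size_def)

lemma iota_simps:
  "iota [] = 1" "iota (F @ G) = iota F * iota G" "iota [Node H] = ext_tri (iota H) (inc pgen)"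
  by (simp_all add: iota_def utri_eq)

lemma length_le_forest_size: "length F \<le> forest_size F"
  by (induction F rule: forest_induct) auto

lemma For_0: "For 0 = {[]}"
proof -
  have "F = []" if "forest_size F = 0" for F
    using length_le_forest_size[of F] that by simp
  then show ?thesis by (auto simp: For_def)
qed

lemma For_Suc: "For (Suc n) = (\<Union>i\<le>n. (\<lambda>(H, F). Node H # F) ` (For i \<times> For (n - i)))"
proof (intro equalityI subsetI)
  fix F assume F: "F \<in> For (Suc n)"
  then obtain T G where TG: "F = T # G"
    by (cases F) (auto simp: For_def)
  obtain H where "T = Node H" by (cases T)
  then show "F \<in> (\<Union>i\<le>n. (\<lambda>(H, F). Node H # F) ` (For i \<times> For (n - i)))"
    using F TG by (auto simp: For_def image_iff intro!: bexI[of _ "forest_size H"])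
qed (auto simp: For_def)

lemma finite_For: "finite (For n)"
proof (induction n rule: less_induct)
  case (less n)
  show ?case
  proof (cases n)
    case (Suc m)
    show ?thesis
      unfolding Suc For_Suc
      by (intro finite_UN_I finite_atMost finite_imageI finite_cartesian_product less) (auto simp: Suc)
  qed (simp add: For_0)
qed

definition forest_series :: "(forest \<Rightarrow> 'k::field_char_0) \<Rightarrow> 'k env fps" where
  "forest_series c = Abs_fps (\<lambda>n. \<Sum>F\<in>For n. uscale (c F) (iota F))"

definition concat_conv :: "(forest \<Rightarrow> 'k::field_char_0) \<Rightarrow> (forest \<Rightarrow> 'k) \<Rightarrow> forest \<Rightarrow> 'k" where
  "concat_conv c d F = (\<Sum>i\<le>length F. c (take i F) * d (drop i F))"

lemma forest_series_mult: "forest_series c * forest_series d = forest_series (concat_conv c d)"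
proof (rule fps_ext)
  fix n
  have "(forest_series c * forest_series d) $ n
      = (\<Sum>i\<le>n. \<Sum>F\<in>For i. \<Sum>G\<in>For (n - i). uscale (c F * d G) (iota (F @ G)))"
    by (simp add: fps_mult_nth forest_series_def sum_product iota_simps uscale_mult_left
        uscale_mult_right atLeast0AtMost mult.commute)
  also have "\<dots> = (\<Sum>(i, F, G)\<in>(SIGMA i:{..n}. For i \<times> For (n - i)). uscale (c F * d G) (iota (F @ G)))"
    by (simp add: sum.Sigma sum.cartesian_product split_def finite_For)
  \<comment> \<open>A pair of forests is the same as its concatenation with the position of the
    cut.\<close>
  also have "\<dots> = (\<Sum>(F, i)\<in>(SIGMA F:For n. {..length F}). uscale (c (take i F) * d (drop i F)) (iota F))"
  proof (rule sum.reindex_bij_witness[where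
      i = "\<lambda>(F, i). (forest_size (take i F), take i F, drop i F)" and
      j = "\<lambda>(i, F, G). (F @ G, length F)"])
    fix x assume x: "x \<in> (SIGMA F:For n. {..length F})"
    obtain F i where [simp]: "x = (F, i)" by (cases x)
    have "forest_size F = forest_size (take i F) + forest_size (drop i F)"
      using forest_size_simps(3)[of "take i F" "drop i F"] by simp
    with x show "(case x of (F, i) \<Rightarrow> (forest_size (take i F), take i F, drop i F))
        \<in> (SIGMA i:{..n}. For i \<times> For (n - i))"
      by (auto simp: For_def)
  qed (auto simp: For_def)
  also have "\<dots> = forest_series (concat_conv c d) $ n"
    by (simp add: sum.Sigma[symmetric] finite_For forest_series_def concat_conv_def
        env_vs.scale_sum_left)
  finally show "(forest_series c * forest_series d) $ n = forest_series (concat_conv c d) $ n" .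
qed

definition on_trees :: "(ptree \<Rightarrow> 'k::field_char_0) \<Rightarrow> forest \<Rightarrow> 'k" where
  "on_trees z F = (case F of [T] \<Rightarrow> z T | _ \<Rightarrow> 0)"

lemma graft_forest_series:
  "graft (forest_series c) = forest_series (on_trees (\<lambda>T. c (subtrees T)))"
proof (rule fps_ext)
  fix n
  show "graft (forest_series c) $ n = forest_series (on_trees (\<lambda>T. c (subtrees T))) $ n"
  proof (cases n)
    case 0
    then show ?thesis by (simp add: forest_series_def For_0 on_trees_def)
  next
    case (Suc m)
    let ?h = "\<lambda>H. [Node H]"
    have "graft (forest_series c) $ n = (\<Sum>H\<in>For m. uscale (c H) (iota [Node H]))"
      by (simp add: Suc forest_series_def ext_tri_sum iota_simps)
    also have "\<dots> = (\<Sum>F\<in>?h ` For m. uscale (on_trees (\<lambda>T. c (subtrees T)) F) (iota F))"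
      by (subst sum.reindex) (auto simp: inj_on_def on_trees_def)
    also have "\<dots> = (\<Sum>F\<in>For n. uscale (on_trees (\<lambda>T. c (subtrees T)) F) (iota F))"
    proof (rule sum.mono_neutral_left)
      show "\<forall>F\<in>For n - ?h ` For m. uscale (on_trees (\<lambda>T. c (subtrees T)) F) (iota F) = 0"
      proof
        fix F assume F: "F \<in> For n - ?h ` For m"
        have "F \<noteq> [T]" for T
          using F Suc by (cases T) (auto simp: For_def)
        then have "on_trees (\<lambda>T. c (subtrees T)) F = 0"
          by (auto simp: on_trees_def split: list.split)
        then show "uscale (on_trees (\<lambda>T. c (subtrees T)) F) (iota F) = 0" by simp
      qed
    qed (auto simp: For_def Suc finite_For[unfolded For_def])
    finally show ?thesis by (simp add: forest_series_def)
  qed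
qed

lemma forest_series_one: "forest_series (\<lambda>F. if F = [] then 1 else 0) = 1"
proof (rule fps_ext)
  fix n
  show "forest_series (\<lambda>F. if F = [] then 1 else 0) $ n = (1 :: 'a env fps) $ n"
  proof (cases "n = 0")
    case True
    then show ?thesis by (simp add: forest_series_def For_0 iota_simps)
  next
    case False
    then show ?thesis by (auto simp: forest_series_def For_def intro!: sum.neutral)
  qed
qed

text \<open>Only the cut after the first tree leaves a single tree on the left, so a forest arises
  from the power in just one way.\<close>

lemma forest_series_on_trees_power:
  "forest_series (on_trees z) ^ j =
    forest_series (\<lambda>F. if length F = j then prod_list (map z F) else 0)"
proof (induction j)
  case 0
  have "(\<lambda>F. if length F = 0 then prod_list (map z F) else 0) = (\<lambda>F. if F = [] then 1 else 0)"
    by auto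
  then show ?case by (simp add: forest_series_one[symmetric] cong: if_cong)
next
  case (Suc j)
  let ?g = "\<lambda>j F. if length F = j then prod_list (map z F) else 0"
  have "concat_conv (on_trees z) (?g j) F = ?g (Suc j) F" for F
  proof (cases F)
    case Nil
    then show ?thesis by (simp add: concat_conv_def on_trees_def)
  next
    case (Cons T G)
    have z: "on_trees z (take i F) = 0" if "i \<le> length F" "i \<noteq> 1" for i
    proof -
      have "length (take i F) \<noteq> 1" using that by simp
      then have "take i F \<noteq> [T]" for T
        by (metis One_nat_def length_Cons list.size(3))
      then show ?thesis by (auto simp: on_trees_def split: list.split)
    qed
    have "concat_conv (on_trees z) (?g j) F
        = (\<Sum>i\<in>{1}. on_trees z (take i F) * ?g j (drop i F))"
      unfolding concat_conv_def
      by (rule sum.mono_neutral_right) (use z Cons in auto)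
    then show ?thesis by (simp add: Cons on_trees_def)
  qed
  then have "concat_conv (on_trees z) (?g j) = ?g (Suc j)" by (rule ext)
  then show ?case by (simp only: power_Suc Suc forest_series_mult)
qed

lemma series_exp_forest_series:
  "series_exp (forest_series (on_trees z)) =
    forest_series (\<lambda>F. prod_list (map z F) / fact (length F))"
proof (rule fps_ext)
  fix n
  have "series_exp (forest_series (on_trees z)) $ n =
      (\<Sum>j\<le>n. \<Sum>F\<in>For n. uscale (if length F = j then prod_list (map z F) / fact j else 0) (iota F))"
    by (simp only: series_exp_def forest_series_on_trees_power fps_nth_Abs_fps)
      (simp only: forest_series_def fps_nth_Abs_fps env_vs.scale_sum_right,
        intro sum.cong refl, simp)
  also have "\<dots> = (\<Sum>F\<in>For n. uscale (\<Sum>j\<le>n. if length F = j then prod_list (map z F) / fact j else 0) (iota F))"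
    by (subst sum.swap) (simp only: env_vs.scale_sum_left)
  also have "\<dots> = (\<Sum>F\<in>For n. uscale (prod_list (map z F) / fact (length F)) (iota F))"
  proof (rule sum.cong[OF refl])
    fix F assume "F \<in> For n"
    then have "length F \<le> n"
      using length_le_forest_size[of F] by (simp add: For_def)
    then show "uscale (\<Sum>j\<le>n. if length F = j then prod_list (map z F) / fact j else 0) (iota F)
        = uscale (prod_list (map z F) / fact (length F)) (iota F)"
      by simp
  qed
  finally show "series_exp (forest_series (on_trees z)) $ n =
      forest_series (\<lambda>F. prod_list (map z F) / fact (length F)) $ n"
    by (simp add: forest_series_def)
qed

text \<open>The recursion of \<open>flow\<close> on coefficients: a final segment of trees comes
  from the new exponential, and the branches of these trees from \<open>flow K\<close>.\<close>

primrec flow_coeff :: "nat \<Rightarrow> forest \<Rightarrow> 'k::field_char_0" where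
  "flow_coeff 0 = (\<lambda>F. if F = [] then 1 else 0)"
| "flow_coeff (Suc K) = concat_conv (flow_coeff K)
    (\<lambda>F. prod_list (map (\<lambda>T. flow_coeff K (subtrees T)) F) / fact (length F))"

lemma flow_eq_forest_series: "flow K = forest_series (flow_coeff K)"
  by (induction K)
    (simp_all add: forest_series_one graft_forest_series series_exp_forest_series forest_series_mult)

text \<open>Binomial inversion by induction: in the relation for \<open>K = k\<close> the term of
  index \<open>k\<close> has coefficient 1, and all others have smaller index.\<close>

lemma exp_sub_power_eq_forest_series:
  assumes "\<And>K F. flow_coeff K F = (\<Sum>k\<le>K. of_nat (K choose k) * w k F)"
  shows "exp_sub_power k = forest_series (w k)"
proof (induction k rule: less_induct)
  case (less k)
  have of_nat: "of_nat c * X = uscale (of_nat c) X" for c and X :: "'a env"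
    by (induction c) (simp_all add: ring_distribs env_vs.scale_left_distrib)
  have split: "(\<Sum>i\<le>k. f i) = (\<Sum>i<k. f i) + f k" for f :: "nat \<Rightarrow> 'b::comm_monoid_add"
    by (simp add: lessThan_Suc_atMost[symmetric])
  have "(flow k :: 'a env fps) = (\<Sum>i<k. of_nat (k choose i) * forest_series (w i)) + exp_sub_power k"
    by (simp add: flow_eq_exp_sub_power split less)
  moreover have "(flow k :: 'a env fps) =
      (\<Sum>i<k. of_nat (k choose i) * forest_series (w i)) + forest_series (w k)"
  proof (rule fps_ext)
    fix n
    have "flow k $ n = (\<Sum>F\<in>For n. uscale (\<Sum>i\<le>k. of_nat (k choose i) * w i F) (iota F))"
      by (simp add: flow_eq_forest_series forest_series_def assms)
    also have "\<dots> = (\<Sum>i\<le>k. uscale (of_nat (k choose i)) (\<Sum>F\<in>For n. uscale (w i F) (iota F)))"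
      by (simp add: env_vs.scale_sum_left env_vs.scale_sum_right) (rule sum.swap)
    also have "\<dots> = (\<Sum>i\<le>k. of_nat (k choose i) * forest_series (w i) $ n)"
      by (simp add: of_nat forest_series_def)
    finally show "flow k $ n =
        ((\<Sum>i<k. of_nat (k choose i) * forest_series (w i)) + forest_series (w k)) $ n"
      by (simp add: split fps_sum_nth fps_of_nat[symmetric])
  qed
  ultimately show ?case by simp
qed

lemma chi_coeff_eq:
  assumes "\<And>K F. flow_coeff K F = (\<Sum>k\<le>K. of_nat (K choose k) * w k F)"
  shows "(chi_coeff F :: 'k::field_char_0) =
    (\<Sum>k = 1..forest_size F. (- 1) ^ (k - 1) / of_nat k * w k F)"
proof -
  let ?c = "\<lambda>F. (\<Sum>k = 1..forest_size F. (- 1) ^ (k - 1) / of_nat k * w k F)"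
  have c: "chi n = (\<Sum>F\<in>For n. uscale (?c F) (iota F))" for n
  proof -
    have "chi n = (\<Sum>k = 1..n. uscale ((- 1) ^ (k - 1) / of_nat k) (exp_sub_power k $ n))"
      by (simp add: chi_def gl_log_def exp_sub_power_def)
    also have "\<dots> = (\<Sum>k = 1..n. \<Sum>F\<in>For n. uscale ((- 1) ^ (k - 1) / of_nat k * w k F) (iota F))"
      by (simp add: exp_sub_power_eq_forest_series[OF assms] forest_series_def
          env_vs.scale_sum_right)
    also have "\<dots> = (\<Sum>F\<in>For n. uscale (?c F) (iota F))"
      by (subst sum.swap) (simp add: env_vs.scale_sum_left For_def)
    finally show ?thesis .
  qed
  have "chi_coeff = ?c"
    unfolding chi_coeff_def
  proof (rule the_equality)
    \<comment> \<open>\<open>chi_coeff\<close> is a definite description, so uniqueness is needed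
      too; it holds degree by degree by linear independence.\<close>
    fix d :: "forest \<Rightarrow> 'k" assume d: "\<forall>n. chi n = (\<Sum>F\<in>For n. uscale (d F) (iota F))"
    show "d = ?c"
    proof
      fix G
      show "d G = ?c G"
        by (rule iota_independent[OF finite_For[of "forest_size G"]])
          (use c[of "forest_size G"] d in \<open>simp_all add: For_def\<close>)
    qed
  qed (simp add: c)
  then have "chi_coeff F = ?c F" by (rule fun_cong)
  then show ?thesis by simp
qed

section \<open>Labelled forests\<close>

lemma Cons_in_forest_verts:
  "i # p \<in> forest_verts F \<longleftrightarrow> i < length F \<and> (p = [] \<or> p \<in> forest_verts (subtrees (F ! i)))"
  by (cases p) (auto simp: forest_verts_def tree_verts_def)

lemma Nil_notin_forest_verts [simp]: "[] \<notin> forest_verts F"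
  by (simp add: forest_verts_def)

lemma forest_verts_eq:
  "forest_verts F = (\<Union>i<length F. Cons i ` insert [] (forest_verts (subtrees (F ! i))))"
proof (intro set_eqI)
  fix v show "v \<in> forest_verts F \<longleftrightarrow>
      v \<in> (\<Union>i<length F. Cons i ` insert [] (forest_verts (subtrees (F ! i))))"
    by (cases v) (auto simp: Cons_in_forest_verts)
qed

lemma forest_nth_induct [case_names step]:
  assumes "\<And>F. (\<And>i. i < length F \<Longrightarrow> P (subtrees (F ! i))) \<Longrightarrow> P F"
  shows "P F"
proof -
  have "\<forall>i<length F. P (subtrees (F ! i))"
  proof (induction F rule: forest_induct)
    case (Cons H F)
    have "P H" by (rule assms) (use Cons(1) in blast)
    with Cons(2) show ?case by (auto simp: nth_Cons')
  qed simp
  then show ?thesis using assms[of F] by blast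
qed

lemma finite_forest_verts: "finite (forest_verts F)"
proof (induction F rule: forest_nth_induct)
  case (step F)
  then show ?case by (subst forest_verts_eq) auto
qed

lemma forest_verts_parent: "v @ [i] \<in> forest_verts F \<Longrightarrow> v = [] \<or> v \<in> forest_verts F"
proof (induction v arbitrary: F)
  case (Cons j v)
  then show ?case by (auto simp: Cons_in_forest_verts)
qed simp

text \<open>The labeling belonging to a nested tubing counts, for each vertex, the tubes containing it,
  minus one.\<close>

definition labelings :: "nat \<Rightarrow> forest \<Rightarrow> (nat list \<Rightarrow> nat) set" where
  "labelings K F = {f \<in> forest_verts F \<rightarrow>\<^sub>E {..<K}.
    (\<forall>v i. v \<in> forest_verts F \<longrightarrow> v @ [i] \<in> forest_verts F \<longrightarrow> f (v @ [i]) < f v) \<and>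
    (\<forall>v i j. v @ [i] \<in> forest_verts F \<longrightarrow> v @ [j] \<in> forest_verts F \<longrightarrow> i < j \<longrightarrow>
      f (v @ [i]) \<le> f (v @ [j]))}"

definition label_count :: "forest \<Rightarrow> (nat list \<Rightarrow> nat) \<Rightarrow> nat list \<Rightarrow> nat \<Rightarrow> nat" where
  "label_count F f v m = card {u \<in> forest_verts F. child_of u v \<and> f u = m}"

text \<open>The empty address stands for an additional root below the forest.\<close>

definition label_weight :: "forest \<Rightarrow> (nat list \<Rightarrow> nat) \<Rightarrow> 'k::field_char_0" where
  "label_weight F f = (\<Prod>v\<in>insert [] (forest_verts F). \<Prod>m\<in>f ` forest_verts F.
     1 / fact (label_count F f v m))"

lemma finite_labelings: "finite (labelings K F)"
  by (rule finite_subset[of _ "forest_verts F \<rightarrow>\<^sub>E {..<K}"])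
    (auto simp: labelings_def intro!: finite_PiE finite_forest_verts)

lemma label_count_zero:
  assumes "m \<notin> f ` forest_verts F" shows "label_count F f v m = 0"
proof -
  have "{u \<in> forest_verts F. child_of u v \<and> f u = m} = {}"
    using assms by auto
  then show ?thesis unfolding label_count_def by (simp only: card.empty)
qed

text \<open>Labels that do not occur contribute 1/0! = 1, so labelings with different bounds can be
  compared factor by factor.\<close>

lemma label_weight_superset:
  assumes "finite S" "f ` forest_verts F \<subseteq> S"
  shows "label_weight F f = (\<Prod>v\<in>insert [] (forest_verts F). \<Prod>m\<in>S. 1 / fact (label_count F f v m))"
  unfolding label_weight_def
  by (intro prod.cong refl prod.mono_neutral_left) (use assms label_count_zero in auto)

subsection \<open>Labelings of the roots\<close>

definition root_labels :: "nat \<Rightarrow> nat \<Rightarrow> (nat \<Rightarrow> nat) set" where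
  "root_labels r K = {l \<in> {..<r} \<rightarrow>\<^sub>E {..<K}. \<forall>i j. i < j \<longrightarrow> j < r \<longrightarrow> l i \<le> l j}"

definition root_weight :: "nat \<Rightarrow> nat \<Rightarrow> (nat \<Rightarrow> nat) \<Rightarrow> 'k::field_char_0" where
  "root_weight r K l = (\<Prod>m<K. 1 / fact (card {i. i < r \<and> l i = m}))"

text \<open>The value \<open>undefined\<close> off the roots keeps the function extensional, as
  membership in \<open>root_labels\<close> demands.\<close>

definition extend_labels :: "nat \<Rightarrow> nat \<Rightarrow> nat \<Rightarrow> (nat \<Rightarrow> nat) \<Rightarrow> nat \<Rightarrow> nat" where
  "extend_labels r K i l j = (if j < i then l j else if j < r then K else undefined)"

lemma finite_root_labels: "finite (root_labels r K)"
  by (rule finite_subset[of _ "{..<r} \<rightarrow>\<^sub>E {..<K}"]) (auto simp: root_labels_def intro!: finite_PiE)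

lemma root_labels_below:
  assumes "l \<in> root_labels r (Suc K)"
  shows "{j. j < r \<and> l j < K} = {..<card {j. j < r \<and> l j < K}}" (is "?D = _")
proof -
  define m where "m = (LEAST n. n \<notin> ?D)"
  have "r \<notin> ?D" by simp
  then have m: "m \<notin> ?D" unfolding m_def by (rule LeastI)
  have lt: "j \<in> ?D" if "j < m" for j
    using not_less_Least that unfolding m_def by blast
  have "j < m" if "j \<in> ?D" for j
  proof (rule ccontr)
    assume "\<not> j < m"
    moreover have "l m \<le> l j" if "m < j"
      using assms that \<open>j \<in> ?D\<close> by (auto simp: root_labels_def)
    ultimately have "m \<in> ?D" using \<open>j \<in> ?D\<close> by (cases "m = j") auto
    then show False using m by simp
  qed
  with lt have "?D = {..<m}" by blast
  then show ?thesis by (metis card_lessThan)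
qed

text \<open>Weak monotonicity forces the top label \<open>K\<close> onto a final segment of the
  roots; \<open>i\<close> is the number of roots before it.\<close>

lemma bij_extend_labels:
  "bij_betw (\<lambda>(i, l). extend_labels r K i l) (SIGMA i:{..r}. root_labels i K) (root_labels r (Suc K))"
proof (rule bij_betwI[where g = "\<lambda>l. let i = card {j. j < r \<and> l j < K} in (i, restrict l {..<i})"])
  show "(\<lambda>(i, l). extend_labels r K i l) \<in> (SIGMA i:{..r}. root_labels i K) \<rightarrow> root_labels r (Suc K)"
    by (fastforce simp: extend_labels_def root_labels_def PiE_def Pi_def extensional_def less_Suc_eq)
next
  show "(\<lambda>l. let i = card {j. j < r \<and> l j < K} in (i, restrict l {..<i}))
      \<in> root_labels r (Suc K) \<rightarrow> (SIGMA i:{..r}. root_labels i K)"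
  proof
    fix l assume l: "l \<in> root_labels r (Suc K)"
    define i where "i = card {j. j < r \<and> l j < K}"
    have D: "{j. j < r \<and> l j < K} = {..<i}"
      using root_labels_below[OF l] i_def by simp
    have "i \<le> r"
      unfolding i_def by (rule order_trans[OF card_mono[of "{..<r}"]]) auto
    moreover have "restrict l {..<i} \<in> root_labels i K"
      using l D \<open>i \<le> r\<close> by (auto simp: root_labels_def)
    ultimately show "(let i = card {j. j < r \<and> l j < K} in (i, restrict l {..<i}))
        \<in> (SIGMA i:{..r}. root_labels i K)"
      by (simp add: i_def[symmetric] Let_def)
  qed
next
  fix x assume "x \<in> (SIGMA i:{..r}. root_labels i K)"
  then obtain i l where x: "x = (i, l)" "i \<le> r" "l \<in> root_labels i K" by auto
  then have lt: "l j < K" if "j < i" for j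
    using that by (auto simp: root_labels_def)
  have "{j. j < r \<and> extend_labels r K i l j < K} = {..<i}"
    using x lt by (auto simp: extend_labels_def split: if_splits)
  moreover have "restrict (extend_labels r K i l) {..<i} = l"
    using x by (auto simp: extend_labels_def root_labels_def PiE_def extensional_def)
  ultimately show "(let i = card {j. j < r \<and> (case x of (i, l) \<Rightarrow> extend_labels r K i l) j < K}
      in (i, restrict (case x of (i, l) \<Rightarrow> extend_labels r K i l) {..<i})) = x"
    by (simp add: x)
next
  fix l assume l: "l \<in> root_labels r (Suc K)"
  define i where "i = card {j. j < r \<and> l j < K}"
  have D: "{j. j < r \<and> l j < K} = {..<i}"
    using root_labels_below[OF l] i_def by simp
  have "extend_labels r K i (restrict l {..<i}) j = l j" for j
  proof (cases "j < i")
    case True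
    then show ?thesis by (simp add: extend_labels_def)
  next
    case False
    with D have "j < r \<Longrightarrow> \<not> l j < K" by blast
    with l False show ?thesis
      by (force simp: extend_labels_def root_labels_def PiE_def extensional_def Pi_def)
  qed
  then show "(case let i = card {j. j < r \<and> l j < K} in (i, restrict l {..<i}) of
      (i, l) \<Rightarrow> extend_labels r K i l) = l"
    by (simp add: i_def[symmetric] Let_def fun_eq_iff)
qed

lemma root_weight_extend:
  assumes "l \<in> root_labels i K" "i \<le> r"
  shows "root_weight r (Suc K) (extend_labels r K i l) = root_weight i K l / fact (r - i)"
proof -
  have lt: "l j < K" if "j < i" for j
    using that assms by (auto simp: root_labels_def)
  have "{j. j < r \<and> extend_labels r K i l j = m} = {j. j < i \<and> l j = m}" if "m < K" for m
    using assms lt that by (auto simp: extend_labels_def split: if_splits)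
  moreover have "{j. j < r \<and> extend_labels r K i l j = K} = {i..<r}"
  proof (rule set_eqI)
    fix j show "j \<in> {j. j < r \<and> extend_labels r K i l j = K} \<longleftrightarrow> j \<in> {i..<r}"
      using assms(2) lt[of j] by (cases "j < i") (auto simp: extend_labels_def)
  qed
  ultimately show ?thesis
    by (simp add: root_weight_def)
qed

lemma prod_list_map_drop:
  "prod_list (map f (drop i F)) = (\<Prod>j\<in>{i..<length F}. f (F ! j))"
proof -
  have "prod_list (map f (drop i F)) = (\<Prod>j\<in>{0..<length F - i}. f (F ! (i + j)))"
    by (simp add: prod.list_conv_set_nth)
  also have "\<dots> = (\<Prod>j\<in>{i..<length F}. f (F ! j))"
    by (rule prod.reindex_bij_witness[where i = "\<lambda>j. j - i" and j = "\<lambda>j. i + j"]) auto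
  finally show ?thesis .
qed

text \<open>Unrolls the recursion over \<open>K\<close>: a root with label \<open>m\<close> is
  contributed by the step from \<open>m\<close> to \<open>m + 1\<close>, so its branches are
  weighted by \<open>flow_coeff m\<close>. The roots carrying the top label belong to the last
  step.\<close>

lemma flow_coeff_root_labels:
  "(flow_coeff K F :: 'a::field_char_0) = (\<Sum>l\<in>root_labels (length F) K.
     root_weight (length F) K l * (\<Prod>i<length F. flow_coeff (l i) (subtrees (F ! i))))"
proof (induction K arbitrary: F)
  case 0
  show ?case
  proof (cases F)
    case Nil
    then show ?thesis by (simp add: root_labels_def root_weight_def)
  next
    case (Cons T G)
    then have "root_labels (length F) 0 = {}"
      by (auto simp: root_labels_def PiE_eq_empty_iff)
    then show ?thesis using Cons by simp
  qed
next
  case (Suc K)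
  let ?r = "length F"
  let ?g = "\<lambda>r K F l. (root_weight r K l :: 'a) * (\<Prod>i<r. flow_coeff (l i) (subtrees (F ! i)))"
  have ext: "?g ?r (Suc K) F (extend_labels ?r K i l) =
      ?g i K (take i F) l * (prod_list (map (\<lambda>T. flow_coeff K (subtrees T)) (drop i F)) / fact (?r - i))"
    if "i \<le> ?r" "l \<in> root_labels i K" for i l
  proof -
    have split: "{..<?r} = {..<i} \<union> {i..<?r}" using that by auto
    have "(\<Prod>j<?r. flow_coeff (extend_labels ?r K i l j) (subtrees (F ! j)) :: 'a)
        = (\<Prod>j<i. flow_coeff (extend_labels ?r K i l j) (subtrees (F ! j))) *
          (\<Prod>j\<in>{i..<?r}. flow_coeff (extend_labels ?r K i l j) (subtrees (F ! j)))"
      by (subst split, subst prod.union_disjoint) auto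
    also have "\<dots> = (\<Prod>j<i. flow_coeff (l j) (subtrees (take i F ! j))) *
          (\<Prod>j\<in>{i..<?r}. flow_coeff K (subtrees (F ! j)))"
      by (intro arg_cong2[where f = "(*)"] prod.cong) (auto simp: extend_labels_def)
    finally show ?thesis
      by (simp add: root_weight_extend that prod_list_map_drop)
  qed
  let ?h = "\<lambda>i. prod_list (map (\<lambda>T. flow_coeff K (subtrees T)) (drop i F)) / fact (?r - i) :: 'a"
  have take: "flow_coeff K (take i F) = (\<Sum>l\<in>root_labels i K. ?g i K (take i F) l)" if "i \<le> ?r" for i
    using Suc[of "take i F"] that by (simp add: min_def)
  have "flow_coeff (Suc K) F = (\<Sum>i\<le>?r. flow_coeff K (take i F) * ?h i)"
    by (simp add: concat_conv_def)
  also have "\<dots> = (\<Sum>i\<le>?r. \<Sum>l\<in>root_labels i K. ?g i K (take i F) l * ?h i)"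
    by (intro sum.cong refl) (simp only: take atMost_iff sum_distrib_right)
  also have "\<dots> = (\<Sum>i\<le>?r. \<Sum>l\<in>root_labels i K. ?g ?r (Suc K) F (extend_labels ?r K i l))"
    by (intro sum.cong refl) (simp only: ext atMost_iff)
  also have "\<dots> = (\<Sum>x\<in>(SIGMA i:{..?r}. root_labels i K).
      ?g ?r (Suc K) F ((\<lambda>(i, l). extend_labels ?r K i l) x))"
    by (simp add: sum.Sigma finite_root_labels split_def)
  also have "\<dots> = (\<Sum>l\<in>root_labels ?r (Suc K). ?g ?r (Suc K) F l)"
    by (rule sum.reindex_bij_betw[OF bij_extend_labels])
  finally show ?case .
qed


subsection \<open>Decomposition of labelings along the roots\<close>

definition join_labels :: "forest \<Rightarrow> (nat \<Rightarrow> nat) \<Rightarrow> (nat \<Rightarrow> nat list \<Rightarrow> nat) \<Rightarrow> nat list \<Rightarrow> nat" where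
  "join_labels F l g v = (if v \<in> forest_verts F
     then if tl v = [] then l (hd v) else g (hd v) (tl v) else undefined)"

lemma join_labels_simps:
  "i < length F \<Longrightarrow> join_labels F l g [i] = l i"
  "i < length F \<Longrightarrow> p \<in> forest_verts (subtrees (F ! i)) \<Longrightarrow> join_labels F l g (i # p) = g i p"
  using Nil_notin_forest_verts by (auto simp: join_labels_def Cons_in_forest_verts)

abbreviation label_families :: "forest \<Rightarrow> (nat \<Rightarrow> nat) \<Rightarrow> (nat \<Rightarrow> nat list \<Rightarrow> nat) set" where
  "label_families F l \<equiv> PiE {..<length F} (\<lambda>i. labelings (l i) (subtrees (F ! i)))"

text \<open>Bounds the labels of a branch by the label of its root, so that the restricted labeling
  lies in \<open>labelings (f [i])\<close> of the branch.\<close>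

lemma labelings_below_root:
  assumes "f \<in> labelings K F" "i # p \<in> forest_verts F" "p \<noteq> []"
  shows "f (i # p) < f [i]"
  using assms(2,3)
proof (induction p rule: rev_induct)
  case (snoc j p)
  have p: "p = [] \<or> p \<in> forest_verts (subtrees (F ! i))" and i: "i < length F"
    using snoc.prems forest_verts_parent[of p j] by (auto simp: Cons_in_forest_verts)
  then have ip: "i # p \<in> forest_verts F" by (simp add: Cons_in_forest_verts)
  have "f ((i # p) @ [j]) < f (i # p)"
    using assms(1) ip snoc.prems unfolding labelings_def by force
  then show ?case
    using snoc.IH[OF ip] by (cases "p = []") auto
qed simp

lemma join_labels_in_labelings:
  assumes l: "l \<in> root_labels (length F) K" and g: "g \<in> label_families F l"
  shows "join_labels F l g \<in> labelings K F"
proof -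
  have lK: "l i < K" if "i < length F" for i
    using l that by (auto simp: root_labels_def)
  have gi: "g i \<in> labelings (l i) (subtrees (F ! i))" if "i < length F" for i
    using g that by auto
  have gl: "g i p < l i" if "i < length F" "p \<in> forest_verts (subtrees (F ! i))" for i p
    using gi[OF that(1)] that(2) by (auto simp: labelings_def)
  have "join_labels F l g v < K" if v: "v \<in> forest_verts F" for v
  proof (cases v)
    case (Cons i p)
    then show ?thesis
      using v lK[of i] gl[of i p] by (auto simp: Cons_in_forest_verts join_labels_simps)
  qed (use v in simp)
  moreover have "join_labels F l g (v @ [j]) < join_labels F l g v"
    if v: "v \<in> forest_verts F" "v @ [j] \<in> forest_verts F" for v j
  proof (cases v)
    case (Cons i p)
    with v have i: "i < length F" and q: "p @ [j] \<in> forest_verts (subtrees (F ! i))"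
      by (auto simp: Cons_in_forest_verts)
    show ?thesis
    proof (cases "p = []")
      case True
      then show ?thesis using Cons i q gl[OF i q] by (simp add: join_labels_simps)
    next
      case False
      then have p: "p \<in> forest_verts (subtrees (F ! i))"
        using v Cons by (simp add: Cons_in_forest_verts)
      then have "g i (p @ [j]) < g i p"
        using gi[OF i] q by (auto simp: labelings_def)
      then show ?thesis using Cons i p q by (simp add: join_labels_simps)
    qed
  qed (use v in simp)
  moreover have "join_labels F l g (v @ [j]) \<le> join_labels F l g (v @ [k])"
    if v: "v @ [j] \<in> forest_verts F" "v @ [k] \<in> forest_verts F" "j < k" for v j k
  proof (cases v)
    case Nil
    then show ?thesis
      using v l by (auto simp: Cons_in_forest_verts join_labels_simps root_labels_def)
  next
    case (Cons i p)
    then have "i < length F" "p @ [j] \<in> forest_verts (subtrees (F ! i))"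
      "p @ [k] \<in> forest_verts (subtrees (F ! i))"
      using v by (auto simp: Cons_in_forest_verts)
    moreover from this have "g i (p @ [j]) \<le> g i (p @ [k])"
      using gi[of i] v(3) by (auto simp: labelings_def)
    ultimately show ?thesis using Cons by (simp add: join_labels_simps)
  qed
  moreover have "join_labels F l g v = undefined" if "v \<notin> forest_verts F" for v
    using that by (simp add: join_labels_def)
  ultimately show ?thesis
    by (auto simp: labelings_def)
qed

definition root_part :: "forest \<Rightarrow> (nat list \<Rightarrow> nat) \<Rightarrow> nat \<Rightarrow> nat" where
  "root_part F f = restrict (\<lambda>i. f [i]) {..<length F}"

definition branch_part :: "forest \<Rightarrow> (nat list \<Rightarrow> nat) \<Rightarrow> nat \<Rightarrow> nat list \<Rightarrow> nat" where
  "branch_part F f = restrict (\<lambda>i. restrict (\<lambda>p. f (i # p)) (forest_verts (subtrees (F ! i))))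
     {..<length F}"

lemma root_part_in_root_labels:
  assumes "f \<in> labelings K F" shows "root_part F f \<in> root_labels (length F) K"
proof -
  have "f [i] < K" if "i < length F" for i
    using assms that by (auto simp: labelings_def Cons_in_forest_verts)
  moreover have "f ([] @ [i]) \<le> f ([] @ [j])" if "i < j" "j < length F" for i j
  proof -
    have "[] @ [i] \<in> forest_verts F" "[] @ [j] \<in> forest_verts F"
      using that by (simp_all add: Cons_in_forest_verts)
    then show ?thesis using assms that(1) unfolding labelings_def by blast
  qed
  ultimately show ?thesis
    by (auto simp: root_part_def root_labels_def)
qed

lemma branch_part_in_families:
  assumes f: "f \<in> labelings K F" shows "branch_part F f \<in> label_families F (root_part F f)"
proof (rule PiE_I)
  fix i assume "i \<in> {..<length F}"
  then have i: "i < length F" by simp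
  let ?V = "forest_verts (subtrees (F ! i))"
  have V: "i # p \<in> forest_verts F" if "p \<in> ?V" for p
    using i that by (simp add: Cons_in_forest_verts)
  have "f (i # p) < f [i]" if "p \<in> ?V" for p
    by (rule labelings_below_root[OF f V[OF that]]) (use that in auto)
  moreover have "f (i # p @ [j]) < f (i # p)" if "p \<in> ?V" "p @ [j] \<in> ?V" for p j
    using f V[OF that(1)] V[OF that(2)] unfolding labelings_def
    by (metis (mono_tags, lifting) append_Cons mem_Collect_eq)
  moreover have "f (i # p @ [j]) \<le> f (i # p @ [k])" if "p @ [j] \<in> ?V" "p @ [k] \<in> ?V" "j < k" for p j k
    using f V[OF that(1)] V[OF that(2)] that(3) unfolding labelings_def
    by (metis (mono_tags, lifting) append_Cons mem_Collect_eq)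
  ultimately show "branch_part F f i \<in> labelings (root_part F f i) (subtrees (F ! i))"
    using i by (auto simp: branch_part_def root_part_def labelings_def)
qed (simp add: branch_part_def)

lemma bij_join_labels:
  "bij_betw (\<lambda>(l, g). join_labels F l g)
     (SIGMA l:root_labels (length F) K. label_families F l) (labelings K F)"
proof (rule bij_betwI[where g = "\<lambda>f. (root_part F f, branch_part F f)"])
  fix x assume "x \<in> (SIGMA l:root_labels (length F) K. label_families F l)"
  then obtain l g where x: "x = (l, g)" and l: "l \<in> root_labels (length F) K"
    and g: "g \<in> label_families F l" by auto
  have "root_part F (join_labels F l g) = l"
    using l by (auto simp: root_part_def join_labels_simps root_labels_def PiE_def extensional_def)
  moreover have "branch_part F (join_labels F l g) = g"
  proof
    fix i
    show "branch_part F (join_labels F l g) i = g i"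
    proof (cases "i < length F")
      case True
      then have "g i \<in> extensional (forest_verts (subtrees (F ! i)))"
        using g by (auto simp: labelings_def PiE_def Pi_def)
      then show ?thesis
        using True by (auto simp: branch_part_def join_labels_simps extensional_def)
    next
      case False
      then show ?thesis using g by (auto simp: branch_part_def PiE_def extensional_def)
    qed
  qed
  ultimately show "(root_part F (case x of (l, g) \<Rightarrow> join_labels F l g),
      branch_part F (case x of (l, g) \<Rightarrow> join_labels F l g)) = x"
    by (simp add: x)
next
  fix f assume f: "f \<in> labelings K F"
  have "join_labels F (root_part F f) (branch_part F f) v = f v" for v
  proof (cases "v \<in> forest_verts F")
    case True
    then show ?thesis
      by (cases v) (auto simp: Cons_in_forest_verts join_labels_simps root_part_def branch_part_def)
  next
    case False
    then show ?thesis using f by (auto simp: join_labels_def labelings_def PiE_def extensional_def)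
  qed
  then show "(case (root_part F f, branch_part F f) of (l, g) \<Rightarrow> join_labels F l g) = f"
    by auto
next
  show "(\<lambda>(l, g). join_labels F l g) \<in>
      (SIGMA l:root_labels (length F) K. label_families F l) \<rightarrow> labelings K F"
    by (auto intro: join_labels_in_labelings)
  show "(\<lambda>f. (root_part F f, branch_part F f)) \<in>
      labelings K F \<rightarrow> (SIGMA l:root_labels (length F) K. label_families F l)"
    by (intro funcsetI SigmaI root_part_in_root_labels branch_part_in_families)
qed

lemma label_weight_join:
  assumes l: "l \<in> root_labels (length F) K" and g: "g \<in> label_families F l"
  shows "(label_weight F (join_labels F l g) :: 'a::field_char_0) =
    root_weight (length F) K l * (\<Prod>i<length F. label_weight (subtrees (F ! i)) (g i))"
proof -
  let ?f = "join_labels F l g"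
  let ?V = "\<lambda>i. forest_verts (subtrees (F ! i))"
  let ?w = "\<lambda>v. \<Prod>m<K. 1 / fact (label_count F ?f v m) :: 'a"
  have f: "?f \<in> labelings K F" by (rule join_labels_in_labelings[OF l g])
  then have "?f ` forest_verts F \<subseteq> {..<K}"
    by (auto simp: labelings_def)
  then have "label_weight F ?f = (\<Prod>v\<in>insert [] (forest_verts F). ?w v)"
    by (rule label_weight_superset[rotated]) simp
  also have "\<dots> = ?w [] * (\<Prod>v\<in>forest_verts F. ?w v)"
    by (simp add: finite_forest_verts)
  also have "?w [] = root_weight (length F) K l"
  proof -
    have "label_count F ?f [] m = card {i. i < length F \<and> l i = m}" for m
    proof -
      have "{u \<in> forest_verts F. child_of u [] \<and> ?f u = m} = (\<lambda>i. [i]) ` {i. i < length F \<and> l i = m}"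
        by (auto simp: child_of_def Cons_in_forest_verts join_labels_simps)
      then show ?thesis by (simp add: label_count_def card_image inj_on_def)
    qed
    then show ?thesis by (simp add: root_weight_def)
  qed
  also have "(\<Prod>v\<in>forest_verts F. ?w v) = (\<Prod>i<length F. \<Prod>v\<in>Cons i ` insert [] (?V i). ?w v)"
    by (subst (1) forest_verts_eq, subst prod.UNION_disjoint) (auto simp: finite_forest_verts)
  also have "\<dots> = (\<Prod>i<length F. label_weight (subtrees (F ! i)) (g i))"
  proof (rule prod.cong[OF refl])
    fix i assume "i \<in> {..<length F}"
    then have i: "i < length F" by simp
    have gi: "g i \<in> labelings (l i) (subtrees (F ! i))" and li: "l i < K"
      using g l i by (auto simp: root_labels_def)
    have count: "label_count F ?f (i # p) m = label_count (subtrees (F ! i)) (g i) p m" for p m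
    proof -
      have "{u \<in> forest_verts F. child_of u (i # p) \<and> ?f u = m} =
          Cons i ` {u \<in> ?V i. child_of u p \<and> g i u = m}"
        using i by (auto simp: child_of_def Cons_in_forest_verts join_labels_simps)
      then show ?thesis by (simp add: label_count_def card_image)
    qed
    have "(\<Prod>v\<in>Cons i ` insert [] (?V i). ?w v) = (\<Prod>p\<in>insert [] (?V i). ?w (i # p))"
      by (subst prod.reindex) (auto simp: inj_on_def)
    \<comment> \<open>The branch uses labels below \<open>l i\<close> while the product runs up to
      \<open>K\<close>; the surplus labels do not occur in the branch.\<close>
    also have "\<dots> = label_weight (subtrees (F ! i)) (g i)"
      unfolding count
      by (rule label_weight_superset[symmetric])
        (use gi li in \<open>auto simp: labelings_def PiE_def Pi_def intro: less_trans\<close>)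
    finally show "(\<Prod>v\<in>Cons i ` insert [] (?V i). ?w v) = label_weight (subtrees (F ! i)) (g i)" .
  qed
  finally show ?thesis .
qed

text \<open>\<open>K\<close> stays free in the induction, since the bound for the branches of a root
  is the label of that root. The product over the roots of sums over branch labelings becomes a sum
  over families.\<close>

lemma flow_coeff_eq_labelings:
  "(flow_coeff K F :: 'a::field_char_0) = (\<Sum>f\<in>labelings K F. label_weight F f)"
proof (induction F arbitrary: K rule: forest_nth_induct)
  case (step F)
  let ?L = "\<lambda>l i. labelings (l i) (subtrees (F ! i))"
  have "(flow_coeff K F :: 'a) = (\<Sum>l\<in>root_labels (length F) K. root_weight (length F) K l *
      (\<Prod>i<length F. \<Sum>h\<in>?L l i. label_weight (subtrees (F ! i)) h))"
    by (subst flow_coeff_root_labels) (simp add: step)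
  also have "\<dots> = (\<Sum>l\<in>root_labels (length F) K. \<Sum>g\<in>label_families F l.
      root_weight (length F) K l * (\<Prod>i<length F. label_weight (subtrees (F ! i)) (g i)))"
    by (simp add: prod_sum_PiE finite_labelings sum_distrib_left)
  also have "\<dots> = (\<Sum>l\<in>root_labels (length F) K. \<Sum>g\<in>label_families F l.
      label_weight F (join_labels F l g))"
    by (intro sum.cong refl) (simp add: label_weight_join)
  also have "\<dots> = (\<Sum>x\<in>(SIGMA l:root_labels (length F) K. label_families F l).
      label_weight F ((\<lambda>(l, g). join_labels F l g) x))"
    by (simp add: sum.Sigma finite_root_labels finite_PiE finite_labelings split_def)
  also have "\<dots> = (\<Sum>f\<in>labelings K F. label_weight F f)"
    by (rule sum.reindex_bij_betw[OF bij_join_labels])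
  finally show ?case .
qed

subsection \<open>Surjective labelings\<close>

definition surj_labelings :: "nat \<Rightarrow> forest \<Rightarrow> (nat list \<Rightarrow> nat) set" where
  "surj_labelings k F = {f \<in> labelings k F. f ` forest_verts F = {..<k}}"

definition relabel :: "forest \<Rightarrow> (nat \<Rightarrow> nat) \<Rightarrow> (nat list \<Rightarrow> nat) \<Rightarrow> nat list \<Rightarrow> nat" where
  "relabel F h f = restrict (\<lambda>v. h (f v)) (forest_verts F)"

lemma relabel_in_labelings:
  assumes "f \<in> labelings K F" "strict_mono_on (f ` forest_verts F) h"
    "h ` f ` forest_verts F \<subseteq> {..<K'}"
  shows "relabel F h f \<in> labelings K' F"
proof -
  have "h (f u) < h (f v)" if "u \<in> forest_verts F" "v \<in> forest_verts F" "f u < f v" for u v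
    using assms(2) that by (auto simp: strict_mono_on_def)
  moreover from this have "h (f u) \<le> h (f v)"
    if "u \<in> forest_verts F" "v \<in> forest_verts F" "f u \<le> f v" for u v
    using that by (cases "f u = f v") (auto simp: le_less)
  moreover have "h (f v) < K'" if "v \<in> forest_verts F" for v
    using assms(3) that by auto
  ultimately show ?thesis
    using assms(1) by (auto simp: labelings_def relabel_def)
qed

lemma label_weight_relabel:
  assumes "inj_on h (f ` forest_verts F)"
  shows "label_weight F (relabel F h f) = label_weight F f"
proof -
  have im: "relabel F h f ` forest_verts F = h ` f ` forest_verts F"
    by (auto simp: relabel_def image_iff)
  have "label_count F (relabel F h f) v (h m) = label_count F f v m" if "m \<in> f ` forest_verts F" for v m
    unfolding label_count_def
    by (rule arg_cong[where f = card])
      (use that assms in \<open>auto simp: relabel_def inj_on_def\<close>)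
  then show ?thesis
    unfolding label_weight_def im
    by (intro prod.cong[OF refl], subst prod.reindex[OF assms], intro prod.cong refl) simp
qed

text \<open>The increasing bijection between \<open>S\<close> and an initial segment keeps strict
  and weak inequalities, and the weight sees only which siblings share a label.\<close>

lemma sum_labelings_with_image:
  assumes "S \<subseteq> {..<K}"
  shows "(\<Sum>f | f \<in> labelings K F \<and> f ` forest_verts F = S. label_weight F f)
    = (\<Sum>f\<in>surj_labelings (card S) F. label_weight F f)"
proof -
  have "finite S" using assms by (rule finite_subset) simp
  then obtain h where bij: "bij_betw h {..<card S} S" and mono: "strict_mono_on {..<card S} h"
    using ex_bij_betw_strict_mono_card by blast
  define h' where "h' = the_inv_into {..<card S} h"
  have hS: "h ` {..<card S} = S" and inj: "inj_on h {..<card S}"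
    using bij by (auto simp: bij_betw_def)
  have h'h: "h' (h m) = m" if "m < card S" for m
    using that inj by (simp add: h'_def the_inv_into_f_f)
  have hh': "h (h' m) = m" if "m \<in> S" for m
    using that inj hS by (simp add: h'_def f_the_inv_into_f)
  have h'S: "h' ` S = {..<card S}"
    using h'h hS by force
  have mono': "strict_mono_on S h'"
  proof (rule strict_mono_onI)
    fix a b assume ab: "a \<in> S" "b \<in> S" "a < b"
    then have "h' a < card S" "h' b < card S" using h'S by auto
    moreover have "h (h' a) < h (h' b)" using ab hh' by simp
    ultimately show "h' a < h' b"
      using mono by (metis lessThan_iff not_less_iff_gr_or_eq strict_mono_onD)
  qed
  show ?thesis
  proof (rule sum.reindex_bij_witness[where i = "relabel F h" and j = "relabel F h'"])
    fix f assume f: "f \<in> {f \<in> labelings K F. f ` forest_verts F = S}"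
    then have fv: "f v \<in> S" if "v \<in> forest_verts F" for v using that by auto
    show "relabel F h (relabel F h' f) = f"
    proof
      fix v show "relabel F h (relabel F h' f) v = f v"
        using f fv[of v] by (auto simp: relabel_def hh' labelings_def PiE_def extensional_def)
    qed
    have "relabel F h' f ` forest_verts F = {..<card S}"
      using f h'S by (auto simp: relabel_def image_iff)
    moreover have "relabel F h' f \<in> labelings (card S) F"
      by (rule relabel_in_labelings) (use f mono' h'S in auto)
    ultimately show "relabel F h' f \<in> surj_labelings (card S) F"
      by (simp add: surj_labelings_def)
    show "label_weight F (relabel F h' f) = label_weight F f"
      by (rule label_weight_relabel) (use f mono' in \<open>auto intro: strict_mono_on_imp_inj_on\<close>)
  next
    fix f assume f: "f \<in> surj_labelings (card S) F"
    then have fv: "f v < card S" if "v \<in> forest_verts F" for v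
      using that by (auto simp: surj_labelings_def)
    show "relabel F h' (relabel F h f) = f"
    proof
      fix v show "relabel F h' (relabel F h f) v = f v"
        using f fv[of v]
        by (auto simp: relabel_def h'h surj_labelings_def labelings_def PiE_def extensional_def)
    qed
    have "relabel F h f ` forest_verts F = h ` f ` forest_verts F"
      by (auto simp: relabel_def image_iff)
    then have "relabel F h f ` forest_verts F = S"
      using f hS by (simp add: surj_labelings_def)
    moreover have "relabel F h f \<in> labelings K F"
      by (rule relabel_in_labelings) (use f mono hS assms in \<open>auto simp: surj_labelings_def\<close>)
    ultimately show "relabel F h f \<in> {f \<in> labelings K F. f ` forest_verts F = S}"
      by simp
  qed
qed

text \<open>Group by image, then by its size: each of the \<open>K choose k\<close> images
  contributes the same sum.\<close>

lemma flow_coeff_eq_surj_labelings: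
  "(flow_coeff K F :: 'a::field_char_0) = (\<Sum>k\<le>K. of_nat (K choose k) * (\<Sum>f\<in>surj_labelings k F. label_weight F f))"
proof -
  let ?w = "\<lambda>k. \<Sum>f\<in>surj_labelings k F. label_weight F f :: 'a"
  have "flow_coeff K F = (\<Sum>S\<in>Pow {..<K}. \<Sum>f | f \<in> labelings K F \<and> f ` forest_verts F = S. label_weight F f)"
    unfolding flow_coeff_eq_labelings
    by (rule sum.group[symmetric]) (auto simp: finite_labelings, auto simp: labelings_def)
  also have "\<dots> = (\<Sum>S\<in>Pow {..<K}. ?w (card S))"
    by (intro sum.cong refl sum_labelings_with_image) simp
  also have "\<dots> = (\<Sum>k\<le>K. \<Sum>S | S \<in> Pow {..<K} \<and> card S = k. ?w (card S))"
    by (rule sum.group[symmetric]) (auto dest: card_mono[rotated])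
  also have "\<dots> = (\<Sum>k\<le>K. of_nat (K choose k) * ?w k)"
  proof (rule sum.cong[OF refl])
    fix k
    have "(\<Sum>S | S \<in> Pow {..<K} \<and> card S = k. ?w (card S)) = (\<Sum>S | S \<in> Pow {..<K} \<and> card S = k. ?w k)"
      by (rule sum.cong) auto
    then show "(\<Sum>S | S \<in> Pow {..<K} \<and> card S = k. ?w (card S)) = of_nat (K choose k) * ?w k"
      by (simp add: n_subsets)
  qed
  finally show ?thesis .
qed

section \<open>Nested tubings and surjective labelings\<close>

lemma card_forest_verts: "card (forest_verts F) = forest_size F"
proof (induction F rule: forest_nth_induct)
  case (step F)
  have "card (forest_verts F) = (\<Sum>i<length F. card (Cons i ` insert [] (forest_verts (subtrees (F ! i)))))"
    by (subst forest_verts_eq, rule card_UN_disjoint) (auto simp: finite_forest_verts)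
  also have "\<dots> = (\<Sum>i<length F. Suc (forest_size (subtrees (F ! i))))"
  proof (rule sum.cong[OF refl])
    fix i assume "i \<in> {..<length F}"
    moreover have "card (Cons i ` insert [] (forest_verts (subtrees (F ! i))))
        = card (insert [] (forest_verts (subtrees (F ! i))))"
      by (rule card_image) (rule inj_on_Cons1)
    ultimately show "card (Cons i ` insert [] (forest_verts (subtrees (F ! i))))
        = Suc (forest_size (subtrees (F ! i)))"
      by (simp only: card_insert_disjoint finite_forest_verts Nil_notin_forest_verts step
          lessThan_iff not_False_eq_True)
  qed
  also have "\<dots> = (\<Sum>i<length F. tree_size (F ! i))"
  proof (rule sum.cong[OF refl])
    fix i show "Suc (forest_size (subtrees (F ! i))) = tree_size (F ! i)"
      by (cases "F ! i") (simp add: forest_size_def)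
  qed
  also have "\<dots> = forest_size F"
    by (simp add: forest_size_def sum_list_sum_nth atLeast0LessThan)
  finally show ?case .
qed

lemma forest_verts_prefix:
  "u @ w \<in> forest_verts F \<Longrightarrow> u = [] \<or> u \<in> forest_verts F"
proof (induction w rule: rev_induct)
  case (snoc i w)
  then show ?case using forest_verts_parent[of "u @ w" i F] by auto
qed simp

lemma labelings_child:
  "f \<in> labelings K F \<Longrightarrow> v \<in> forest_verts F \<Longrightarrow> v @ [i] \<in> forest_verts F \<Longrightarrow> f (v @ [i]) < f v"
  by (simp add: labelings_def)

lemma labelings_sibling:
  "f \<in> labelings K F \<Longrightarrow> v @ [i] \<in> forest_verts F \<Longrightarrow> v @ [j] \<in> forest_verts F \<Longrightarrow> i < j \<Longrightarrow>
    f (v @ [i]) \<le> f (v @ [j])"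
  by (simp add: labelings_def)

text \<open>Every vertex is joined to the root \<open>[]\<close> through its prefixes, so
  connectivity of a tube is automatic once it is closed under parents.\<close>

lemma connected_prefix_closed:
  assumes "\<And>v i. v @ [i] \<in> P \<Longrightarrow> v \<in> P"
  shows "connected_verts P"
proof -
  let ?R = "{(a, b). a \<in> P \<and> b \<in> P \<and> (child_of a b \<or> child_of b a)}"
  have "(u, []) \<in> ?R\<^sup>* \<and> ([], u) \<in> ?R\<^sup>*" if "u \<in> P" for u
    using that
  proof (induction u rule: rev_induct)
    case (snoc i u)
    then have u: "u \<in> P" using assms by blast
    then have "(u @ [i], u) \<in> ?R" "(u, u @ [i]) \<in> ?R"
      using snoc.prems by (auto simp: child_of_def)
    then show ?case
      using snoc.IH[OF u] by (meson converse_rtrancl_into_rtrancl rtrancl.rtrancl_into_rtrancl)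
  qed simp
  then show ?thesis
    unfolding connected_verts_def by (meson rtrancl_trans)
qed

lemma preorder_less_snoc [simp]: "preorder_less (v @ [i]) (v @ [j]) \<longleftrightarrow> i < j"
  by (induction v) (simp_all add: preorder_less_def)

lemma preorder_less_singleton [simp]: "preorder_less [i] [j] \<longleftrightarrow> i < j"
  using preorder_less_snoc[of "[]" i j] by simp

subsection \<open>The characterisation of tubes\<close>

lemma tree_verts_eq: "tree_verts T = insert [] (forest_verts (subtrees T))"
proof (rule set_eqI)
  fix p show "p \<in> tree_verts T \<longleftrightarrow> p \<in> insert [] (forest_verts (subtrees T))"
    by (cases p) (auto simp: tree_verts_def forest_verts_def)
qed

lemma Cons_forest_verts_iff: "i # p \<in> forest_verts F \<longleftrightarrow> i < length F \<and> p \<in> tree_verts (F ! i)"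
  by (auto simp: Cons_in_forest_verts tree_verts_eq)

text \<open>Closure under parents and right siblings is the form in which tubes are compared with
  labelings. The instance \<open>v = []\<close> of the last condition is the condition on the roots
  of \<open>F\<close>.\<close>

lemma forest_tube_iff:
  "forest_tube F s \<longleftrightarrow> s \<subseteq> forest_verts F \<and>
    (\<forall>v i. v @ [i] \<in> s \<longrightarrow> v = [] \<or> v \<in> s) \<and>
    (\<forall>v i j. v @ [i] \<in> s \<longrightarrow> v @ [j] \<in> forest_verts F \<longrightarrow> i < j \<longrightarrow> v @ [j] \<in> s)"
    (is "?L \<longleftrightarrow> ?V \<and> ?P \<and> ?S")
proof
  assume L: ?L
  then have V: ?V
    and roots: "higher_set (roots F) preorder_less (s \<inter> roots F)"
    and trees: "\<And>i. i < length F \<Longrightarrow> {p. i # p \<in> s} \<noteq> {} \<Longrightarrow> tree_tube (F ! i) {p. i # p \<in> s}"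
    unfolding forest_tube_def by blast+
  have tube: "tree_tube (F ! a) {p. a # p \<in> s}" "a < length F" if "a # p \<in> s" for a p
  proof -
    have "a # p \<in> forest_verts F" using V that by blast
    then show a: "a < length F" by (simp add: Cons_forest_verts_iff)
    show "tree_tube (F ! a) {p. a # p \<in> s}" by (rule trees[OF a]) (use that in blast)
  qed
  have ?P
  proof (intro allI impI)
    fix v i assume v: "v @ [i] \<in> s"
    show "v = [] \<or> v \<in> s"
    proof (cases v)
      case (Cons a p)
      with v have "a # (p @ [i]) \<in> s" by simp
      from tube[OF this] this have "higher_set (tree_verts (F ! a)) tree_less {p. a # p \<in> s}"
        and "a # (p @ [i]) \<in> forest_verts F"
        using V by (auto simp: tree_tube_def)
      moreover from this(2) have "p \<in> tree_verts (F ! a)"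
        using forest_verts_prefix[of "a # p" "[i]" F] by (simp add: Cons_forest_verts_iff)
      ultimately have "p \<in> {p. a # p \<in> s}"
        using v Cons unfolding higher_set_def tree_less_def
        by (metis append_Cons mem_Collect_eq strict_prefixI' append_Nil2)
      then show ?thesis using Cons by simp
    qed simp
  qed
  moreover have ?S
  proof (intro allI impI)
    fix v i j assume v: "v @ [i] \<in> s" "v @ [j] \<in> forest_verts F" "i < j"
    show "v @ [j] \<in> s"
    proof (cases v)
      case Nil
      have "[i] \<in> s \<inter> roots F" "[j] \<in> roots F"
        using v Nil V by (auto simp: roots_def Cons_forest_verts_iff subset_iff)
      then show ?thesis
        using roots v(3) Nil unfolding higher_set_def by auto
    next
      case (Cons a p)
      have t: "tree_tube (F ! a) {p. a # p \<in> s}"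
        using tube v Cons by auto
      have p: "p \<in> {p. a # p \<in> s}"
        using \<open>?P\<close>[rule_format, of v i] v(1) Cons by simp
      have "p @ [i] \<in> {p. a # p \<in> s} \<inter> branches (F ! a) p" "p @ [j] \<in> branches (F ! a) p"
        using v Cons V by (auto simp: branches_def child_of_def Cons_forest_verts_iff subset_iff)
      then have "p @ [j] \<in> {p. a # p \<in> s}"
        using t p v(3) unfolding tree_tube_def higher_set_def by (metis (no_types, lifting) IntE preorder_less_snoc)
      then show ?thesis using Cons by simp
    qed
  qed
  ultimately show "?V \<and> ?P \<and> ?S" using V by blast
next
  assume R: "?V \<and> ?P \<and> ?S"
  then have V: ?V and P: "\<And>v i. v @ [i] \<in> s \<Longrightarrow> v = [] \<or> v \<in> s"
    and S: "\<And>v i j. v @ [i] \<in> s \<Longrightarrow> v @ [j] \<in> forest_verts F \<Longrightarrow> i < j \<Longrightarrow> v @ [j] \<in> s"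
    by blast+
  have prefix: "u \<in> s" if "u @ w \<in> s" "u \<noteq> []" for u w
    using that(1)
  proof (induction w rule: rev_induct)
    case (snoc i w)
    then show ?case using P[of "u @ w" i] that(2) by auto
  qed simp
  have "higher_set (roots F) preorder_less (s \<inter> roots F)"
    unfolding higher_set_def
    using S[of "[]"] by (auto simp: roots_def Cons_in_forest_verts)
  moreover have "tree_tube (F ! a) {p. a # p \<in> s}" if a: "a < length F" for a
    unfolding tree_tube_def
  proof (intro conjI ballI)
    show "connected_verts {p. a # p \<in> s}"
      by (rule connected_prefix_closed) (use P in force)
    show "higher_set (tree_verts (F ! a)) tree_less {p. a # p \<in> s}"
      unfolding higher_set_def
    proof (intro conjI ballI impI)
      show "{p. a # p \<in> s} \<subseteq> tree_verts (F ! a)"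
        using V by (auto simp: Cons_forest_verts_iff)
      fix v u assume "v \<in> {p. a # p \<in> s}" "tree_less v u"
      then show "u \<in> {p. a # p \<in> s}"
        using prefix[of "a # u"] by (auto simp: tree_less_def strict_prefix_def prefix_def)
    qed
    fix v assume "v \<in> {p. a # p \<in> s}"
    show "higher_set (branches (F ! a) v) preorder_less ({p. a # p \<in> s} \<inter> branches (F ! a) v)"
      unfolding higher_set_def
      using S[of "a # v"] a by (auto simp: branches_def child_of_def Cons_forest_verts_iff)
  qed
  ultimately show ?L
    using V by (simp add: forest_tube_def)
qed

subsection \<open>From labelings to tubings\<close>

definition level_set :: "forest \<Rightarrow> (nat list \<Rightarrow> nat) \<Rightarrow> nat \<Rightarrow> nat list set" where
  "level_set F f j = {v \<in> forest_verts F. j \<le> f v}"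

definition tubing_of :: "forest \<Rightarrow> nat \<Rightarrow> (nat list \<Rightarrow> nat) \<Rightarrow> nat list set set" where
  "tubing_of F k f = level_set F f ` {..<k}"

lemma surj_labelingsD:
  assumes "f \<in> surj_labelings k F"
  shows "f \<in> labelings k F" "\<And>v. v \<in> forest_verts F \<Longrightarrow> f v < k"
    "\<And>j. j < k \<Longrightarrow> \<exists>v\<in>forest_verts F. f v = j"
proof -
  show "\<exists>v\<in>forest_verts F. f v = j" if "j < k" for j
  proof -
    have "j \<in> f ` forest_verts F" using assms that by (simp add: surj_labelings_def)
    then show ?thesis by blast
  qed
qed (use assms in \<open>auto simp: surj_labelings_def\<close>)

text \<open>Surjectivity keeps the level sets apart: a vertex of label exactly \<open>i\<close> lies
  in none of the higher ones.\<close>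

lemma level_set_subset_iff:
  assumes "f \<in> surj_labelings k F" "i < k" "j < k"
  shows "level_set F f i \<subseteq> level_set F f j \<longleftrightarrow> j \<le> i"
proof
  assume sub: "level_set F f i \<subseteq> level_set F f j"
  obtain v where "v \<in> forest_verts F" "f v = i"
    using surj_labelingsD(3)[OF assms(1,2)] by blast
  then show "j \<le> i" using sub by (auto simp: level_set_def)
qed (auto simp: level_set_def)

lemma level_set_psubset_iff:
  assumes "f \<in> surj_labelings k F" "i < k" "j < k"
  shows "level_set F f i \<subset> level_set F f j \<longleftrightarrow> j < i"
  using level_set_subset_iff[OF assms] level_set_subset_iff[OF assms(1,3,2)] by auto

lemma inj_on_level_set:
  assumes "f \<in> surj_labelings k F" shows "inj_on (level_set F f) {..<k}"
proof (rule inj_onI)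
  fix i j assume "i \<in> {..<k}" "j \<in> {..<k}" "level_set F f i = level_set F f j"
  then show "i = j"
    using level_set_subset_iff[OF assms, of i j] level_set_subset_iff[OF assms, of j i] by simp
qed

lemma card_tubing_of: "f \<in> surj_labelings k F \<Longrightarrow> card (tubing_of F k f) = k"
  by (simp add: tubing_of_def card_image inj_on_level_set)

text \<open>The union of the smaller tubes is the next level set, also at the last level, where both
  are empty.\<close>

lemma bdry_tubing_of:
  assumes f: "f \<in> surj_labelings k F" and j: "j < k"
  shows "bdry (tubing_of F k f) (level_set F f j) = {v \<in> forest_verts F. f v = j}"
proof -
  have "\<Union>{s' \<in> tubing_of F k f. s' \<subset> level_set F f j} = level_set F f (Suc j)"
  proof (intro equalityI subsetI)
    fix v assume "v \<in> \<Union>{s' \<in> tubing_of F k f. s' \<subset> level_set F f j}"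
    then obtain i where "i < k" "level_set F f i \<subset> level_set F f j" "v \<in> level_set F f i"
      by (auto simp: tubing_of_def)
    then show "v \<in> level_set F f (Suc j)"
      using level_set_psubset_iff[OF f _ j, of i] by (auto simp: level_set_def)
  next
    fix v assume v: "v \<in> level_set F f (Suc j)"
    then have "Suc j < k" using surj_labelingsD(2)[OF f, of v] by (auto simp: level_set_def)
    then show "v \<in> \<Union>{s' \<in> tubing_of F k f. s' \<subset> level_set F f j}"
      using level_set_psubset_iff[OF f _ j, of "Suc j"] v by (auto simp: tubing_of_def)
  qed
  then show ?thesis
    unfolding bdry_def by (auto simp: level_set_def)
qed

lemma tubing_of_in_hTub:
  assumes f: "f \<in> surj_labelings k F" and k: "2 \<le> k"
  shows "tubing_of F k f \<in> hTub F"
proof -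
  note fL = surj_labelingsD(1)[OF f]
  have "forest_tube F (level_set F f j)" for j
    unfolding forest_tube_iff
  proof (intro conjI allI impI)
    fix v i assume "v @ [i] \<in> level_set F f j"
    then show "v = [] \<or> v \<in> level_set F f j"
      using forest_verts_parent[of v i F] labelings_child[OF fL, of v i] by (auto simp: level_set_def)
  next
    fix v i i' assume "v @ [i] \<in> level_set F f j" "v @ [i'] \<in> forest_verts F" "i < i'"
    then show "v @ [i'] \<in> level_set F f j"
      using labelings_sibling[OF fL, of v i i'] by (auto simp: level_set_def)
  qed (auto simp: level_set_def)
  moreover have "level_set F f j \<noteq> {}" if "j < k" for j
    using surj_labelingsD(3)[OF f that] by (auto simp: level_set_def)
  moreover have "level_set F f i \<subseteq> level_set F f j \<or> level_set F f j \<subseteq> level_set F f i" for i j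
    by (auto simp: level_set_def)
  moreover have "forest_verts F \<in> tubing_of F k f"
    unfolding tubing_of_def using k by (intro image_eqI[of _ _ 0]) (auto simp: level_set_def)
  ultimately have "nested_tubing F (tubing_of F k f)"
    using k card_tubing_of[OF f] unfolding nested_tubing_def by (auto simp: tubing_of_def)
  moreover have "\<not> child_of u v"
    if "s \<in> tubing_of F k f" "u \<in> bdry (tubing_of F k f) s" "v \<in> bdry (tubing_of F k f) s" for s u v
  proof
    assume "child_of u v"
    obtain j where "j < k" "s = level_set F f j"
      using \<open>s \<in> tubing_of F k f\<close> by (auto simp: tubing_of_def)
    with that bdry_tubing_of[OF f] have "u \<in> forest_verts F" "v \<in> forest_verts F" "f u = f v"
      by auto
    with \<open>child_of u v\<close> show False
      using labelings_child[OF fL] by (metis child_of_def less_irrefl)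
  qed
  ultimately show ?thesis by (auto simp: hTub_def)
qed

subsection \<open>From tubings to labelings\<close>

definition labeling_of :: "forest \<Rightarrow> nat list set set \<Rightarrow> nat list \<Rightarrow> nat" where
  "labeling_of F t = restrict (\<lambda>v. card {s \<in> t. v \<in> s} - 1) (forest_verts F)"

lemma labeling_of_tubing_of:
  assumes f: "f \<in> surj_labelings k F"
  shows "labeling_of F (tubing_of F k f) = f"
proof
  fix v
  show "labeling_of F (tubing_of F k f) v = f v"
  proof (cases "v \<in> forest_verts F")
    case True
    have "{s \<in> tubing_of F k f. v \<in> s} = level_set F f ` {..f v}"
      using True surj_labelingsD(2)[OF f True] by (auto simp: tubing_of_def level_set_def)
    moreover have "inj_on (level_set F f) {..f v}"
      by (rule inj_on_subset[OF inj_on_level_set[OF f]])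
        (use surj_labelingsD(2)[OF f True] in auto)
    ultimately show ?thesis
      using True by (simp add: labeling_of_def card_image)
  next
    case False
    then show ?thesis
      using surj_labelingsD(1)[OF f] by (auto simp: labeling_of_def labelings_def PiE_def extensional_def)
  qed
qed

context
  fixes F t assumes t: "t \<in> hTub F"
begin

lemma hTub_tube: "s \<in> t \<Longrightarrow> forest_tube F s"
  using t by (simp add: hTub_def nested_tubing_def)

lemma hTub_nonempty: "s \<in> t \<Longrightarrow> s \<noteq> {}"
  using t by (simp add: hTub_def nested_tubing_def)

lemma hTub_chain: "s \<in> t \<Longrightarrow> s' \<in> t \<Longrightarrow> s \<subseteq> s' \<or> s' \<subseteq> s"
  using t by (simp add: hTub_def nested_tubing_def)

lemma hTub_top: "forest_verts F \<in> t"
  using t by (simp add: hTub_def nested_tubing_def)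

lemma hTub_horizontal: "s \<in> t \<Longrightarrow> u \<in> bdry t s \<Longrightarrow> v \<in> bdry t s \<Longrightarrow> \<not> child_of u v"
  using t by (simp add: hTub_def)

lemma hTub_card: "2 \<le> card t"
  using t by (simp add: hTub_def nested_tubing_def)

lemma hTub_finite: "finite t"
  using hTub_card by (intro card_ge_0_finite) simp

lemma hTub_subset: "s \<in> t \<Longrightarrow> s \<subseteq> forest_verts F"
  using hTub_tube by (auto simp: forest_tube_iff)

lemma hTub_bdry_tubes:
  assumes "s \<in> t" "v \<in> bdry t s" shows "{s' \<in> t. v \<in> s'} = {s' \<in> t. s \<subseteq> s'}"
  using assms hTub_chain[OF assms(1)] unfolding bdry_def by blast

lemma hTub_bdry_exists:
  assumes "v \<in> forest_verts F" shows "\<exists>s\<in>t. v \<in> bdry t s"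
proof -
  have fin: "finite {s \<in> t. v \<in> s}" using hTub_finite by simp
  have "{s \<in> t. v \<in> s} \<noteq> {}" using assms hTub_top by blast
  then obtain s where s: "s \<in> {s \<in> t. v \<in> s}" "\<And>s'. s' \<in> {s \<in> t. v \<in> s} \<Longrightarrow> s' \<subseteq> s \<Longrightarrow> s = s'"
    using finite_has_minimal[OF fin] by blast
  then have "v \<in> bdry t s" unfolding bdry_def by blast
  then show ?thesis using s by blast
qed

text \<open>The tubes strictly inside \<open>s\<close> form a finite chain, so their union is the
  largest of them and still a proper subset.\<close>

lemma hTub_bdry_nonempty:
  assumes "s \<in> t" shows "bdry t s \<noteq> {}"
proof (cases "{s' \<in> t. s' \<subset> s} = {}")
  case True
  have "bdry t s = s" unfolding bdry_def True by simp
  then show ?thesis using hTub_nonempty[OF assms] by simp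
next
  case False
  have "finite {s' \<in> t. s' \<subset> s}" using hTub_finite by simp
  from finite_has_maximal[OF this False]
  obtain m where m: "m \<in> {s' \<in> t. s' \<subset> s}"
    and max: "\<forall>s'\<in>{s' \<in> t. s' \<subset> s}. m \<subseteq> s' \<longrightarrow> m = s'"
    by (elim bexE)
  have "s' \<subseteq> m" if "s' \<in> {s' \<in> t. s' \<subset> s}" for s'
    using hTub_chain[of m s'] bspec[OF max that] m that by auto
  then have "\<Union>{s' \<in> t. s' \<subset> s} \<subseteq> m" by (rule Union_least)
  moreover have "m \<subset> s" using m by simp
  ultimately show ?thesis unfolding bdry_def by auto
qed

text \<open>Horizontality enters here: if the same tubes contained both ends of an edge, both would
  lie in the boundary of the smallest of these tubes. This becomes the strict decrease of labels
  along edges.\<close>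

lemma hTub_tubes_child:
  assumes "v \<in> forest_verts F" "v @ [i] \<in> forest_verts F"
  shows "{s \<in> t. v @ [i] \<in> s} \<subset> {s \<in> t. v \<in> s}"
proof -
  have "v \<noteq> []" using assms(1) by auto
  then have sub: "{s \<in> t. v @ [i] \<in> s} \<subseteq> {s \<in> t. v \<in> s}"
    using hTub_tube by (auto simp: forest_tube_iff)
  obtain s where s: "s \<in> t" "v @ [i] \<in> bdry t s"
    using hTub_bdry_exists[OF assms(2)] by blast
  have "{s \<in> t. v @ [i] \<in> s} \<noteq> {s \<in> t. v \<in> s}"
  proof
    assume eq: "{s \<in> t. v @ [i] \<in> s} = {s \<in> t. v \<in> s}"
    have "v \<in> bdry t s"
      using s eq unfolding bdry_def by blast
    then show False
      using hTub_horizontal[OF s] by (auto simp: child_of_def)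
  qed
  with sub show ?thesis by blast
qed

lemma hTub_tubes_pos: "v \<in> forest_verts F \<Longrightarrow> 0 < card {s \<in> t. v \<in> s}"
  using hTub_finite hTub_top by (auto simp: card_gt_0_iff)

text \<open>For a tube \<open>s\<close>, the number of tubes strictly larger than \<open>s\<close>:
  the whole vertex set has rank 0, the innermost tube the top rank.\<close>

definition tube_rank :: "nat list set \<Rightarrow> nat" where
  "tube_rank s = card {s' \<in> t. s \<subseteq> s'} - 1"

lemma tube_rank_Suc:
  assumes "s \<in> t" shows "Suc (tube_rank s) = card {s' \<in> t. s \<subseteq> s'}"
proof -
  have "{s' \<in> t. s \<subseteq> s'} \<noteq> {}" using assms by blast
  moreover have "finite {s' \<in> t. s \<subseteq> s'}" using hTub_finite by simp
  ultimately have "0 < card {s' \<in> t. s \<subseteq> s'}" using card_gt_0_iff by blast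
  then show ?thesis by (simp add: tube_rank_def)
qed

lemma tube_rank_bij: "tube_rank ` t = {..<card t}"
proof -
  have less: "tube_rank s < tube_rank s'" if "s \<in> t" "s' \<in> t" "s' \<subset> s" for s s'
  proof -
    have "card {r \<in> t. s \<subseteq> r} < card {r \<in> t. s' \<subseteq> r}"
      by (rule psubset_card_mono) (use hTub_finite that in auto)
    then show ?thesis using tube_rank_Suc that by (metis Suc_less_SucD)
  qed
  have "inj_on tube_rank t"
    by (rule inj_onI) (metis less hTub_chain psubsetI nat_neq_iff)
  moreover have "tube_rank s < card t" if "s \<in> t" for s
  proof -
    have "card {s' \<in> t. s \<subseteq> s'} \<le> card t"
      by (rule card_mono) (use hTub_finite in auto)
    then show ?thesis using tube_rank_Suc[OF that] by simp
  qed
  ultimately show ?thesis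
    by (intro card_subset_eq) (auto simp: card_image)
qed

lemma labeling_of_bdry:
  assumes "s \<in> t" "v \<in> bdry t s" shows "labeling_of F t v = tube_rank s"
proof -
  have "v \<in> forest_verts F" using assms hTub_subset unfolding bdry_def by blast
  then show ?thesis by (simp add: labeling_of_def hTub_bdry_tubes[OF assms] tube_rank_def)
qed

lemma labeling_of_in_surj_labelings: "labeling_of F t \<in> surj_labelings (card t) F"
proof -
  have lab: "Suc (labeling_of F t v) = card {s \<in> t. v \<in> s}" if "v \<in> forest_verts F" for v
    using hTub_tubes_pos[OF that] that by (simp add: labeling_of_def)
  have "labeling_of F t ` forest_verts F = {..<card t}"
  proof (intro equalityI subsetI)
    fix j assume "j \<in> {..<card t}"
    then obtain s where s: "s \<in> t" "tube_rank s = j"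
      using tube_rank_bij by (metis imageE)
    obtain v where v: "v \<in> bdry t s" using hTub_bdry_nonempty[OF s(1)] by blast
    then have "v \<in> forest_verts F" using s hTub_subset unfolding bdry_def by blast
    with labeling_of_bdry[OF s(1) v] s(2) show "j \<in> labeling_of F t ` forest_verts F"
      by (metis imageI)
  next
    fix j assume "j \<in> labeling_of F t ` forest_verts F"
    then obtain v where "v \<in> forest_verts F" "j = labeling_of F t v" by blast
    moreover obtain s where "s \<in> t" "v \<in> bdry t s"
      using hTub_bdry_exists[OF \<open>v \<in> forest_verts F\<close>] by blast
    ultimately show "j \<in> {..<card t}"
      using labeling_of_bdry tube_rank_bij by blast
  qed
  moreover have "labeling_of F t (v @ [i]) < labeling_of F t v"
    if "v \<in> forest_verts F" "v @ [i] \<in> forest_verts F" for v i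
  proof -
    have "card {s \<in> t. v @ [i] \<in> s} < card {s \<in> t. v \<in> s}"
      by (rule psubset_card_mono[OF _ hTub_tubes_child[OF that]]) (simp add: hTub_finite)
    then show ?thesis using lab that by (metis Suc_less_SucD)
  qed
  moreover have "labeling_of F t (v @ [i]) \<le> labeling_of F t (v @ [j])"
    if "v @ [i] \<in> forest_verts F" "v @ [j] \<in> forest_verts F" "i < j" for v i j
  proof -
    have "{s \<in> t. v @ [i] \<in> s} \<subseteq> {s \<in> t. v @ [j] \<in> s}"
      using hTub_tube that(2,3) unfolding forest_tube_iff by blast
    then have "card {s \<in> t. v @ [i] \<in> s} \<le> card {s \<in> t. v @ [j] \<in> s}"
      by (rule card_mono[rotated]) (simp add: hTub_finite)
    then show ?thesis using lab that by (metis Suc_le_mono)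
  qed
  ultimately show ?thesis
    by (auto simp: surj_labelings_def labelings_def labeling_of_def)
qed

text \<open>In a chain, \<open>v\<close> lies in \<open>s\<close> iff at least as many tubes contain
  \<open>v\<close> as contain \<open>s\<close>; hence the level set at the rank of \<open>s\<close>
  is \<open>s\<close>.\<close>

lemma tubing_of_labeling_of: "tubing_of F (card t) (labeling_of F t) = t"
proof -
  have eq: "level_set F (labeling_of F t) (tube_rank s) = s" if s: "s \<in> t" for s
  proof (rule set_eqI)
    fix v
    show "v \<in> level_set F (labeling_of F t) (tube_rank s) \<longleftrightarrow> v \<in> s"
    proof (cases "v \<in> forest_verts F")
      case True
      have lab: "Suc (labeling_of F t v) = card {s \<in> t. v \<in> s}"
        using hTub_tubes_pos[OF True] True by (simp add: labeling_of_def)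
      show ?thesis
      proof (cases "v \<in> s")
        case True
        then have "card {s' \<in> t. s \<subseteq> s'} \<le> card {s \<in> t. v \<in> s}"
          by (intro card_mono) (auto simp: hTub_finite)
        then show ?thesis
          using True lab tube_rank_Suc[OF s] \<open>v \<in> forest_verts F\<close> by (simp add: level_set_def)
      next
        case False
        then have "{s' \<in> t. v \<in> s'} \<subset> {s' \<in> t. s \<subseteq> s'}"
          using hTub_chain[OF s] s by blast
        then have "card {s' \<in> t. v \<in> s'} < card {s' \<in> t. s \<subseteq> s'}"
          by (rule psubset_card_mono[rotated]) (simp add: hTub_finite)
        then show ?thesis
          using False lab tube_rank_Suc[OF s] by (simp add: level_set_def)
      qed
    qed (use hTub_subset[OF s] in \<open>auto simp: level_set_def\<close>)
  qed
  have "tubing_of F (card t) (labeling_of F t) = (\<lambda>s. level_set F (labeling_of F t) (tube_rank s)) ` t"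
    unfolding tubing_of_def tube_rank_bij[symmetric] image_image ..
  also have "\<dots> = t" using eq by simp
  finally show ?thesis .
qed

end

section \<open>The weights\<close>

lemma bij_tree_positions:
  assumes "finite r"
  shows "bij_betw (\<lambda>a. tree_positions r ! (a - 1)) {1..lg r} {i. \<exists>p. i # p \<in> r}"
proof -
  have "{i. \<exists>p. i # p \<in> r} \<subseteq> hd ` r" by force
  then have fin: "finite {i. \<exists>p. i # p \<in> r}" using assms by (meson finite_imageI finite_subset)
  have "bij_betw (\<lambda>a. a - 1) {1..lg r} {..<lg r}"
    by (rule bij_betwI[where g = Suc]) auto
  moreover have "bij_betw ((!) (tree_positions r)) {..<lg r} {i. \<exists>p. i # p \<in> r}"
    unfolding lg_def using fin by (intro bij_betw_nth) (simp_all add: tree_positions_def)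
  ultimately show ?thesis by (rule bij_betw_trans[unfolded comp_def])
qed

text \<open>The trees induced on \<open>r\<close> are the fibres of \<open>hd\<close>, enumerated by
  \<open>tree_positions\<close>; excluding \<open>[]\<close> makes \<open>hd\<close>
  meaningful.\<close>

lemma tube_tree_partition:
  assumes "finite r" "[] \<notin> r"
  shows "(\<Sum>a = 1..lg r. \<Sum>v\<in>tube_tree r a. g v) = (\<Sum>v\<in>r. g v)"
    and "(\<Prod>a = 1..lg r. \<Prod>v\<in>tube_tree r a. h v) = (\<Prod>v\<in>r. h v)"
proof -
  let ?I = "{i. \<exists>p. i # p \<in> r}"
  have "hd ` r \<subseteq> ?I"
  proof
    fix i assume "i \<in> hd ` r"
    then obtain v where "v \<in> r" "i = hd v" by blast
    with assms(2) show "i \<in> ?I" by (cases v) auto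
  qed
  moreover have "?I \<subseteq> hd ` r" by force
  ultimately have I: "?I = hd ` r" by blast
  note bij = bij_tree_positions[OF assms(1)]
  have "(\<Sum>a = 1..lg r. \<Sum>v\<in>tube_tree r a. g v) = (\<Sum>i\<in>?I. \<Sum>v | v \<in> r \<and> hd v = i. g v)"
    unfolding tube_tree_def by (rule sum.reindex_bij_betw[OF bij])
  also have "\<dots> = (\<Sum>v\<in>r. g v)"
    unfolding I by (rule sum.group) (use assms in auto)
  finally show "(\<Sum>a = 1..lg r. \<Sum>v\<in>tube_tree r a. g v) = (\<Sum>v\<in>r. g v)" .
  have "(\<Prod>a = 1..lg r. \<Prod>v\<in>tube_tree r a. h v) = (\<Prod>i\<in>?I. \<Prod>v | v \<in> r \<and> hd v = i. h v)"
    unfolding tube_tree_def by (rule prod.reindex_bij_betw[OF bij])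
  also have "\<dots> = (\<Prod>v\<in>r. h v)"
    unfolding I by (rule prod.group) (use assms in auto)
  finally show "(\<Prod>a = 1..lg r. \<Prod>v\<in>tube_tree r a. h v) = (\<Prod>v\<in>r. h v)" .
qed

lemma card_children_sum:
  assumes "finite A" "finite B"
  shows "card {u \<in> B. \<exists>v\<in>A. child_of u v} = (\<Sum>v\<in>A. card {u \<in> B. child_of u v})"
proof -
  have "{u \<in> B. \<exists>v\<in>A. child_of u v} = (\<Union>v\<in>A. {u \<in> B. child_of u v})" by blast
  also have "card \<dots> = (\<Sum>v\<in>A. card {u \<in> B. child_of u v})"
    by (rule card_UN_disjoint) (use assms in \<open>auto simp: child_of_def\<close>)
  finally show ?thesis .
qed

lemma sh_support:
  assumes "finite I"
  shows "sh q {v \<in> I. q v \<noteq> 0} = (fact (\<Sum>i\<in>I. q i) / (\<Prod>i\<in>I. fact (q i)) :: 'k::field_char_0)"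
proof -
  have "(\<Sum>i | i \<in> I \<and> q i \<noteq> 0. q i) = (\<Sum>i\<in>I. q i)"
    by (rule sum.mono_neutral_left) (use assms in auto)
  moreover have "(\<Prod>i | i \<in> I \<and> q i \<noteq> 0. fact (q i) :: 'k) = (\<Prod>i\<in>I. fact (q i))"
    by (rule prod.mono_neutral_left) (use assms in auto)
  ultimately show ?thesis by (simp add: sh_def)
qed

context
  fixes F k f
  assumes f: "f \<in> surj_labelings k F"
begin

lemma finite_level_set: "finite (level_set F f j)"
  by (rule finite_subset[OF _ finite_forest_verts[of F]]) (auto simp: level_set_def)

lemma label_count_outside:
  assumes "v \<in> forest_verts F" "v \<notin> level_set F f (Suc j)"
  shows "label_count F f v j = 0"
proof -
  have "{u \<in> forest_verts F. child_of u v \<and> f u = j} = {}"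
  proof -
    have "\<not> (u \<in> forest_verts F \<and> child_of u v \<and> f u = j)" for u
    proof
      assume u: "u \<in> forest_verts F \<and> child_of u v \<and> f u = j"
      then obtain i where "u = v @ [i]" by (auto simp: child_of_def)
      with u labelings_child[OF surj_labelingsD(1)[OF f] assms(1), of i] assms
      show False by (auto simp: level_set_def)
    qed
    then show ?thesis by blast
  qed
  then show ?thesis unfolding label_count_def by (simp only: card.empty)
qed

lemma prod_label_count:
  "(\<Prod>v\<in>insert [] (forest_verts F). 1 / fact (label_count F f v j) :: 'k::field_char_0) =
    (\<Prod>v\<in>insert [] (level_set F f (Suc j)). 1 / fact (label_count F f v j))"
  by (rule prod.mono_neutral_right)
    (use label_count_outside in \<open>auto simp: finite_forest_verts level_set_def\<close>)

text \<open>A vertex labelled \<open>j\<close> is a root or has a parent with a larger label; the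
  sum sorts these vertices by parent, with \<open>[]\<close> as parent of the roots.\<close>

lemma sum_label_count:
  "(\<Sum>v\<in>insert [] (level_set F f (Suc j)). label_count F f v j) = card {v \<in> forest_verts F. f v = j}"
proof -
  let ?B = "{v \<in> forest_verts F. f v = j}"
  let ?A = "insert [] (level_set F f (Suc j))"
  have "?B = {u \<in> ?B. \<exists>v\<in>?A. child_of u v}"
  proof -
    have "\<exists>v\<in>?A. child_of u v" if u: "u \<in> ?B" for u
    proof (cases u rule: rev_cases)
      case (snoc v i)
      then have "v = [] \<or> v \<in> forest_verts F"
        using u forest_verts_parent[of v i F] by auto
      moreover have "Suc j \<le> f v" if "v \<in> forest_verts F"
        using labelings_child[OF surj_labelingsD(1)[OF f] that, of i] u snoc by auto
      ultimately have "v \<in> ?A" by (auto simp: level_set_def)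
      then show ?thesis using snoc by (auto simp: child_of_def)
    qed (use u in simp)
    then show ?thesis by blast
  qed
  then have "card ?B = card {u \<in> ?B. \<exists>v\<in>?A. child_of u v}" by (rule arg_cong)
  also have "\<dots> = (\<Sum>v\<in>?A. card {u \<in> ?B. child_of u v})"
    by (rule card_children_sum) (simp_all add: finite_level_set finite_forest_verts)
  also have "\<dots> = (\<Sum>v\<in>?A. label_count F f v j)"
    unfolding label_count_def
    by (intro sum.cong refl arg_cong[where f = card]) blast
  finally show ?thesis by simp
qed

lemma inner_tube_tubing_of:
  assumes "Suc j < k"
  shows "inner_tube (tubing_of F k f) (level_set F f j) = level_set F f (Suc j)"
  unfolding inner_tube_def
proof (rule Greatest_equality)
  have "level_set F f (Suc j) \<subset> level_set F f j"
    using level_set_psubset_iff[OF f assms, of j] assms by simp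
  then show "level_set F f (Suc j) \<in> tubing_of F k f \<and> level_set F f (Suc j) \<subset> level_set F f j"
    using assms by (simp add: tubing_of_def)
next
  fix s assume "s \<in> tubing_of F k f \<and> s \<subset> level_set F f j"
  then obtain i where "i < k" "s = level_set F f i" "level_set F f i \<subset> level_set F f j"
    by (auto simp: tubing_of_def)
  then show "s \<le> level_set F f (Suc j)"
    using level_set_psubset_iff[OF f, of i j] assms by (auto simp: level_set_def)
qed

text \<open>The shuffle numbers telescope: |\<partial>s|! cancels the numerator of the outer one,
  and each j(s)_a! in its denominator cancels the numerator of the one for the a-th tree. What is
  left is 1/j(s)_0! and one factor 1/f(v)! for each vertex of the inner tube.\<close>

lemma tube_weight:
  assumes j: "j < k"
  shows "1 / fact (card (bdry (tubing_of F k f) (level_set F f j))) *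
      shuffle_factor F (tubing_of F k f) (level_set F f j) =
    (\<Prod>v\<in>insert [] (forest_verts F). 1 / fact (label_count F f v j) :: 'k::field_char_0)"
proof -
  let ?t = "tubing_of F k f" and ?s = "level_set F f j" and ?r = "level_set F f (Suc j)"
  let ?c = "\<lambda>v. label_count F f v j"
  have b: "bdry ?t ?s = {v \<in> forest_verts F. f v = j}"
    by (rule bdry_tubing_of[OF f j])
  have notin: "[] \<notin> ?r" by (simp add: level_set_def)
  have card: "card (bdry ?t ?s) = ?c [] + (\<Sum>v\<in>?r. ?c v)"
    using sum_label_count[of j] notin by (simp add: b finite_level_set)
  show ?thesis
  proof (cases "Suc j < k")
    \<comment> \<open>The minimal tube: no vertex has a label above \<open>j\<close>, so the whole
      boundary consists of roots and 1/|\<partial>s|! is the factor at \<open>[]\<close>.\<close>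
    case False
    then have "\<not> (\<exists>s'\<in>?t. s' \<subset> ?s)"
      using level_set_psubset_iff[OF f _ j] by (auto simp: tubing_of_def)
    moreover have "?r = {}"
      using False surj_labelingsD(2)[OF f] by (fastforce simp: level_set_def)
    ultimately show ?thesis
      unfolding prod_label_count using card by (simp add: shuffle_factor_def)
  next
    case True
    have inner: "inner_tube ?t ?s = ?r" by (rule inner_tube_tubing_of[OF True])
    have ex: "\<exists>s'\<in>?t. s' \<subset> ?s"
      using level_set_psubset_iff[OF f True j] True by (auto simp: tubing_of_def)
    have fc: "f_count ?t ?s v = ?c v" for v
      unfolding f_count_def b label_count_def by (rule arg_cong[where f = card]) blast
    have j0: "j_count F ?t ?s 0 = ?c []"
    proof -
      have "{v \<in> forest_verts F. f v = j} \<inter> roots F = {u \<in> forest_verts F. child_of u [] \<and> f u = j}"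
        by (auto simp: roots_def child_of_def Cons_in_forest_verts)
      then show ?thesis by (simp add: j_count_def b label_count_def)
    qed
    have ja: "j_count F ?t ?s a = (\<Sum>v\<in>tube_tree ?r a. ?c v)" if "a \<noteq> 0" for a
    proof -
      have "j_count F ?t ?s a = (\<Sum>v\<in>tube_tree ?r a. card {u \<in> bdry ?t ?s. child_of u v})"
        unfolding j_count_def inner using that
        by (simp, intro card_children_sum)
          (simp_all add: tube_tree_def finite_level_set b finite_forest_verts)
      then show ?thesis using fc by (simp add: f_count_def)
    qed
    have split: "{0..lg ?r} = insert 0 {1..lg ?r}" by auto
    have sumj: "(\<Sum>a\<in>{0..lg ?r}. j_count F ?t ?s a) = card (bdry ?t ?s)"
    proof -
      have "(\<Sum>a = 1..lg ?r. j_count F ?t ?s a) = (\<Sum>a = 1..lg ?r. \<Sum>v\<in>tube_tree ?r a. ?c v)"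
        by (rule sum.cong) (auto simp: ja)
      also have "\<dots> = (\<Sum>v\<in>?r. ?c v)"
        by (rule tube_tree_partition(1)[OF finite_level_set notin])
      finally show ?thesis
        unfolding split card by (simp add: j0)
    qed
    define P :: 'k where "P = (\<Prod>a = 1..lg ?r. fact (j_count F ?t ?s a))"
    have P0: "P \<noteq> 0" by (simp add: P_def)
    have sh0: "sh (j_count F ?t ?s) {0..lg ?r} = fact (card (bdry ?t ?s)) / (fact (?c []) * P)"
      unfolding sh_def sumj unfolding split P_def by (simp add: j0)
    have "(\<Prod>a = 1..lg ?r. sh (f_count ?t ?s) {v \<in> tube_tree ?r a. f_count ?t ?s v \<noteq> 0})
        = (\<Prod>a = 1..lg ?r. fact (j_count F ?t ?s a) / (\<Prod>v\<in>tube_tree ?r a. fact (?c v)) :: 'k)"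
    proof (rule prod.cong[OF refl])
      fix a assume "a \<in> {1..lg ?r}"
      then have "j_count F ?t ?s a = (\<Sum>v\<in>tube_tree ?r a. f_count ?t ?s v)"
        by (simp add: ja fc)
      moreover have "finite (tube_tree ?r a)" by (simp add: tube_tree_def finite_level_set)
      ultimately show "sh (f_count ?t ?s) {v \<in> tube_tree ?r a. f_count ?t ?s v \<noteq> 0}
          = (fact (j_count F ?t ?s a) / (\<Prod>v\<in>tube_tree ?r a. fact (?c v)) :: 'k)"
        by (simp only: sh_support) (simp only: fc)
    qed
    also have "\<dots> = P / (\<Prod>v\<in>?r. fact (?c v))"
      by (simp only: prod_dividef P_def tube_tree_partition(2)[OF finite_level_set notin])
    finally have "shuffle_factor F ?t ?s
        = fact (card (bdry ?t ?s)) / (fact (?c []) * P) * (P / (\<Prod>v\<in>?r. fact (?c v)) :: 'k)"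
      unfolding shuffle_factor_def inner using ex by (simp add: sh0)
    then show ?thesis
      unfolding prod_label_count using P0 notin
      by (simp add: finite_level_set prod_dividef)
  qed
qed

lemma tubing_weight:
  "(\<Prod>s\<in>tubing_of F k f. 1 / fact (card (bdry (tubing_of F k f) s)) *
     shuffle_factor F (tubing_of F k f) s) = (label_weight F f :: 'k::field_char_0)"
proof -
  have "(\<Prod>s\<in>tubing_of F k f. 1 / fact (card (bdry (tubing_of F k f) s)) *
      shuffle_factor F (tubing_of F k f) s) =
    (\<Prod>j<k. 1 / fact (card (bdry (tubing_of F k f) (level_set F f j))) *
      shuffle_factor F (tubing_of F k f) (level_set F f j) :: 'k)"
    by (subst (1) tubing_of_def, subst prod.reindex[OF inj_on_level_set[OF f]]) simp
  also have "\<dots> = (\<Prod>j<k. \<Prod>v\<in>insert [] (forest_verts F). 1 / fact (label_count F f v j))"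
    by (rule prod.cong[OF refl]) (simp only: tube_weight lessThan_iff)
  also have "\<dots> = (\<Prod>v\<in>insert [] (forest_verts F). \<Prod>j<k. 1 / fact (label_count F f v j))"
    by (rule prod.swap)
  also have "\<dots> = label_weight F f"
    using f by (simp only: label_weight_def surj_labelings_def mem_Collect_eq)
  finally show ?thesis .
qed

end

text \<open>A single label leaves no room for the strict decrease along an edge.\<close>

lemma surj_labelings_1:
  assumes "F \<noteq> replicate (length F) (Node [])" shows "surj_labelings 1 F = {}"
proof (rule ccontr)
  assume "surj_labelings 1 F \<noteq> {}"
  then obtain f where f: "f \<in> labelings 1 F" by (auto simp: surj_labelings_def)
  have "F ! i = Node []" if i: "i < length F" for i
  proof (rule ccontr)
    assume "F ! i \<noteq> Node []"
    then have "subtrees (F ! i) \<noteq> []" by (cases "F ! i") auto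
    then have "[i] \<in> forest_verts F" "[i] @ [0] \<in> forest_verts F"
      using i by (auto simp: Cons_in_forest_verts)
    moreover from this have "f ([i] @ [0]) < f [i]"
      by (rule labelings_child[OF f])
    moreover have "f [i] < 1"
      using f \<open>[i] \<in> forest_verts F\<close> unfolding labelings_def by blast
    ultimately show False by simp
  qed
  then have "F = replicate (length F) (Node [])"
    by (intro nth_equalityI) auto
  with assms show False by simp
qed

theorem mainTheorem9:
  fixes N :: nat and F :: forest
  assumes "N \<ge> 2" and "F \<in> For' N"
  shows "(chi_coeff F :: 'k::field_char_0) =
    (\<Sum>t\<in>hTub F. (- 1) ^ (card t - 1) / of_nat (card t) *
      (\<Prod>s\<in>t. 1 / fact (card (bdry t s)) * shuffle_factor F t s))"
proof -
  let ?w = "\<lambda>k. \<Sum>f\<in>surj_labelings k F. label_weight F f :: 'k"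
  let ?g = "\<lambda>t. (- 1) ^ (card t - 1) / of_nat (card t) *
      (\<Prod>s\<in>t. 1 / fact (card (bdry t s)) * shuffle_factor F t s) :: 'k"
  have N: "forest_size F = N" and ne: "F \<noteq> replicate N (Node [])"
    using assms(2) by (auto simp: For'_def For_def)
  have "forest_size (replicate n (Node [])) = n" for n
    by (induction n) simp_all
  then have "F \<noteq> replicate (length F) (Node [])"
    using N ne by metis
  then have "surj_labelings 1 F = {}"
    by (rule surj_labelings_1)
  then have w1: "?w 1 = 0"
    by (simp only: sum.empty)
  have fin: "finite (surj_labelings k F)" for k
    by (rule finite_subset[OF _ finite_labelings[of k F]]) (auto simp: surj_labelings_def)
  have "(chi_coeff F :: 'k) = (\<Sum>k = 1..N. (- 1) ^ (k - 1) / of_nat k * ?w k)"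
    using chi_coeff_eq[OF flow_coeff_eq_surj_labelings, of F] N by simp
  \<comment> \<open>The term \<open>k = 1\<close> would correspond to a single tube, which nested
    tubings exclude; it vanishes because \<open>F\<close> has an edge.\<close>
  also have "\<dots> = (\<Sum>k = 2..N. (- 1) ^ (k - 1) / of_nat k * ?w k)"
  proof (rule sum.mono_neutral_right)
    show "\<forall>k\<in>{1..N} - {2..N}. (- 1) ^ (k - 1) / of_nat k * ?w k = 0"
    proof
      fix k assume "k \<in> {1..N} - {2..N}"
      then have "k = 1" by auto
      then show "(- 1) ^ (k - 1) / of_nat k * ?w k = 0" by (simp only: w1 mult_zero_right)
    qed
  qed auto
  also have "\<dots> = (\<Sum>k = 2..N. \<Sum>f\<in>surj_labelings k F. ?g (tubing_of F k f))"
    unfolding sum_distrib_left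
    by (intro sum.cong refl) (simp only: tubing_weight card_tubing_of)
  also have "\<dots> = (\<Sum>(k, f)\<in>(SIGMA k:{2..N}. surj_labelings k F). ?g (tubing_of F k f))"
    by (rule sum.Sigma) (simp_all add: fin)
  also have "\<dots> = (\<Sum>t\<in>hTub F. ?g t)"
  proof (rule sum.reindex_bij_witness[where i = "\<lambda>t. (card t, labeling_of F t)" and
        j = "\<lambda>(k, f). tubing_of F k f"])
    fix x assume "x \<in> (SIGMA k:{2..N}. surj_labelings k F)"
    then obtain k f where x: "x = (k, f)" "2 \<le> k" "f \<in> surj_labelings k F" by auto
    show "(card (case x of (k, f) \<Rightarrow> tubing_of F k f), labeling_of F (case x of (k, f) \<Rightarrow> tubing_of F k f)) = x"
      using x by (simp add: card_tubing_of labeling_of_tubing_of)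
    show "(case x of (k, f) \<Rightarrow> tubing_of F k f) \<in> hTub F"
      using x by (simp add: tubing_of_in_hTub)
  next
    fix t assume t: "t \<in> hTub F"
    show "(case (card t, labeling_of F t) of (k, f) \<Rightarrow> tubing_of F k f) = t"
      by (simp add: tubing_of_labeling_of[OF t])
    have s: "labeling_of F t \<in> surj_labelings (card t) F"
      by (rule labeling_of_in_surj_labelings[OF t])
    \<comment> \<open>Each rank occurs as the label of a vertex, so there are at most as many tubes
      as vertices.\<close>
    then have "card t = card (labeling_of F t ` forest_verts F)"
      by (simp add: surj_labelings_def)
    also have "\<dots> \<le> N"
      using card_image_le[OF finite_forest_verts[of F], of "labeling_of F t"]
      by (simp add: card_forest_verts N)
    finally show "(card t, labeling_of F t) \<in> (SIGMA k:{2..N}. surj_labelings k F)"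
      using s hTub_card[OF t] by simp
  qed auto
  finally show ?thesis .
qed

end
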